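(* Let $M$ be a smooth $CR$ manifold of type $(n,k)$ and assume that $M$ has property $E$. Let $Y$ be an open subset of $M$ with a smooth boundary. If $Y$ is strongly pseudoconcave at a point $a\in\partial Y$, then for every open neighborhood $U$ of $a$ in $M$ there is an open neighborhood $\omega$ of $a$ in $U$ such that $$\sup_{\omega}|u|\ \le\ \sup_{Y\cap U}|u|\qquad\text{for all } u\in\mathcal{CR}(U).$$
   Context: **CR manifolds.** All manifolds are $\mathcal C^\infty$ and paracompact. A $CR$ manifold of type $(n,k)$ is a triple $(M,HM,J)$, where $M$ is a smooth manifold with $\dim_{\mathbb R}M=2n+k$, $HM\subset TM$ is a smooth real subbundle of rank $2n$, and $J:HM\to HM$ is a smooth fiber preserving isomorphism with $J^2=-I$ such that $[\Gamma(M,T^{0,1}M),\Gamma(M,T^{0,1}M)]\subset\Gamma(M,T^{0,1}M)$, where $T^{0,1}M=\{X+iJX : X\in HM\}\subset\mathbb C HM$. Put $T^{1,0}M=\overline{T^{0,1}M}$. A smooth $CR$ function on an open set $\omega\subset M$ is a smooth $f:\omega\to\mathbb C$ with $Zf=0$ for every section $Z$ of $T^{0,1}M$ over $\omega$; these form $\mathcal{CR}(\omega)$, and $\mathcal{CR}_{M,a}$ is the ring of germs at $a\in M$ of smooth $CR$ functions. The characteristic bundle is $H^0M=\{\xi\in T^*M : \xi(X)=0 \text{ for all } X\in HM \text{ over the same point}\}$. The Levi form at $\xi\in H^0_xM$ is $L(\xi,X)=\xi([J\tilde X,\tilde X])=d\tilde\xi(X,JX)$ for $X\in H_xM$, where $\tilde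 X$, $\tilde\xi$ are smooth sections of $HM$, $H^0M$ extending $X$, $\xi$. **Property $E$.** $M$ has property $E$ if there is an $E$-pair $(M,X)$: $X$ is a complex manifold, $M$ is a generic $CR$ submanifold of $X$ (so $T_aM+J_XT_aM=T_aX$ and $H_aM=T_aM\cap J_XT_aM$ with $J=J_X|_{HM}$, for all $a\in M$, where $J_X$ is the complex structure of $X$; $\dim_{\mathbb C}X=n+k$), and for each $a\in M$ restriction induces an isomorphism $\mathcal O_{X,a}\to\mathcal{CR}_{M,a}$, where $\mathcal O_{X,a}$ is the ring of germs at $a$ of holomorphic functions. (A complex manifold, $k=0$, has property $E$ with $X=M$.) **Transversal 1-jets and complex Hessian.** A $CR$ gauge on an open set $V\subset M$ is a $\mathcal C^\infty(V,\mathbb C)$-linear map $\lambda=(\lambda_1,\lambda_2)$ on smooth complex valued one-forms $\alpha$ on $V$ such that $\lambda_1(\alpha)$ vanishes on $T^{0,1}M$, $\lambda_2(\alpha)$ vanishes on $T^{1,0}M$, $\alpha=\lambda_1(\alpha)-\lambda_2(\alpha)$, and $\lambda_2(\alpha)=-\overline{\lambda_1(\bar\alpha)}$. A (smooth real) transversal $1$-jet $\phi$ on $V$ is represented in a gauge $\lambda$ by a pair $(\phi_0,\phi_1)_\lambda$, with $\phi_0$ a smooth real function on $V$ and $\phi_1$ a smooth section of $H^0M$ over $V$; in another gauge $\lambda'$ it is represented by $(\phi_0,\ \phi_1+i\lambda_1'(d\phi_0)-i\lambda_1(d\phi_0))_{\lambda'}$. Its complex Hessian is the Hermitian form on $HM$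 given by $i(\partial\bar\partial)_M\phi(X,JX)=d[\phi_1-i\lambda_1(d\phi_0)](X,JX)$ for $X\in HM$ (independent of the gauge). **Strong pseudoconcavity.** Fix a Hermitian metric $\mathbf h$ on the complex vector bundle $(HM,J)$. For $p\in V$ and $\xi\in H^0_pM$ let $\lambda_1(\phi;\xi)\le\lambda_2(\phi;\xi)\le\cdots\le\lambda_n(\phi;\xi)$ be the eigenvalues, with respect to $\mathbf h$, of the Hermitian form $i(\partial\bar\partial)_M\phi(p)+L(\xi,\cdot)$ on $H_pM$. An open $Y\subset M$ with smooth boundary is strongly pseudoconcave at $a\in\partial Y$ if there is a smooth transversal $1$-jet $\phi=(\phi_0,\phi_1)_\lambda$ on an open neighborhood $V$ of $a$ in $M$ such that: (1) $d\phi_0(a)\ne0$ and $Y\cap V=\{p\in V:\phi_0(p)<0\}$; (2) there are $c_0>0$ and an open neighborhood $\omega'$ of $a$ in $V$ with $\lambda_2(\phi;\xi)\le -c_0<0$ for all $p\in\omega'$ and all $\xi\in H^0_pM$. *)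

theory Defs
  imports "HOL-Analysis.Analysis"
begin

section \<open>Smooth manifolds\<close>

primrec Ck_on :: "nat \<Rightarrow> 'e::euclidean_space set \<Rightarrow> ('e \<Rightarrow> 'f::real_normed_vector) \<Rightarrow> bool" where
  "Ck_on 0 S f \<longleftrightarrow> continuous_on S f"
| "Ck_on (Suc k) S f \<longleftrightarrow> (\<forall>x\<in>S. f differentiable (at x)) \<and>
     (\<forall>w. Ck_on k S (\<lambda>x. frechet_derivative f (at x) w))"

text \<open>Used for open sets only.\<close>
definition Cinf_on :: "'e::euclidean_space set \<Rightarrow> ('e \<Rightarrow> 'f::real_normed_vector) \<Rightarrow> bool" where
  "Cinf_on S f \<longleftrightarrow> (\<forall>k. Ck_on k S f)"

text \<open>A manifold is a whole type \<open>'a\<close> of class \<open>t2_space\<close> with an atlas, not necessarily a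
  maximal one. A chart is a pair of a domain and a coordinate map, the values of which outside
  the domain are irrelevant.\<close>

type_synonym ('a, 'e) chart = "'a set \<times> ('a \<Rightarrow> 'e)"

definition paracompact_type :: "'a::topological_space itself \<Rightarrow> bool" where
  "paracompact_type _ \<longleftrightarrow> (\<forall>\<U>::'a set set. (\<forall>U\<in>\<U>. open U) \<and> \<Union>\<U> = UNIV \<longrightarrow>
     (\<exists>\<V>. (\<forall>V\<in>\<V>. open V \<and> (\<exists>U\<in>\<U>. V \<subseteq> U)) \<and> \<Union>\<V> = UNIV \<and> locally_finite_in euclidean \<V>))"

definition smooth_atlas :: "('a::t2_space, 'e::euclidean_space) chart set \<Rightarrow> bool" where
  "smooth_atlas A \<longleftrightarrow> (\<Union>(U, \<phi>)\<in>A. U) = UNIV \<and>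
     (\<forall>(U, \<phi>)\<in>A. open U \<and> open (\<phi> ` U) \<and> homeomorphism U (\<phi> ` U) \<phi> (inv_into U \<phi>)) \<and>
     (\<forall>(U, \<phi>)\<in>A. \<forall>(W, \<psi>)\<in>A. Cinf_on (\<phi> ` (U \<inter> W)) (\<psi> \<circ> inv_into U \<phi>))"

definition smooth_manifold :: "('a::t2_space, 'e::euclidean_space) chart set \<Rightarrow> bool" where
  "smooth_manifold A \<longleftrightarrow> smooth_atlas A \<and> paracompact_type TYPE('a)"

definition smooth_fun ::
    "('a::t2_space, 'e::euclidean_space) chart set \<Rightarrow> 'a set \<Rightarrow> ('a \<Rightarrow> 'f::real_normed_vector) \<Rightarrow> bool" where
  "smooth_fun A V f \<longleftrightarrow> (\<forall>(U, \<phi>)\<in>A. Cinf_on (\<phi> ` (U \<inter> V)) (f \<circ> inv_into U \<phi>))"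

definition smooth_at ::
    "('a::t2_space, 'e::euclidean_space) chart set \<Rightarrow> 'a \<Rightarrow> ('a \<Rightarrow> 'f::real_normed_vector) \<Rightarrow> bool" where
  "smooth_at A p f \<longleftrightarrow> (\<exists>V. open V \<and> p \<in> V \<and> smooth_fun A V f)"

section \<open>Tangent vectors, vector fields, differential forms\<close>

text \<open>Real and complexified tangent vectors at \<open>p\<close> are represented by their action, as complex
  linear derivations, on complex valued functions that are smooth near \<open>p\<close>. They are \<open>0\<close> on all
  other functions, so that equality of tangent vectors is equality of operators.\<close>

type_synonym 'a tvec = "('a \<Rightarrow> complex) \<Rightarrow> complex"
type_synonym 'a vfield = "'a \<Rightarrow> 'a tvec"
type_synonym 'a form = "'a \<Rightarrow> 'a tvec \<Rightarrow> complex"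

definition tadd :: "'a tvec \<Rightarrow> 'a tvec \<Rightarrow> 'a tvec" (infixl "+\<^sub>t" 65) where
  "X +\<^sub>t Y = (\<lambda>f. X f + Y f)"

definition tscale :: "complex \<Rightarrow> 'a tvec \<Rightarrow> 'a tvec" (infixr "*\<^sub>t" 75) where
  "c *\<^sub>t X = (\<lambda>f. c * X f)"

definition tconj :: "'a tvec \<Rightarrow> 'a tvec" where
  "tconj X = (\<lambda>f. cnj (X (\<lambda>q. cnj (f q))))"

definition lincomb :: "nat \<Rightarrow> (nat \<Rightarrow> complex) \<Rightarrow> (nat \<Rightarrow> 'a tvec) \<Rightarrow> 'a tvec" where
  "lincomb r c E = (\<lambda>f. \<Sum>i<r. c i * E i f)"

definition chart_tvec ::
    "('a::t2_space, 'e::euclidean_space) chart set \<Rightarrow> ('a, 'e) chart \<Rightarrow> 'a \<Rightarrow> 'e \<Rightarrow> 'a tvec" where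
  "chart_tvec A \<kappa> p w = (\<lambda>f. if smooth_at A p f
     then frechet_derivative (f \<circ> inv_into (fst \<kappa>) (snd \<kappa>)) (at (snd \<kappa> p)) w else 0)"

definition tangent_space ::
    "('a::t2_space, 'e::euclidean_space) chart set \<Rightarrow> 'a \<Rightarrow> 'a tvec set" where
  "tangent_space A p = {chart_tvec A \<kappa> p w | \<kappa> w. \<kappa> \<in> A \<and> p \<in> fst \<kappa>}"

definition ctangent_space ::
    "('a::t2_space, 'e::euclidean_space) chart set \<Rightarrow> 'a \<Rightarrow> 'a tvec set" where
  "ctangent_space A p = {X +\<^sub>t \<i> *\<^sub>t Y | X Y. X \<in> tangent_space A p \<and> Y \<in> tangent_space A p}"

definition smooth_section ::
    "('a::t2_space, 'e::euclidean_space) chart set \<Rightarrow> 'a set \<Rightarrow> ('a \<Rightarrow> 'a tvec set) \<Rightarrow> 'a vfield \<Rightarrow> bool" where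
  "smooth_section A V E X \<longleftrightarrow> (\<forall>p\<in>V. X p \<in> E p \<and> X p \<in> ctangent_space A p) \<and>
     (\<forall>W f. open W \<and> W \<subseteq> V \<and> smooth_fun A W f \<longrightarrow> smooth_fun A W (\<lambda>q. X q f))"

definition lie_bracket ::
    "('a::t2_space, 'e::euclidean_space) chart set \<Rightarrow> 'a vfield \<Rightarrow> 'a vfield \<Rightarrow> 'a vfield" where
  "lie_bracket A X Y = (\<lambda>p f. if smooth_at A p f
     then X p (\<lambda>q. Y q f) - Y p (\<lambda>q. X q f) else 0)"

text \<open>Complex covectors are complex linear on the complexified tangent space, and set to \<open>0\<close>
  off it, so that equality of covectors and of forms is equality of functions.\<close>

definition ccovectors ::
    "('a::t2_space, 'e::euclidean_space) chart set \<Rightarrow> 'a \<Rightarrow> ('a tvec \<Rightarrow> complex) set" where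
  "ccovectors A p = {\<xi>. (\<forall>v. v \<notin> ctangent_space A p \<longrightarrow> \<xi> v = 0) \<and>
     (\<forall>v\<in>ctangent_space A p. \<forall>w\<in>ctangent_space A p. \<forall>c d.
        \<xi> (c *\<^sub>t v +\<^sub>t d *\<^sub>t w) = c * \<xi> v + d * \<xi> w)}"

definition one_form ::
    "('a::t2_space, 'e::euclidean_space) chart set \<Rightarrow> 'a set \<Rightarrow> 'a form \<Rightarrow> bool" where
  "one_form A V \<alpha> \<longleftrightarrow> (\<forall>p\<in>V. \<alpha> p \<in> ccovectors A p) \<and> (\<forall>p. p \<notin> V \<longrightarrow> (\<forall>v. \<alpha> p v = 0)) \<and>
     (\<forall>W X. open W \<and> W \<subseteq> V \<and> smooth_section A W (ctangent_space A) X \<longrightarrow>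
        smooth_fun A W (\<lambda>q. \<alpha> q (X q)))"

definition form_conj :: "'a form \<Rightarrow> 'a form" where
  "form_conj \<alpha> = (\<lambda>p v. cnj (\<alpha> p (tconj v)))"

definition fun_diff ::
    "('a::t2_space, 'e::euclidean_space) chart set \<Rightarrow> 'a set \<Rightarrow> ('a \<Rightarrow> real) \<Rightarrow> 'a form" where
  "fun_diff A V f = (\<lambda>p v. if p \<in> V \<and> v \<in> ctangent_space A p
     then v (\<lambda>q. complex_of_real (f q)) else 0)"

text \<open>The exterior derivative of a one-form at a pair of real tangent vectors, by the formula
  \<open>d\<alpha>(X,Y) = X(\<alpha>(Y)) - Y(\<alpha>(X)) - \<alpha>([X,Y])\<close>, without a factor 1/2, for arbitrary smooth extensions
  of the two vectors (the value does not depend on them).\<close>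

definition form_diff ::
    "('a::t2_space, 'e::euclidean_space) chart set \<Rightarrow> 'a form \<Rightarrow> 'a \<Rightarrow> 'a tvec \<Rightarrow> 'a tvec \<Rightarrow> complex" where
  "form_diff A \<alpha> p v w = (THE c. \<forall>X Y W. open W \<and> p \<in> W \<and>
     smooth_section A W (tangent_space A) X \<and> smooth_section A W (tangent_space A) Y \<and>
     X p = v \<and> Y p = w \<longrightarrow>
     c = X p (\<lambda>q. \<alpha> q (Y q)) - Y p (\<lambda>q. \<alpha> q (X q)) - \<alpha> p (lie_bracket A X Y p))"

section \<open>CR manifolds\<close>

text \<open>\<open>hor M p\<close> is the fibre of \<open>HM\<close> at \<open>p\<close>; \<open>cpx M p\<close> is \<open>J\<close> at \<open>p\<close>, relevant only on \<open>hor M p\<close>.\<close>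

record ('a, 'e) cr_struct =
  atl :: "('a, 'e) chart set"
  hor :: "'a \<Rightarrow> 'a tvec set"
  cpx :: "'a \<Rightarrow> 'a tvec \<Rightarrow> 'a tvec"

definition smooth_subbundle ::
    "('a::t2_space, 'e::euclidean_space) chart set \<Rightarrow> nat \<Rightarrow> ('a \<Rightarrow> 'a tvec set) \<Rightarrow> bool" where
  "smooth_subbundle A r H \<longleftrightarrow> (\<forall>p. \<exists>V E. open V \<and> p \<in> V \<and>
     (\<forall>i<r. smooth_section A V (tangent_space A) (E i)) \<and>
     (\<forall>q\<in>V. H q = {lincomb r (\<lambda>i. complex_of_real (c i)) (\<lambda>i. E i q) | c. True} \<and>
        (\<forall>c. lincomb r (\<lambda>i. complex_of_real (c i)) (\<lambda>i. E i q) = (\<lambda>f. 0) \<longrightarrow> (\<forall>i<r. c i = 0))))"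

definition T01 :: "('a, 'e) cr_struct \<Rightarrow> 'a \<Rightarrow> 'a tvec set" where
  "T01 M p = {X +\<^sub>t \<i> *\<^sub>t cpx M p X | X. X \<in> hor M p}"

definition T10 :: "('a, 'e) cr_struct \<Rightarrow> 'a \<Rightarrow> 'a tvec set" where
  "T10 M p = tconj ` T01 M p"

definition CR_manifold :: "nat \<Rightarrow> nat \<Rightarrow> ('a::t2_space, 'e::euclidean_space) cr_struct \<Rightarrow> bool" where
  "CR_manifold n k M \<longleftrightarrow>
     smooth_manifold (atl M) \<and> DIM('e) = 2 * n + k \<and>
     smooth_subbundle (atl M) (2 * n) (hor M) \<and>
     (\<forall>p. \<forall>X\<in>hor M p. cpx M p X \<in> hor M p \<and> cpx M p (cpx M p X) = (-1) *\<^sub>t X) \<and>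
     (\<forall>p. \<forall>X\<in>hor M p. \<forall>Y\<in>hor M p. \<forall>a b.
        cpx M p (complex_of_real a *\<^sub>t X +\<^sub>t complex_of_real b *\<^sub>t Y) =
        complex_of_real a *\<^sub>t cpx M p X +\<^sub>t complex_of_real b *\<^sub>t cpx M p Y) \<and>
     (\<forall>V X. open V \<and> smooth_section (atl M) V (hor M) X \<longrightarrow>
        smooth_section (atl M) V (hor M) (\<lambda>q. cpx M q (X q))) \<and>
     (\<forall>Z W. smooth_section (atl M) UNIV (T01 M) Z \<and> smooth_section (atl M) UNIV (T01 M) W \<longrightarrow>
        smooth_section (atl M) UNIV (T01 M) (lie_bracket (atl M) Z W))"

definition CR_fun :: "('a::t2_space, 'e::euclidean_space) cr_struct \<Rightarrow> 'a set \<Rightarrow> ('a \<Rightarrow> complex) \<Rightarrow> bool" where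
  "CR_fun M V f \<longleftrightarrow> smooth_fun (atl M) V f \<and>
     (\<forall>Z. smooth_section (atl M) V (T01 M) Z \<longrightarrow> (\<forall>p\<in>V. Z p f = 0))"

text \<open>The fibre of the characteristic bundle \<open>H\<^sup>0M\<close>, with real covectors extended complex linearly.\<close>

definition H0 :: "('a::t2_space, 'e::euclidean_space) cr_struct \<Rightarrow> 'a \<Rightarrow> ('a tvec \<Rightarrow> complex) set" where
  "H0 M p = {\<xi> \<in> ccovectors (atl M) p.
     (\<forall>v\<in>tangent_space (atl M) p. \<xi> v \<in> \<real>) \<and> (\<forall>v\<in>hor M p. \<xi> v = 0)}"

definition levi_form ::
    "('a::t2_space, 'e::euclidean_space) cr_struct \<Rightarrow> 'a \<Rightarrow> ('a tvec \<Rightarrow> complex) \<Rightarrow> 'a tvec \<Rightarrow> real" where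
  "levi_form M p \<xi> v = (THE c. \<forall>X W. open W \<and> p \<in> W \<and> smooth_section (atl M) W (hor M) X \<and> X p = v \<longrightarrow>
     complex_of_real c = \<xi> (lie_bracket (atl M) (\<lambda>q. cpx M q (X q)) X p))"

section \<open>Property E\<close>

definition holo_on :: "(complex ^ 'm) set \<Rightarrow> (complex ^ 'm \<Rightarrow> complex) \<Rightarrow> bool" where
  "holo_on S f \<longleftrightarrow> (\<forall>z\<in>S. \<exists>D. (f has_derivative D) (at z) \<and> (\<forall>w. D (\<i> *s w) = \<i> * D w))"

definition complex_manifold :: "('b::t2_space, complex ^ 'm) chart set \<Rightarrow> bool" where
  "complex_manifold B \<longleftrightarrow> smooth_manifold B \<and>
     (\<forall>(U, \<phi>)\<in>B. \<forall>(W, \<psi>)\<in>B. \<forall>j. holo_on (\<phi> ` (U \<inter> W)) (\<lambda>z. \<psi> (inv_into U \<phi> z) $ j))"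

definition holo_fun :: "('b::t2_space, complex ^ 'm) chart set \<Rightarrow> 'b set \<Rightarrow> ('b \<Rightarrow> complex) \<Rightarrow> bool" where
  "holo_fun B V F \<longleftrightarrow> (\<forall>(U, \<phi>)\<in>B. holo_on (\<phi> ` (U \<inter> V)) (F \<circ> inv_into U \<phi>))"

text \<open>\<open>J\<^sub>X\<close> is multiplication by \<open>\<i>\<close> in any holomorphic chart.\<close>

definition JX :: "('b::t2_space, complex ^ 'm) chart set \<Rightarrow> 'b \<Rightarrow> 'b tvec \<Rightarrow> 'b tvec" where
  "JX B b v = (THE u. \<exists>\<kappa>\<in>B. \<exists>w. b \<in> fst \<kappa> \<and> v = chart_tvec B \<kappa> b w \<and> u = chart_tvec B \<kappa> b (\<i> *s w))"

definition push ::
    "('b::t2_space, 'c::euclidean_space) chart set \<Rightarrow> ('a \<Rightarrow> 'b) \<Rightarrow> 'a \<Rightarrow> 'a tvec \<Rightarrow> 'b tvec" where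
  "push B \<iota> p v = (\<lambda>F. if smooth_at B (\<iota> p) F then v (F \<circ> \<iota>) else 0)"

definition smooth_embedding ::
    "('a::t2_space, 'e::euclidean_space) chart set \<Rightarrow> ('b::t2_space, 'c::euclidean_space) chart set \<Rightarrow>
     ('a \<Rightarrow> 'b) \<Rightarrow> bool" where
  "smooth_embedding A B \<iota> \<longleftrightarrow> homeomorphism UNIV (range \<iota>) \<iota> (inv \<iota>) \<and>
     (\<forall>(U, \<phi>)\<in>A. \<forall>(W, \<psi>)\<in>B. Cinf_on (\<phi> ` (U \<inter> \<iota> -` W)) (\<psi> \<circ> \<iota> \<circ> inv_into U \<phi>)) \<and>
     (\<forall>p. inj_on (push B \<iota> p) (tangent_space A p))"

text \<open>The inclusion of \<open>M\<close> as a submanifold of \<open>X\<close> is an embedding \<open>\<iota>\<close>.\<close>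

definition generic_CR_submanifold ::
    "('a::t2_space, 'e::euclidean_space) cr_struct \<Rightarrow> ('b::t2_space, complex ^ 'm) chart set \<Rightarrow>
     ('a \<Rightarrow> 'b) \<Rightarrow> bool" where
  "generic_CR_submanifold M B \<iota> \<longleftrightarrow> smooth_embedding (atl M) B \<iota> \<and>
     (\<forall>p. let T = push B \<iota> p ` tangent_space (atl M) p; J = JX B (\<iota> p) in
        {v +\<^sub>t J w | v w. v \<in> T \<and> w \<in> T} = tangent_space B (\<iota> p) \<and>
        push B \<iota> p ` hor M p = T \<inter> J ` T \<and>
        (\<forall>v\<in>hor M p. push B \<iota> p (cpx M p v) = J (push B \<iota> p v)))"

definition germ :: "'a::topological_space \<Rightarrow> ('a \<Rightarrow> complex) \<Rightarrow> ('a \<Rightarrow> complex) set" where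
  "germ p f = {g. eventually (\<lambda>q. g q = f q) (nhds p)}"

definition holo_germs :: "('b::t2_space, complex ^ 'm) chart set \<Rightarrow> 'b \<Rightarrow> ('b \<Rightarrow> complex) set set" where
  "holo_germs B b = {germ b F | F W. open W \<and> b \<in> W \<and> holo_fun B W F}"

definition CR_germs :: "('a::t2_space, 'e::euclidean_space) cr_struct \<Rightarrow> 'a \<Rightarrow> ('a \<Rightarrow> complex) set set" where
  "CR_germs M p = {germ p f | f V. open V \<and> p \<in> V \<and> CR_fun M V f}"

text \<open>Restriction of germs: all members of the union below are the same germ, as \<open>\<iota>\<close> is continuous.\<close>

definition restrict_germ ::
    "('a::topological_space \<Rightarrow> 'b) \<Rightarrow> 'a \<Rightarrow> ('b \<Rightarrow> complex) set \<Rightarrow> ('a \<Rightarrow> complex) set" where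
  "restrict_germ \<iota> p \<Gamma> = (\<Union>F\<in>\<Gamma>. germ p (F \<circ> \<iota>))"

text \<open>Germs are added and multiplied through representatives, so restriction always respects the
  ring operations; it is an isomorphism iff it is bijective.\<close>

definition E_pair ::
    "nat \<Rightarrow> nat \<Rightarrow> ('a::t2_space, 'e::euclidean_space) cr_struct \<Rightarrow>
     ('b::t2_space, complex ^ 'm) chart set \<Rightarrow> ('a \<Rightarrow> 'b) \<Rightarrow> bool" where
  "E_pair n k M B \<iota> \<longleftrightarrow> complex_manifold B \<and> CARD('m) = n + k \<and> generic_CR_submanifold M B \<iota> \<and>
     (\<forall>p. bij_betw (restrict_germ \<iota> p) (holo_germs B (\<iota> p)) (CR_germs M p))"

text \<open>A definition cannot quantify over types, so the types of the points of \<open>X\<close> and of the indices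
  of its complex coordinates are arguments. A theorem that assumes \<open>property_E\<close> for arbitrary such
  types covers every \<open>M\<close> with an E-pair.\<close>

definition property_E ::
    "'b::t2_space itself \<Rightarrow> 'm::finite itself \<Rightarrow> nat \<Rightarrow> nat \<Rightarrow>
     ('a::t2_space, 'e::euclidean_space) cr_struct \<Rightarrow> bool" where
  "property_E _ _ n k M \<longleftrightarrow>
     (\<exists>(B :: ('b, complex ^ 'm) chart set) (\<iota> :: 'a \<Rightarrow> 'b). E_pair n k M B \<iota>)"

section \<open>Transversal 1-jets and the complex Hessian\<close>

type_synonym 'a gauge = "('a form \<Rightarrow> 'a form) \<times> ('a form \<Rightarrow> 'a form)"

definition form_linear ::
    "('a::t2_space, 'e::euclidean_space) chart set \<Rightarrow> 'a set \<Rightarrow> ('a form \<Rightarrow> 'a form) \<Rightarrow> bool" where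
  "form_linear A V L \<longleftrightarrow> (\<forall>\<alpha>. one_form A V \<alpha> \<longrightarrow> one_form A V (L \<alpha>)) \<and>
     (\<forall>\<alpha> \<beta> f g. one_form A V \<alpha> \<and> one_form A V \<beta> \<and> smooth_fun A V f \<and> smooth_fun A V g \<longrightarrow>
        L (\<lambda>p v. f p * \<alpha> p v + g p * \<beta> p v) = (\<lambda>p v. f p * L \<alpha> p v + g p * L \<beta> p v))"

definition CR_gauge ::
    "('a::t2_space, 'e::euclidean_space) cr_struct \<Rightarrow> 'a set \<Rightarrow> 'a gauge \<Rightarrow> bool" where
  "CR_gauge M V lam \<longleftrightarrow> form_linear (atl M) V (fst lam) \<and> form_linear (atl M) V (snd lam) \<and>
     (\<forall>\<alpha>. one_form (atl M) V \<alpha> \<longrightarrow>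
        (\<forall>p\<in>V. \<forall>v\<in>T01 M p. fst lam \<alpha> p v = 0) \<and>
        (\<forall>p\<in>V. \<forall>v\<in>T10 M p. snd lam \<alpha> p v = 0) \<and>
        \<alpha> = (\<lambda>p v. fst lam \<alpha> p v - snd lam \<alpha> p v) \<and>
        snd lam \<alpha> = (\<lambda>p v. - form_conj (fst lam (form_conj \<alpha>)) p v))"

text \<open>A transversal 1-jet is given by its representatives \<open>\<phi> lam = (\<phi>\<^sub>0, \<phi>\<^sub>1)\<close> in all the gauges.\<close>

definition transversal_jet ::
    "('a::t2_space, 'e::euclidean_space) cr_struct \<Rightarrow> 'a set \<Rightarrow> ('a gauge \<Rightarrow> ('a \<Rightarrow> real) \<times> 'a form) \<Rightarrow> bool" where
  "transversal_jet M V \<phi> \<longleftrightarrow>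
     (\<forall>lam. CR_gauge M V lam \<longrightarrow> smooth_fun (atl M) V (fst (\<phi> lam)) \<and>
        one_form (atl M) V (snd (\<phi> lam)) \<and> (\<forall>p\<in>V. snd (\<phi> lam) p \<in> H0 M p)) \<and>
     (\<forall>lam lam'. CR_gauge M V lam \<and> CR_gauge M V lam' \<longrightarrow>
        (let d\<phi>\<^sub>0 = fun_diff (atl M) V (fst (\<phi> lam)) in
         \<phi> lam' = (fst (\<phi> lam),
           \<lambda>p v. snd (\<phi> lam) p v + \<i> * fst lam' d\<phi>\<^sub>0 p v - \<i> * fst lam d\<phi>\<^sub>0 p v)))"

text \<open>The value at \<open>(X,JX)\<close> of \<open>d[\<phi>\<^sub>1 - \<i> \<lambda>\<^sub>1(d\<phi>\<^sub>0)]\<close> is real: the imaginary part of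
  \<open>\<phi>\<^sub>1 - \<i> \<lambda>\<^sub>1(d\<phi>\<^sub>0)\<close> on real vectors is \<open>- d\<phi>\<^sub>0 / 2\<close>, a closed form.\<close>

definition jet_hessian ::
    "('a::t2_space, 'e::euclidean_space) cr_struct \<Rightarrow> 'a set \<Rightarrow> 'a gauge \<Rightarrow> ('a \<Rightarrow> real) \<times> 'a form \<Rightarrow>
     'a \<Rightarrow> 'a tvec \<Rightarrow> real" where
  "jet_hessian M V lam \<phi>' p X =
     Re (form_diff (atl M)
       (\<lambda>q v. snd \<phi>' q v - \<i> * fst lam (fun_diff (atl M) V (fst \<phi>')) q v) p X (cpx M p X))"

section \<open>Strong pseudoconcavity\<close>

text \<open>Hermitian forms on \<open>(HM, J)\<close> are complex linear in the first argument.\<close>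

definition hermitian_metric ::
    "('a::t2_space, 'e::euclidean_space) cr_struct \<Rightarrow> ('a \<Rightarrow> 'a tvec \<Rightarrow> 'a tvec \<Rightarrow> complex) \<Rightarrow> bool" where
  "hermitian_metric M h \<longleftrightarrow>
     (\<forall>p. \<forall>X\<in>hor M p. \<forall>Y\<in>hor M p. \<forall>Z\<in>hor M p. \<forall>a b.
        h p (complex_of_real a *\<^sub>t X +\<^sub>t complex_of_real b *\<^sub>t Y) Z =
        complex_of_real a * h p X Z + complex_of_real b * h p Y Z) \<and>
     (\<forall>p. \<forall>X\<in>hor M p. \<forall>Y\<in>hor M p. h p (cpx M p X) Y = \<i> * h p X Y \<and> h p Y X = cnj (h p X Y)) \<and>
     (\<forall>p. \<forall>X\<in>hor M p. X \<noteq> (\<lambda>f. 0) \<longrightarrow> Re (h p X X) > 0) \<and>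
     (\<forall>V X Y. open V \<and> smooth_section (atl M) V (hor M) X \<and> smooth_section (atl M) V (hor M) Y \<longrightarrow>
        smooth_fun (atl M) V (\<lambda>p. h p (X p) (Y p)))"

text \<open>The sesquilinear form of a Hermitian form given by its values \<open>q X\<close> on the diagonal.\<close>

definition polarize :: "('a tvec \<Rightarrow> 'a tvec) \<Rightarrow> ('a tvec \<Rightarrow> real) \<Rightarrow> 'a tvec \<Rightarrow> 'a tvec \<Rightarrow> complex" where
  "polarize J q X Y = Complex ((q (X +\<^sub>t Y) - q X - q Y) / 2) ((q (X +\<^sub>t J Y) - q X - q (J Y)) / 2)"

definition jlincomb :: "('a tvec \<Rightarrow> 'a tvec) \<Rightarrow> nat \<Rightarrow> (nat \<Rightarrow> complex) \<Rightarrow> (nat \<Rightarrow> 'a tvec) \<Rightarrow> 'a tvec" where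
  "jlincomb J n c e = lincomb n (\<lambda>j. complex_of_real (Re (c j))) e
     +\<^sub>t lincomb n (\<lambda>j. complex_of_real (Im (c j))) (\<lambda>j. J (e j))"

text \<open>\<open>l\<close> is the increasing list of the \<open>n\<close> eigenvalues with respect to \<open>h\<close>, with multiplicity, of
  the Hermitian form \<open>q\<close> on the complex vector space \<open>H\<close> with complex structure \<open>J\<close>.\<close>

definition eigenvalue_list ::
    "'a tvec set \<Rightarrow> ('a tvec \<Rightarrow> 'a tvec) \<Rightarrow> ('a tvec \<Rightarrow> 'a tvec \<Rightarrow> complex) \<Rightarrow> nat \<Rightarrow> ('a tvec \<Rightarrow> real) \<Rightarrow>
     real list \<Rightarrow> bool" where
  "eigenvalue_list H J h n q l \<longleftrightarrow> length l = n \<and> sorted l \<and>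
     (\<exists>e. H = {jlincomb J n c e | c. True} \<and>
        (\<forall>c. jlincomb J n c e = (\<lambda>f. 0) \<longrightarrow> (\<forall>j<n. c j = 0)) \<and>
        (\<forall>j<n. \<forall>Y\<in>H. polarize J q (e j) Y = complex_of_real (l ! j) * h (e j) Y))"

text \<open>\<open>jet_eigenvalues \<dots> ! (j - 1)\<close> is \<open>\<lambda>\<^sub>j(\<phi>;\<xi>)\<close>.\<close>

definition jet_eigenvalues ::
    "nat \<Rightarrow> ('a::t2_space, 'e::euclidean_space) cr_struct \<Rightarrow> ('a \<Rightarrow> 'a tvec \<Rightarrow> 'a tvec \<Rightarrow> complex) \<Rightarrow>
     'a set \<Rightarrow> 'a gauge \<Rightarrow> ('a \<Rightarrow> real) \<times> 'a form \<Rightarrow> 'a \<Rightarrow> ('a tvec \<Rightarrow> complex) \<Rightarrow> real list" where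
  "jet_eigenvalues n M h V lam \<phi>' p \<xi> =
     (THE l. eigenvalue_list (hor M p) (cpx M p) (h p) n
        (\<lambda>X. jet_hessian M V lam \<phi>' p X + levi_form M p \<xi> X) l)"

definition smooth_boundary :: "('a::t2_space, 'e::euclidean_space) chart set \<Rightarrow> 'a set \<Rightarrow> bool" where
  "smooth_boundary A Y \<longleftrightarrow> (\<forall>b\<in>frontier Y. \<exists>V \<rho>. open V \<and> b \<in> V \<and> smooth_fun A V (\<rho> :: 'a \<Rightarrow> real) \<and>
     (\<exists>v. fun_diff A V \<rho> b v \<noteq> 0) \<and> Y \<inter> V = {p\<in>V. \<rho> p < 0})"

text \<open>The condition \<open>2 \<le> n\<close> is implicit in any mention of the second eigenvalue.\<close>

definition strongly_pseudoconcave_at ::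
    "nat \<Rightarrow> ('a::t2_space, 'e::euclidean_space) cr_struct \<Rightarrow> ('a \<Rightarrow> 'a tvec \<Rightarrow> 'a tvec \<Rightarrow> complex) \<Rightarrow>
     'a set \<Rightarrow> 'a \<Rightarrow> bool" where
  "strongly_pseudoconcave_at n M h Y a \<longleftrightarrow> 2 \<le> n \<and>
     (\<exists>V \<phi> lam. open V \<and> a \<in> V \<and> transversal_jet M V \<phi> \<and> CR_gauge M V lam \<and>
        (\<exists>v. fun_diff (atl M) V (fst (\<phi> lam)) a v \<noteq> 0) \<and>
        Y \<inter> V = {p\<in>V. fst (\<phi> lam) p < 0} \<and>
        (\<exists>c\<^sub>0>0. \<exists>W. open W \<and> a \<in> W \<and> W \<subseteq> V \<and>
           (\<forall>p\<in>W. \<forall>\<xi>\<in>H0 M p. jet_eigenvalues n M h V lam (\<phi> lam) p \<xi> ! 1 \<le> - c\<^sub>0)))"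

end

(*
A CR function u satisfies (X^2 + (JX)^2) u = i [JX, X] u for sections X of HM.  Suppose that
v = u^N, and that |v|^2 (delta - psi) has a local maximum at p, where psi = phi_0 + epsilon rho
for a function rho >= 0 that vanishes at a only, and v(p) <> 0, psi(p) < delta.  The vanishing of
the gradient shows that a multiple of Re (i conj(v) dv) differs on T_pM from the covector of the
jet of psi by an element xi of H^0_pM.  The second order condition along X and JX, for X in the
complex kernel of d psi(p), then says that the complex Hessian of the jet of psi plus L(xi, .) is
nonnegative at X.  Since the form has two negative eigenvalues, it is negative at some such X.  So
the maximum of |u|^2N (delta - psi) over {psi <= delta} near a is attained where phi_0 < 0, that is
in Y, and N -> infinity bounds |u| on {psi < delta} by its supremum over Y.
*)
theory Submission
  imports Defs
begin

section \<open>Calculus of smooth maps\<close>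

text \<open>The bound on the second eigenvalue holds for all \<xi> with one constant c_0, and this
  lets the argument close: the \<xi> found at a maximum depends on u, on N and on the point, and
  nothing bounds its size. As c_0 is independent of it, \<epsilon>, \<delta> and the neighborhood
  are fixed before u and N, and N may tend to infinity. Powers of u are again CR, and in the
  estimate for u^N the weight \<delta> - \<psi> contributes a factor independent of N, whose root
  tends to 1. The weight vanishes where \<psi> = \<delta>, and \<epsilon> \<rho> forces \<psi> \<ge>
  \<delta> at the points on the edge of a coordinate ball that lie outside Y; so a positive maximum
  outside Y is an interior one. Two negative eigenvalues are needed because X and JX both have to be
  killed by d \<psi>, which is one complex equation on the fibre of HM. A second obstacle is that
  Levi form, exterior derivative and eigenvalues are definite descriptions over all extensions of a
  vector or all bases. Each is shown to be well defined and is then computed in one chart and one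
  frame of HM, where the forms become quadratic forms in the frame coefficients.\<close>

abbreviation fd :: "('e::euclidean_space \<Rightarrow> 'f::real_normed_vector) \<Rightarrow> 'e \<Rightarrow> 'e \<Rightarrow> 'f" where
  "fd f z \<equiv> frechet_derivative f (at z)"

lemma fd_eqI: "(f has_derivative f') (at x) \<Longrightarrow> fd f x = f'"
  using frechet_derivative_at by metis

lemma has_derivative_fd: "f differentiable at x \<Longrightarrow> (f has_derivative fd f x) (at x)"
  using frechet_derivative_works by blast

lemma fd_cong:
  assumes "open S" "x \<in> S" "\<And>y. y \<in> S \<Longrightarrow> f y = g y" "f differentiable at x"
  shows "fd f x = fd g x"
  using frechet_derivative_transform_within_open[OF assms(4,1,2)] assms(3) by blast

section \<open>Closure properties of C^k maps\<close>

lemma Ck_on_continuous_on: "Ck_on k S f \<Longrightarrow> continuous_on S f"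
  by (cases k) (auto intro!: continuous_at_imp_continuous_on differentiable_imp_continuous_within)

lemma Ck_on_SucD: "Ck_on (Suc k) S f \<Longrightarrow> Ck_on k S f"
proof (induction k arbitrary: f)
  case 0
  then show ?case using Ck_on_continuous_on[of "Suc 0"] by simp
next
  case (Suc k)
  then show ?case by (metis Ck_on.simps(2))
qed

lemma Ck_on_subset: "Ck_on k S f \<Longrightarrow> T \<subseteq> S \<Longrightarrow> Ck_on k T f"
  by (induction k arbitrary: f) (auto intro: continuous_on_subset)

lemma Ck_on_cong:
  assumes "open S" "\<And>x. x \<in> S \<Longrightarrow> f x = g x" "Ck_on k S f"
  shows "Ck_on k S g"
  using assms(2,3)
proof (induction k arbitrary: f g)
  case 0
  then show ?case by (simp add: continuous_on_cong[of S S f g])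
next
  case (Suc k)
  have 1: "fd f x = fd g x" if "x \<in> S" for x
    using fd_cong[OF assms(1) that] Suc.prems that by auto
  have "g differentiable at x" if "x \<in> S" for x
  proof -
    have "(f has_derivative fd f x) (at x)" using Suc.prems(2) that has_derivative_fd by auto
    then have "(g has_derivative fd f x) (at x)"
      by (rule has_derivative_transform_within_open[OF _ assms(1) that Suc.prems(1)])
    then show ?thesis unfolding differentiable_def by blast
  qed
  moreover have "Ck_on k S (\<lambda>x. fd g x w)" for w
    using Suc.IH[of "\<lambda>x. fd f x w" "\<lambda>x. fd g x w"] 1 Suc.prems(2) by auto
  ultimately show ?case by simp
qed

lemma Ck_on_local:
  assumes "\<And>x. x \<in> S \<Longrightarrow> \<exists>T. open T \<and> x \<in> T \<and> Ck_on k T f"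
  shows "Ck_on k S f"
  using assms
proof (induction k arbitrary: f)
  case 0
  then show ?case
    by (auto intro!: continuous_at_imp_continuous_on simp: continuous_on_eq_continuous_at)
       (metis continuous_on_eq_continuous_at)
next
  case (Suc k)
  have "Ck_on k S (\<lambda>x. fd f x w)" for w
    by (rule Suc.IH) (use Suc.prems in fastforce)
  then show ?case using Suc.prems by fastforce
qed

lemma Ck_on_const: "Ck_on k S (\<lambda>x. c)"
  by (induction k arbitrary: c) auto

lemma Ck_on_bounded_linear:
  assumes "bounded_linear L" "Ck_on k S f" "open S"
  shows "Ck_on k S (\<lambda>x. L (f x))"
  using assms(2)
proof (induction k arbitrary: f)
  case 0
  then show ?case using assms(1)
    by (auto intro: bounded_linear.continuous_on)
next
  case (Suc k)
  have d: "((\<lambda>x. L (f x)) has_derivative (\<lambda>w. L (fd f x w))) (at x)" if "x \<in> S" for x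
    using bounded_linear.has_derivative[OF assms(1) has_derivative_fd] Suc.prems that by auto
  have "Ck_on k S (\<lambda>x. fd (\<lambda>x. L (f x)) x w)" for w
    by (rule Ck_on_cong[OF assms(3) _ Suc.IH[of "\<lambda>x. fd f x w"]])
       (use fd_eqI[OF d] Suc.prems in auto)
  then show ?case using d differentiable_def by (auto; blast)
qed

lemma Ck_on_add:
  assumes "Ck_on k S f" "Ck_on k S g" "open S"
  shows "Ck_on k S (\<lambda>x. f x + g x)"
  using assms(1,2)
proof (induction k arbitrary: f g)
  case 0
  then show ?case by (auto intro: continuous_intros)
next
  case (Suc k)
  have d: "((\<lambda>x. f x + g x) has_derivative (\<lambda>w. fd f x w + fd g x w)) (at x)" if "x \<in> S" for x
    using Suc.prems that by (auto intro!: derivative_eq_intros has_derivative_fd)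
  have "Ck_on k S (\<lambda>x. fd (\<lambda>x. f x + g x) x w)" for w
    by (rule Ck_on_cong[OF assms(3) _ Suc.IH[of "\<lambda>x. fd f x w" "\<lambda>x. fd g x w"]])
       (use fd_eqI[OF d] Suc.prems in auto)
  then show ?case using d differentiable_def by (auto; blast)
qed

lemma Ck_on_bilinear:
  assumes P: "bounded_bilinear P" and "Ck_on k S f" "Ck_on k S g" "open S"
  shows "Ck_on k S (\<lambda>x. P (f x) (g x))"
  using assms(2,3)
proof (induction k arbitrary: f g)
  case 0
  then show ?case using P by (auto intro: bounded_bilinear.continuous_on)
next
  case (Suc k)
  have d: "((\<lambda>x. P (f x) (g x)) has_derivative (\<lambda>w. P (f x) (fd g x w) + P (fd f x w) (g x))) (at x)"
    if "x \<in> S" for x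
    by (rule bounded_bilinear.FDERIV[OF P has_derivative_fd has_derivative_fd]) (use Suc.prems that in auto)
  have "Ck_on k S (\<lambda>x. fd (\<lambda>x. P (f x) (g x)) x w)" for w
    by (rule Ck_on_cong[OF assms(4) _ Ck_on_add[OF
        Suc.IH[of f "\<lambda>x. fd g x w"] Suc.IH[of "\<lambda>x. fd f x w" g] assms(4)]])
       (use fd_eqI[OF d] Suc.prems Ck_on_SucD in auto)
  then show ?case using d differentiable_def by (auto; blast)
qed

lemma Ck_on_sum:
  assumes "\<And>i. i \<in> I \<Longrightarrow> Ck_on k S (f i)" "open S"
  shows "Ck_on k S (\<lambda>x. \<Sum>i\<in>I. f i x)"
  using assms(1)
  by (induction I rule: infinite_finite_induct) (auto intro: Ck_on_const Ck_on_add[OF _ _ assms(2)])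

text \<open>\<open>Ck_on\<close> differentiates in constant directions only. Expanding a direction
  in \<open>Basis\<close> turns a derivative in a moving direction, as in the chain rule or along a
  vector field, into a sum of products that the induction on k can handle.\<close>

lemma fd_expand:
  fixes g :: "'f::euclidean_space \<Rightarrow> 'g::real_normed_vector"
  assumes "g differentiable at y"
  shows "fd g y v = (\<Sum>b\<in>Basis. (v \<bullet> b) *\<^sub>R fd g y b)"
proof -
  have l: "linear (fd g y)" using assms linear_frechet_derivative by blast
  have "fd g y v = fd g y (\<Sum>b\<in>Basis. (v \<bullet> b) *\<^sub>R b)" by (simp add: euclidean_representation)
  also have "\<dots> = (\<Sum>b\<in>Basis. (v \<bullet> b) *\<^sub>R fd g y b)"
    by (simp add: linear_sum[OF l] linear_cmul[OF l])
  finally show ?thesis .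
qed

lemma Ck_on_compose:
  fixes f :: "'e::euclidean_space \<Rightarrow> 'f::euclidean_space" and g :: "'f \<Rightarrow> 'g::real_normed_vector"
  assumes "Ck_on k S f" "Ck_on k T g" "f ` S \<subseteq> T" "open S"
  shows "Ck_on k S (\<lambda>x. g (f x))"
  using assms(1,2)
proof (induction k arbitrary: g)
  case 0
  then show ?case using assms(3) by (auto intro: continuous_on_compose2)
next
  case (Suc k)
  have d: "((\<lambda>x. g (f x)) has_derivative (\<lambda>w. fd g (f x) (fd f x w))) (at x)" if "x \<in> S" for x
    using diff_chain_at[OF has_derivative_fd[of f x] has_derivative_fd[of g "f x"]]
      Suc.prems that assms(3) by (auto simp: o_def)
  have 1: "Ck_on k S (\<lambda>x. \<Sum>b\<in>Basis. (fd f x w \<bullet> b) *\<^sub>R fd g (f x) b)" for w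
    by (intro Ck_on_sum Ck_on_bilinear[OF bounded_bilinear_scaleR] assms(4)
         Ck_on_bounded_linear[OF bounded_linear_inner_left]  Suc.IH[of "\<lambda>x. fd g x b" for b])
       (use Suc.prems Ck_on_SucD in auto)
  have "Ck_on k S (\<lambda>x. fd (\<lambda>x. g (f x)) x w)" for w
    by (rule Ck_on_cong[OF assms(4) _ 1[of w]])
       (use fd_eqI[OF d] fd_expand[of g "f x" for x] Suc.prems(2) assms(3) in auto)
  then show ?case using d differentiable_def by (auto; blast)
qed

section \<open>Smooth maps: the closure properties for all k at once\<close>

lemma Cinf_on_continuous_on: "Cinf_on S f \<Longrightarrow> continuous_on S f"
  unfolding Cinf_on_def by (metis Ck_on_continuous_on)

lemma Cinf_on_differentiable: "Cinf_on S f \<Longrightarrow> x \<in> S \<Longrightarrow> f differentiable at x"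
  unfolding Cinf_on_def using Ck_on.simps(2)[of 0 S f] by blast

lemma Cinf_on_has_derivative: "Cinf_on S f \<Longrightarrow> x \<in> S \<Longrightarrow> (f has_derivative fd f x) (at x)"
  using Cinf_on_differentiable has_derivative_fd by blast

lemma Cinf_on_linear_fd: "Cinf_on S f \<Longrightarrow> x \<in> S \<Longrightarrow> linear (fd f x)"
  using Cinf_on_differentiable linear_frechet_derivative by blast

lemma Cinf_on_fd: "Cinf_on S f \<Longrightarrow> Cinf_on S (\<lambda>x. fd f x w)"
  unfolding Cinf_on_def by (metis Ck_on.simps(2))

lemma Cinf_on_subset: "Cinf_on S f \<Longrightarrow> T \<subseteq> S \<Longrightarrow> Cinf_on T f"
  unfolding Cinf_on_def using Ck_on_subset by blast

lemma Cinf_on_cong: "open S \<Longrightarrow> (\<And>x. x \<in> S \<Longrightarrow> f x = g x) \<Longrightarrow> Cinf_on S f \<Longrightarrow> Cinf_on S g"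
  unfolding Cinf_on_def using Ck_on_cong by blast

lemma Cinf_on_local: "(\<And>x. x \<in> S \<Longrightarrow> \<exists>T. open T \<and> x \<in> T \<and> Cinf_on T f) \<Longrightarrow> Cinf_on S f"
  unfolding Cinf_on_def by (meson Ck_on_local)

lemma Cinf_on_const: "Cinf_on S (\<lambda>x. c)"
  unfolding Cinf_on_def using Ck_on_const by blast

lemma Cinf_on_bounded_linear:
  "bounded_linear L \<Longrightarrow> Cinf_on S f \<Longrightarrow> open S \<Longrightarrow> Cinf_on S (\<lambda>x. L (f x))"
  unfolding Cinf_on_def using Ck_on_bounded_linear by blast

lemma Cinf_on_add: "Cinf_on S f \<Longrightarrow> Cinf_on S g \<Longrightarrow> open S \<Longrightarrow> Cinf_on S (\<lambda>x. f x + g x)"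
  unfolding Cinf_on_def using Ck_on_add by blast

lemma Cinf_on_bilinear:
  "bounded_bilinear P \<Longrightarrow> Cinf_on S f \<Longrightarrow> Cinf_on S g \<Longrightarrow> open S \<Longrightarrow> Cinf_on S (\<lambda>x. P (f x) (g x))"
  unfolding Cinf_on_def using Ck_on_bilinear by blast

lemmas Cinf_on_scaleR = Cinf_on_bilinear[OF bounded_bilinear_scaleR]
  and Cinf_on_mult = Cinf_on_bilinear[OF bounded_bilinear_mult]

lemma Cinf_on_sum:
  "(\<And>i. i \<in> I \<Longrightarrow> Cinf_on S (f i)) \<Longrightarrow> open S \<Longrightarrow> Cinf_on S (\<lambda>x. \<Sum>i\<in>I. f i x)"
  unfolding Cinf_on_def by (intro allI Ck_on_sum) auto

lemma Cinf_on_compose: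
  fixes f :: "'e::euclidean_space \<Rightarrow> 'f::euclidean_space" and g :: "'f \<Rightarrow> 'g::real_normed_vector"
  shows "Cinf_on S f \<Longrightarrow> Cinf_on T g \<Longrightarrow> f ` S \<subseteq> T \<Longrightarrow> open S \<Longrightarrow> Cinf_on S (\<lambda>x. g (f x))"
  unfolding Cinf_on_def using Ck_on_compose by blast

lemma Cinf_on_ident: "Cinf_on S (\<lambda>x. x)"
proof -
  have "Ck_on k S (\<lambda>x. x)" for k
    by (cases k) (auto intro: Ck_on_const continuous_intros)
  then show ?thesis by (simp add: Cinf_on_def)
qed

lemma Cinf_on_linear:
  fixes L :: "'e::euclidean_space \<Rightarrow> 'f::real_normed_vector"
  shows "bounded_linear L \<Longrightarrow> open S \<Longrightarrow> Cinf_on S L"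
  using Cinf_on_bounded_linear[OF _ Cinf_on_ident] by blast

lemma Cinf_on_cmult: "Cinf_on S f \<Longrightarrow> open S \<Longrightarrow> Cinf_on S (\<lambda>x. c * f x)"
  for f :: "'e::euclidean_space \<Rightarrow> 'f::real_normed_algebra"
  by (rule Cinf_on_bounded_linear[OF bounded_linear_mult_right])

lemma Cinf_on_diff: "Cinf_on S f \<Longrightarrow> Cinf_on S g \<Longrightarrow> open S \<Longrightarrow> Cinf_on S (\<lambda>x. f x - g x)"
  using Cinf_on_add[OF _ Cinf_on_bounded_linear[OF bounded_linear_minus[OF bounded_linear_ident]]]
  by fastforce

lemma Cinf_on_power: "Cinf_on S f \<Longrightarrow> open S \<Longrightarrow> Cinf_on S (\<lambda>x. f x ^ m)"
  for f :: "'e::euclidean_space \<Rightarrow> 'f::{real_normed_algebra,monoid_mult}"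
  by (induction m) (auto intro: Cinf_on_const Cinf_on_mult)

section \<open>Derivatives along vector fields and the symmetry of second derivatives\<close>

lemma Cinf_on_fd_field:
  fixes f :: "'e::euclidean_space \<Rightarrow> 'g::real_normed_vector"
  assumes "Cinf_on S f" "Cinf_on S X" "open S"
  shows "Cinf_on S (\<lambda>z. fd f z (X z))"
proof (rule Cinf_on_cong[OF assms(3)])
  show "Cinf_on S (\<lambda>z. \<Sum>b\<in>Basis. (X z \<bullet> b) *\<^sub>R fd f z b)"
    by (intro Cinf_on_sum Cinf_on_scaleR Cinf_on_fd assms
        Cinf_on_bounded_linear[OF bounded_linear_inner_left])
qed (use fd_expand[symmetric] Cinf_on_differentiable[OF assms(1)] in auto)

text \<open>The moving direction contributes the extra term \<open>fd f p (fd X p v)\<close>; the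
  other term is a second derivative in frozen directions, symmetric in them. This split is what
  makes brackets appear and, at critical points, lets fields replace directions.\<close>

lemma fd_fd_field:
  fixes f :: "'e::euclidean_space \<Rightarrow> 'g::real_normed_vector"
  assumes f: "Cinf_on S f" and X: "Cinf_on S X" and "open S" "p \<in> S"
  shows "fd (\<lambda>z. fd f z (X z)) p v = fd (\<lambda>z. fd f z (X p)) p v + fd f p (fd X p v)"
proof -
  have d: "(\<lambda>z. fd f z w) differentiable at p" for w
    using Cinf_on_differentiable[OF Cinf_on_fd[OF f] assms(4)] .
  have e: "((\<lambda>z. \<Sum>b\<in>Basis. (X z \<bullet> b) *\<^sub>R fd f z b) has_derivative
     (\<lambda>v. \<Sum>b\<in>Basis. (X p \<bullet> b) *\<^sub>R fd (\<lambda>z. fd f z b) p v + (fd X p v \<bullet> b) *\<^sub>R fd f p b)) (at p)"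
    by (rule has_derivative_sum, rule has_derivative_scaleR)
       (auto intro!: derivative_eq_intros has_derivative_fd[OF d] Cinf_on_has_derivative[OF X assms(4)])
  have 1: "((\<lambda>z. fd f z (X z)) has_derivative
     (\<lambda>v. \<Sum>b\<in>Basis. (X p \<bullet> b) *\<^sub>R fd (\<lambda>z. fd f z b) p v + (fd X p v \<bullet> b) *\<^sub>R fd f p b)) (at p)"
    by (rule has_derivative_transform_within_open[OF e assms(3,4)])
       (use fd_expand[symmetric] Cinf_on_differentiable[OF f] in auto)
  have e2: "((\<lambda>z. \<Sum>b\<in>Basis. (X p \<bullet> b) *\<^sub>R fd f z b) has_derivative
     (\<lambda>v. \<Sum>b\<in>Basis. (X p \<bullet> b) *\<^sub>R fd (\<lambda>z. fd f z b) p v)) (at p)"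
    by (intro has_derivative_sum has_derivative_scaleR_right has_derivative_fd d)
  have 2: "((\<lambda>z. fd f z (X p)) has_derivative
     (\<lambda>v. \<Sum>b\<in>Basis. (X p \<bullet> b) *\<^sub>R fd (\<lambda>z. fd f z b) p v)) (at p)"
    by (rule has_derivative_transform_within_open[OF e2 assms(3,4)])
       (use fd_expand[symmetric] Cinf_on_differentiable[OF f] in auto)
  show ?thesis
    unfolding fd_eqI[OF 1] fd_eqI[OF 2]
    using fd_expand[OF Cinf_on_differentiable[OF f assms(4)], of "fd X p v"]
    by (simp add: sum.distrib)
qed

text \<open>The second difference of f over the parallelogram spanned by s v and s w is s^2 times a
  mixed derivative at some nearby point, for either order of differentiation. Continuity of both
  mixed derivatives at p then forces them to agree.\<close>

lemma fd_fd_symmetric_real: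
  fixes f :: "'e::euclidean_space \<Rightarrow> real"
  assumes f: "Cinf_on S f" and S: "open S" "p \<in> S"
  shows "fd (\<lambda>z. fd f z w) p v = fd (\<lambda>z. fd f z v) p w"
proof (rule ccontr)
  define H where "H v w z = fd (\<lambda>z. fd f z v) z w" for v w z
  assume "\<not> ?thesis"
  then have ne: "H w v p \<noteq> H v w p" by (simp add: H_def)
  \<comment> \<open>Half the gap: values within e of the two unequal numbers cannot
    coincide.\<close>
  define e where "e = \<bar>H w v p - H v w p\<bar> / 2"
  have e: "e > 0" using ne by (simp add: e_def)
  have cont: "continuous (at p) (H v w)" for v w
    using Cinf_on_continuous_on[OF Cinf_on_fd[OF Cinf_on_fd[OF f]]] S continuous_on_eq_continuous_at
    unfolding H_def by blast
  obtain d1 where d1: "d1 > 0" "\<And>z. dist z p < d1 \<Longrightarrow> \<bar>H w v z - H w v p\<bar> < e"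
    using cont[of w v] e unfolding continuous_at_eps_delta dist_real_def by blast
  obtain d2 where d2: "d2 > 0" "\<And>z. dist z p < d2 \<Longrightarrow> \<bar>H v w z - H v w p\<bar> < e"
    using cont[of v w] e unfolding continuous_at_eps_delta dist_real_def by blast
  obtain d3 where d3: "d3 > 0" "ball p d3 \<subseteq> S" using S open_contains_ball by blast
  define d where "d = min d1 (min d2 d3)"
  have d: "d > 0" using d1 d2 d3 by (simp add: d_def)
  \<comment> \<open>The \<open>+ 1\<close> avoids a division by zero for v = w = 0; the whole
    parallelogram lies strictly inside the ball of radius d.\<close>
  define s where "s = d / (norm v + norm w + 1) / 2"
  have s: "s > 0" using d unfolding s_def by (simp add: add_nonneg_pos)
  have small: "dist (p + a *\<^sub>R v' + b *\<^sub>R w') p < d"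
    if "0 \<le> a" "a \<le> s" "0 \<le> b" "b \<le> s" "norm v' + norm w' = norm v + norm w" for a b v' w'
  proof -
    have "dist (p + a *\<^sub>R v' + b *\<^sub>R w') p = norm (a *\<^sub>R v' + b *\<^sub>R w')"
      by (simp add: dist_norm algebra_simps)
    also have "\<dots> \<le> a * norm v' + b * norm w'" using norm_triangle_ineq[of "a *\<^sub>R v'" "b *\<^sub>R w'"] that by simp
    also have "\<dots> \<le> s * norm v' + s * norm w'" by (intro add_mono mult_right_mono that) auto
    also have "\<dots> = s * (norm v + norm w)" by (simp add: that(5) flip: distrib_left)
    also have "\<dots> < s * (2 * (norm v + norm w + 1))"
    proof (rule mult_strict_left_mono[OF _ s])
      have "N < 2 * (N + 1)" if "0 \<le> N" for N :: real using that by simp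
      from this[of "norm v + norm w"] show "norm v + norm w < 2 * (norm v + norm w + 1)" by simp
    qed
    also have "\<dots> = d"
    proof -
      have "N + 1 \<noteq> 0" if "0 \<le> N" for N :: real using that by simp
      from this[of "norm v + norm w"] have "norm v + norm w + 1 \<noteq> 0" by simp
      then show ?thesis unfolding s_def by (simp add: divide_simps)
    qed
    finally show ?thesis .
  qed
  have inS: "z \<in> S" if "dist z p < d" for z
    using that d3 by (auto simp: d_def dist_commute subset_iff)
  \<comment> \<open>Two mean value theorems: in direction v' for the increment g in direction w',
    then in direction w' for the derivative k. The claim is made for arbitrary v' and w' so that it
    serves both orders.\<close>
  have key: "\<exists>z. dist z p < d \<and>
      f (p + s *\<^sub>R v' + s *\<^sub>R w') - f (p + s *\<^sub>R v') - f (p + s *\<^sub>R w') + f p = s * s * H v' w' z"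
    if vw: "norm v' + norm w' = norm v + norm w" for v' w'
  proof -
    define g where "g t = f (p + t *\<^sub>R v' + s *\<^sub>R w') - f (p + t *\<^sub>R v')" for t
    have dg: "(g has_derivative (\<lambda>h. h * (fd f (p + t *\<^sub>R v' + s *\<^sub>R w') v' - fd f (p + t *\<^sub>R v') v'))) (at t)"
      if t: "0 \<le> t" "t \<le> s" for t
    proof -
      have z1: "p + t *\<^sub>R v' + s *\<^sub>R w' \<in> S" using small[of t s v' w'] t s vw inS by auto
      have z2: "p + t *\<^sub>R v' \<in> S" using small[of t 0 v' w'] t s vw inS by auto
      have l1: "linear (fd f (p + t *\<^sub>R v' + s *\<^sub>R w'))" and l2: "linear (fd f (p + t *\<^sub>R v'))"
        using Cinf_on_linear_fd[OF f] z1 z2 by auto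
      have a: "((\<lambda>t. p + t *\<^sub>R v' + s *\<^sub>R w') has_derivative (\<lambda>h. h *\<^sub>R v')) (at t)"
        by (auto intro!: derivative_eq_intros)
      have b: "((\<lambda>t. p + t *\<^sub>R v') has_derivative (\<lambda>h. h *\<^sub>R v')) (at t)"
        by (auto intro!: derivative_eq_intros)
      have "(g has_derivative (\<lambda>h. fd f (p + t *\<^sub>R v' + s *\<^sub>R w') (h *\<^sub>R v') - fd f (p + t *\<^sub>R v') (h *\<^sub>R v'))) (at t)"
        unfolding g_def
        by (intro has_derivative_diff diff_chain_at[OF a Cinf_on_has_derivative[OF f z1], unfolded o_def]
             diff_chain_at[OF b Cinf_on_has_derivative[OF f z2], unfolded o_def])
      then show ?thesis by (simp add: linear_cmul[OF l1] linear_cmul[OF l2] right_diff_distrib)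
    qed
    have "\<exists>t\<in>{0<..<s}. g s - g 0 = (s - 0) * (fd f (p + t *\<^sub>R v' + s *\<^sub>R w') v' - fd f (p + t *\<^sub>R v') v')"
      using mvt_simple[OF s has_derivative_at_withinI[OF dg]] by simp
    then obtain t where t: "0 < t" "t < s"
      "g s - g 0 = s * (fd f (p + t *\<^sub>R v' + s *\<^sub>R w') v' - fd f (p + t *\<^sub>R v') v')"
      by auto
    define k where "k r = fd f (p + t *\<^sub>R v' + r *\<^sub>R w') v'" for r
    have dk: "(k has_derivative (\<lambda>h. h * H v' w' (p + t *\<^sub>R v' + r *\<^sub>R w'))) (at r)" if r: "0 \<le> r" "r \<le> s" for r
    proof -
      have z1: "p + t *\<^sub>R v' + r *\<^sub>R w' \<in> S" using small[of t r v' w'] t s vw inS r by auto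
      have l1: "linear (fd (\<lambda>z. fd f z v') (p + t *\<^sub>R v' + r *\<^sub>R w'))"
        using Cinf_on_linear_fd[OF Cinf_on_fd[OF f]] z1 by auto
      have a: "((\<lambda>r. p + t *\<^sub>R v' + r *\<^sub>R w') has_derivative (\<lambda>h. h *\<^sub>R w')) (at r)"
        by (auto intro!: derivative_eq_intros)
      show ?thesis
        using diff_chain_at[OF a Cinf_on_has_derivative[OF Cinf_on_fd[OF f, of v'] z1], unfolded o_def]
        unfolding k_def H_def by (simp add: linear_cmul[OF l1])
    qed
    have "\<exists>r\<in>{0<..<s}. k s - k 0 = (s - 0) * H v' w' (p + t *\<^sub>R v' + r *\<^sub>R w')"
      using mvt_simple[OF s has_derivative_at_withinI[OF dk]] by simp
    then obtain r where r: "0 < r" "r < s" "k s - k 0 = s * H v' w' (p + t *\<^sub>R v' + r *\<^sub>R w')"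
      by auto
    have "dist (p + t *\<^sub>R v' + r *\<^sub>R w') p < d" using small[of t r v' w'] t r vw by auto
    moreover have "f (p + s *\<^sub>R v' + s *\<^sub>R w') - f (p + s *\<^sub>R v') - f (p + s *\<^sub>R w') + f p
       = s * s * H v' w' (p + t *\<^sub>R v' + r *\<^sub>R w')"
      using t(3) r(3) by (simp add: g_def k_def)
    ultimately show ?thesis by blast
  qed
  obtain z1 where z1: "dist z1 p < d"
    "f (p + s *\<^sub>R v + s *\<^sub>R w) - f (p + s *\<^sub>R v) - f (p + s *\<^sub>R w) + f p = s * s * H v w z1"
    using key[of v w] by auto
  obtain z2 where z2: "dist z2 p < d"
    "f (p + s *\<^sub>R w + s *\<^sub>R v) - f (p + s *\<^sub>R w) - f (p + s *\<^sub>R v) + f p = s * s * H w v z2"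
    using key[of w v] by (auto simp: add.commute)
  have "s * s * H v w z1 = s * s * H w v z2" using z1(2) z2(2) by (simp add: algebra_simps)
  then have "H v w z1 = H w v z2" using s by simp
  moreover have "\<bar>H v w z1 - H v w p\<bar> < e" "\<bar>H w v z2 - H w v p\<bar> < e"
    using d1 d2 z1 z2 by (auto simp: d_def)
  ultimately show False using e_def by (smt (verit) field_sum_of_halves)
qed

lemma fd_bounded_linear:
  assumes "bounded_linear L" "f differentiable at x"
  shows "fd (\<lambda>x. L (f x)) x v = L (fd f x v)"
  using fd_eqI[OF bounded_linear.has_derivative[OF assms(1) has_derivative_fd[OF assms(2)]]] by simp

text \<open>The mean value theorem is real valued, so the real and the imaginary part are treated
  separately.\<close>

lemma fd_fd_symmetric:
  fixes f :: "'e::euclidean_space \<Rightarrow> complex"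
  assumes f: "Cinf_on S f" and S: "open S" "p \<in> S"
  shows "fd (\<lambda>z. fd f z w) p v = fd (\<lambda>z. fd f z v) p w"
proof -
  have *: "L (fd (\<lambda>z. fd f z w) p v) = fd (\<lambda>z. fd (\<lambda>z. L (f z)) z w) p v"
    if "bounded_linear L" for L :: "complex \<Rightarrow> real" and v w
  proof -
    have "L (fd (\<lambda>z. fd f z w) p v) = fd (\<lambda>z. L (fd f z w)) p v"
      by (rule fd_bounded_linear[symmetric, OF that Cinf_on_differentiable[OF Cinf_on_fd[OF f] S(2)]])
    also have "\<dots> = fd (\<lambda>z. fd (\<lambda>z. L (f z)) z w) p v"
    proof (rule fun_cong[OF fd_cong[OF S]])
      show "L (fd f y w) = fd (\<lambda>z. L (f z)) y w" if "y \<in> S" for y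
        using fd_bounded_linear[OF \<open>bounded_linear L\<close> Cinf_on_differentiable[OF f that]] by simp
      show "(\<lambda>z. L (fd f z w)) differentiable at p"
        by (rule Cinf_on_differentiable[OF Cinf_on_bounded_linear[OF that Cinf_on_fd[OF f] S(1)] S(2)])
    qed
    finally show ?thesis .
  qed
  have "L (fd (\<lambda>z. fd f z w) p v) = L (fd (\<lambda>z. fd f z v) p w)" if "bounded_linear L" for L :: "complex \<Rightarrow> real"
    unfolding *[OF that]
    by (rule fd_fd_symmetric_real[OF Cinf_on_bounded_linear[OF that f S(1)] S])
  from this[OF bounded_linear_Re] this[OF bounded_linear_Im] show ?thesis
    by (simp add: complex_eq_iff)
qed

subsection \<open>A bump function\<close>

text \<open>For n = 0 this is the standard flat function exp(-1/t). The powers of 1/t are included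
  because the derivative of a member is a combination of members, so that smoothness is a plain
  induction.\<close>

definition flat :: "nat \<Rightarrow> real \<Rightarrow> real" where
  "flat n t = (if t > 0 then inverse t ^ n * exp (- inverse t) else 0)"

lemma flat_tendsto_0: "(flat n \<longlongrightarrow> 0) (at_right 0)"
proof -
  have "((\<lambda>x::real. inverse x ^ n / exp (inverse x)) \<longlongrightarrow> 0) (at_right 0)"
    using filterlim_compose[OF tendsto_power_div_exp_0 filterlim_inverse_at_top_right] .
  moreover have "eventually (\<lambda>x. inverse x ^ n / exp (inverse x) = flat n x) (at_right 0)"
    by (auto simp: eventually_at_filter flat_def exp_minus divide_inverse)
  ultimately show ?thesis by (rule Lim_transform_eventually)
qed

lemma flat_has_derivative:
  "(flat n has_field_derivative (flat (n + 2) t - real n * flat (n + 1) t)) (at t)"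
proof -
  consider "t > 0" | "t < 0" | "t = 0" by linarith
  then show ?thesis
  proof cases
    case 1
    have "((\<lambda>t. inverse t ^ n * exp (- inverse t)) has_field_derivative
       (flat (n + 2) t - real n * flat (n + 1) t)) (at t)"
    proof -
      have i: "(inverse has_field_derivative - (inverse t)\<^sup>2) (at t)"
        using DERIV_inverse[of t] 1 by (simp add: power2_eq_square)
      have pw: "((\<lambda>t. inverse t ^ n) has_field_derivative - (real n * inverse t ^ (n + 1))) (at t)"
        using DERIV_power[OF i, of n] by (cases n) (simp_all add: power2_eq_square mult_ac)
      have ex: "((\<lambda>t. exp (- inverse t)) has_field_derivative exp (- inverse t) * (inverse t)\<^sup>2) (at t)"
        using DERIV_chain2[OF DERIV_exp DERIV_minus[OF i]] by simp
      show ?thesis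
        using DERIV_mult[OF pw ex] 1 by (simp add: flat_def power2_eq_square algebra_simps)
    qed
    then show ?thesis
      by (rule has_field_derivative_transform_within_open[where S="{0<..}"]) (use 1 in \<open>auto simp: flat_def\<close>)
  next
    case 2
    have "((\<lambda>t. 0) has_field_derivative (flat (n + 2) t - real n * flat (n + 1) t)) (at t)"
      using 2 by (simp add: flat_def)
    then show ?thesis
      by (rule has_field_derivative_transform_within_open[where S="{..<0}"]) (use 2 in \<open>auto simp: flat_def\<close>)
  next
    case 3
    \<comment> \<open>For h > 0 the difference quotient of \<open>flat n\<close> at 0 is
      \<open>flat (n + 1)\<close> at h.\<close>
    have r: "((\<lambda>h. flat n h / h) \<longlongrightarrow> 0) (at_right 0)"
      by (rule Lim_transform_eventually[OF flat_tendsto_0[of "n + 1"]])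
         (auto simp: eventually_at_filter flat_def divide_inverse)
    have l: "((\<lambda>h. flat n h / h) \<longlongrightarrow> 0) (at_left 0)"
      by (rule Lim_transform_eventually[OF tendsto_const]) (auto simp: eventually_at_filter flat_def)
    have "((\<lambda>h. flat n h / h) \<longlongrightarrow> 0) (at 0)" using l r by (rule filterlim_split_at)
    then show ?thesis using 3 by (simp add: DERIV_def flat_def)
  qed
qed

lemma Cinf_on_flat: "Cinf_on UNIV (flat n)"
proof -
  have "Ck_on k UNIV (flat n)" for k n
  proof (induction k arbitrary: n)
    case 0
    have "isCont (flat n) x" for x using DERIV_isCont[OF flat_has_derivative] .
    then show ?case by (simp add: continuous_at_imp_continuous_on)
  next
    case (Suc k)
    have d: "(flat n has_derivative (\<lambda>w. w * (flat (n + 2) t - real n * flat (n + 1) t))) (at t)" for t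
      using flat_has_derivative[of n t] unfolding has_field_derivative_def by (simp add: mult_commute_abs)
    have "Ck_on k UNIV (\<lambda>t. w * (flat (n + 2) t + (- real n) * flat (n + 1) t))" for w
      by (intro Ck_on_bounded_linear[OF bounded_linear_mult_right] Ck_on_add Suc.IH) auto
    then have "Ck_on k UNIV (\<lambda>t. fd (flat n) t w)" for w
      using fd_eqI[OF d] by simp
    then show ?case using d differentiable_def by (auto; blast)
  qed
  then show ?thesis by (simp add: Cinf_on_def)
qed

lemma flat_mono: "t \<le> s \<Longrightarrow> flat 0 t \<le> flat 0 s"
  by (auto simp: flat_def)

lemma flat_less: "t < s \<Longrightarrow> 0 < s \<Longrightarrow> flat 0 t < flat 0 s"
  by (auto simp: flat_def)

text \<open>Not normalized: for r > 0 the value at the center is exp(-1/r^2). It serves both as the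
  cut-off of sections and, subtracted from that value, as the weight that localizes.\<close>

definition bump :: "real \<Rightarrow> 'e::euclidean_space \<Rightarrow> 'e \<Rightarrow> real" where
  "bump r z0 z = flat 0 (r\<^sup>2 - (dist z z0)\<^sup>2)"

lemma Cinf_on_bump: "Cinf_on UNIV (bump r z0)"
proof -
  have "Cinf_on UNIV (\<lambda>z. r\<^sup>2 - (z - z0) \<bullet> (z - z0))"
    by (intro Cinf_on_diff Cinf_on_const Cinf_on_bilinear[OF bounded_bilinear_inner] Cinf_on_ident) auto
  then have "Cinf_on UNIV (\<lambda>z. flat 0 (r\<^sup>2 - (z - z0) \<bullet> (z - z0)))"
    by (rule Cinf_on_compose[OF _ Cinf_on_flat]) auto
  then show ?thesis by (simp add: bump_def[abs_def] dist_norm power2_norm_eq_inner)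
qed

lemma bump_eq_0:
  assumes "r > 0" "r \<le> dist z z0"
  shows "bump r z0 z = 0"
proof -
  have "r\<^sup>2 \<le> (dist z z0)\<^sup>2" using assms by (intro power_mono) auto
  then show ?thesis by (simp add: bump_def flat_def)
qed

lemma bump_pos: "dist z z0 < r \<Longrightarrow> bump r z0 z > 0"
  using power_strict_mono[of "dist z z0" r 2] by (simp add: bump_def flat_def)

subsection \<open>Local maxima\<close>

text \<open>A positive second derivative along the line through p in direction w makes the first
  derivative, which is 0 at p, positive just after p, and the mean value theorem gives a larger
  value.\<close>

lemma local_max_fd_fd:
  fixes f :: "'e::euclidean_space \<Rightarrow> real"
  assumes f: "Cinf_on S f" and S: "open S" "p \<in> S" and max: "\<And>z. z \<in> S \<Longrightarrow> f z \<le> f p"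
  shows "fd f p v = 0" and "fd (\<lambda>z. fd f z w) p w \<le> 0"
proof -
  have 0: "fd f p v = 0" for v
    using differential_zero_maxmin[OF S(2,1) Cinf_on_has_derivative[OF f S(2)]] max by auto
  then show "fd f p v = 0" .
  show "fd (\<lambda>z. fd f z w) p w \<le> 0"
  proof (rule ccontr)
    assume n: "\<not> ?thesis"
    define k where "k t = fd f (p + t *\<^sub>R w) w" for t
    have a: "((\<lambda>t. p + t *\<^sub>R w) has_derivative (\<lambda>h. h *\<^sub>R w)) (at t)" for t
      by (auto intro!: derivative_eq_intros)
    have "(k has_derivative (\<lambda>h. fd (\<lambda>z. fd f z w) (p + 0 *\<^sub>R w) (h *\<^sub>R w))) (at 0)"
      unfolding k_def
      by (rule diff_chain_at[OF a Cinf_on_has_derivative[OF Cinf_on_fd[OF f]], unfolded o_def]) (use S in simp)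
    moreover have "linear (fd (\<lambda>z. fd f z w) p)"
      using Cinf_on_linear_fd[OF Cinf_on_fd[OF f] S(2)] .
    ultimately have "(k has_field_derivative fd (\<lambda>z. fd f z w) p w) (at 0)"
      unfolding has_field_derivative_def by (simp add: linear_cmul mult_commute_abs)
    moreover have "0 < fd (\<lambda>z. fd f z w) p w" using n by simp
    ultimately have "\<exists>d>0. \<forall>h>0. h < d \<longrightarrow> k 0 < k (0 + h)" by (rule DERIV_pos_inc_right)
    then obtain d where d: "d > 0" "\<And>h. 0 < h \<Longrightarrow> h < d \<Longrightarrow> 0 < k h"
      using 0[of w] by (auto simp: k_def)
    have "open ((\<lambda>t. p + t *\<^sub>R w) -` S)"
      by (rule open_vimage[OF S(1)]) (auto intro!: continuous_intros)
    then obtain d' where d': "d' > 0" "ball 0 d' \<subseteq> (\<lambda>t. p + t *\<^sub>R w) -` S"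
      using S(2) open_contains_ball by (metis (no_types, lifting) add.right_neutral scaleR_zero_left vimage_eq)
    define s where "s = min d d' / 2"
    have s: "s > 0" "s < d" "s < d'" using d d' by (auto simp: s_def)
    have inS: "p + t *\<^sub>R w \<in> S" if "0 \<le> t" "t \<le> s" for t
      using d'(2) s that by (auto simp: subset_iff dist_real_def)
    have dk: "((\<lambda>t. f (p + t *\<^sub>R w)) has_derivative (\<lambda>h. h * k t)) (at t)" if t: "0 \<le> t" "t \<le> s" for t
      using diff_chain_at[OF a[of t] Cinf_on_has_derivative[OF f inS[OF t]], unfolded o_def]
        linear_cmul[OF Cinf_on_linear_fd[OF f inS[OF t]]] by (simp add: k_def)
    have "\<exists>t\<in>{0<..<s}. f (p + s *\<^sub>R w) - f (p + 0 *\<^sub>R w) = (s - 0) * k t"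
      using mvt_simple[OF s(1) has_derivative_at_withinI[OF dk]] by simp
    then obtain t where t: "0 < t" "t < s" "f (p + s *\<^sub>R w) - f p = s * k t" by auto
    have "s * k t > 0" using d(2)[of t] t s by simp
    then show False using t(3) max[OF inS[of s]] s by simp
  qed
qed

text \<open>At a critical point the extra term of \<open>fd_fd_field\<close> vanishes, so the second
  order condition holds for a varying field as well as for a fixed direction.\<close>

lemma local_max_along_field:
  fixes f :: "'e::euclidean_space \<Rightarrow> real"
  assumes f: "Cinf_on S f" and X: "Cinf_on S X" and S: "open S" "p \<in> S" and max: "\<And>z. z \<in> S \<Longrightarrow> f z \<le> f p"
  shows "fd (\<lambda>z. fd f z (X z)) p (X p) \<le> 0"
  unfolding fd_fd_field[OF f X S] using local_max_fd_fd[OF f S max] by simp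

subsection \<open>Uniformly positive definite matrices\<close>

text \<open>The form attains its minimum on the compact unit sphere, and homogeneity does the rest.
  Coefficients are functions on all naturals, as in the frame combinations below; the coordinates
  from N on are pinned to 0 to make the sphere compact in the product topology.\<close>

lemma posdef_lower_bound:
  fixes B :: "nat \<Rightarrow> nat \<Rightarrow> real"
  assumes pos: "\<And>c. \<exists>i<N. c i \<noteq> 0 \<Longrightarrow> (\<Sum>i<N. \<Sum>j<N. c i * c j * B i j) > 0"
  shows "\<exists>m>0. \<forall>c. m * (\<Sum>i<N. (c i)\<^sup>2) \<le> (\<Sum>i<N. \<Sum>j<N. c i * c j * B i j)"
proof (cases "N = 0")
  case True
  then show ?thesis by (auto intro: exI[of _ 1])
next
  case False
  define Q where "Q c = (\<Sum>i<N. \<Sum>j<N. c i * c j * B i j)" for c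
  define n2 where "n2 c = (\<Sum>i<N. (c i)\<^sup>2)" for c :: "nat \<Rightarrow> real"
  define P where "P = PiE UNIV (\<lambda>i. if i < N then {-1..1::real} else {0})"
  define K where "K = P \<inter> {c. n2 c = 1}"
  have "compact P"
    using compactin_PiE[of "\<lambda>i::nat. euclidean :: real topology" UNIV] unfolding P_def
    by (auto simp: euclidean_product_topology)
  moreover have cn: "continuous_on UNIV n2" and cQ: "continuous_on UNIV Q"
    unfolding n2_def Q_def by (intro continuous_intros continuous_on_product_coordinates)+
  moreover have "closed {c. n2 c = 1}"
    using closed_vimage[OF _ cn, of "{1}"] by (simp add: vimage_def)
  ultimately have K: "compact K" unfolding K_def by (simp add: compact_Int_closed)
  have "(\<lambda>i. if i = 0 then 1 else 0) \<in> K"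
    using False unfolding K_def P_def n2_def by (auto simp: PiE_def if_distrib[of "\<lambda>x. x\<^sup>2"] sum.delta cong: if_cong)
  then have ne: "K \<noteq> {}" by blast
  obtain c0 where c0: "c0 \<in> K" "\<And>c. c \<in> K \<Longrightarrow> Q c0 \<le> Q c"
    using continuous_attains_inf[OF K ne continuous_on_subset[OF cQ]] by auto
  have "\<exists>i<N. c0 i \<noteq> 0"
  proof (rule ccontr)
    assume "\<not> ?thesis"
    then have "n2 c0 = 0" by (simp add: n2_def)
    then show False using c0(1) by (simp add: K_def)
  qed
  then have m: "Q c0 > 0" using pos by (simp add: Q_def)
  have "Q c0 * n2 c \<le> Q c" for c
  proof (cases "n2 c = 0")
    case True
    then have "c i = 0" if "i < N" for i using that by (simp add: n2_def sum_nonneg_eq_0_iff)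
    then show ?thesis using True by (simp add: Q_def)
  next
    case False
    then have p: "n2 c > 0" using sum_nonneg[of "{..<N}" "\<lambda>i. (c i)\<^sup>2"] by (simp add: n2_def less_le)
    define s where "s = inverse (sqrt (n2 c))"
    define d where "d i = (if i < N then s * c i else 0)" for i
    have s2: "s * s = inverse (n2 c)" using p by (simp add: s_def flip: real_sqrt_mult inverse_mult_distrib)
    have n1: "n2 d = 1"
    proof -
      have "n2 d = (\<Sum>i<N. (s * s) * (c i)\<^sup>2)" by (simp add: n2_def d_def power2_eq_square mult_ac)
      also have "\<dots> = 1" using p by (simp add: s2 n2_def flip: sum_distrib_left)
      finally show ?thesis .
    qed
    have "\<bar>d i\<bar> \<le> 1" if "i < N" for i
    proof -
      have "(d i)\<^sup>2 \<le> n2 d" unfolding n2_def using that by (intro member_le_sum) auto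
      then show ?thesis using n1 by (simp add: abs_square_le_1)
    qed
    then have "d \<in> K" using n1 by (auto simp: K_def P_def PiE_def abs_le_iff d_def)
    then have "Q c0 \<le> Q d" using c0 by blast
    also have "Q d = (\<Sum>i<N. \<Sum>j<N. (s * s) * (c i * c j * B i j))"
      unfolding Q_def d_def by (intro sum.cong) (auto simp: mult_ac)
    also have "\<dots> = Q c / n2 c" by (simp add: s2 Q_def divide_inverse mult.commute flip: sum_distrib_left)
    finally show ?thesis using p by (simp add: field_simps)
  qed
  then show ?thesis using m unfolding Q_def n2_def by blast
qed

text \<open>From 2 |a b| \<le> a^2 + b^2. The constant is crude; only its independence of c
  matters.\<close>

lemma quadratic_form_le:
  fixes B :: "nat \<Rightarrow> nat \<Rightarrow> real"
  assumes "\<And>i j. i < N \<Longrightarrow> j < N \<Longrightarrow> \<bar>B i j\<bar> \<le> C"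
  shows "\<bar>\<Sum>i<N. \<Sum>j<N. c i * c j * B i j\<bar> \<le> C * real N * (\<Sum>i<N. (c i)\<^sup>2)"
proof -
  have "\<bar>\<Sum>i<N. \<Sum>j<N. c i * c j * B i j\<bar> \<le> (\<Sum>i<N. \<Sum>j<N. C * (((c i)\<^sup>2 + (c j)\<^sup>2) / 2))"
  proof (rule order_trans[OF sum_abs], rule sum_mono, rule order_trans[OF sum_abs], rule sum_mono)
    fix i j assume ij: "i \<in> {..<N}" "j \<in> {..<N}"
    have C: "\<bar>B i j\<bar> \<le> C" using assms ij by simp
    have "0 \<le> (\<bar>c i\<bar> - \<bar>c j\<bar>)\<^sup>2" by simp
    then have "\<bar>c i * c j\<bar> \<le> ((c i)\<^sup>2 + (c j)\<^sup>2) / 2"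
      by (simp add: power2_diff abs_mult)
    then have "\<bar>c i * c j\<bar> * \<bar>B i j\<bar> \<le> ((c i)\<^sup>2 + (c j)\<^sup>2) / 2 * C"
      using C by (intro mult_mono) auto
    then show "\<bar>c i * c j * B i j\<bar> \<le> C * (((c i)\<^sup>2 + (c j)\<^sup>2) / 2)"
      by (simp add: abs_mult mult.commute)
  qed
  also have "\<dots> = C * real N * (\<Sum>i<N. (c i)\<^sup>2)"
    by (simp add: sum.distrib sum_distrib_left sum_divide_distrib[symmetric] add_divide_distrib
        sum_distrib_right algebra_simps flip: sum_distrib_left)
  finally show ?thesis .
qed

text \<open>One neighborhood works for all coefficient vectors at once, since it only has to control
  the finitely many entries.\<close>

lemma posdef_eventually_lower_bound:
  fixes B :: "nat \<Rightarrow> nat \<Rightarrow> 'e::t2_space \<Rightarrow> real"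
  assumes cont: "\<And>i j. i < N \<Longrightarrow> j < N \<Longrightarrow> isCont (B i j) z0"
    and pos: "\<And>c. \<exists>i<N. c i \<noteq> 0 \<Longrightarrow> (\<Sum>i<N. \<Sum>j<N. c i * c j * B i j z0) > 0"
  shows "\<exists>m>0. eventually (\<lambda>z. \<forall>c. m * (\<Sum>i<N. (c i)\<^sup>2) \<le> (\<Sum>i<N. \<Sum>j<N. c i * c j * B i j z)) (nhds z0)"
proof -
  obtain m where m: "m > 0" "\<And>c. m * (\<Sum>i<N. (c i)\<^sup>2) \<le> (\<Sum>i<N. \<Sum>j<N. c i * c j * B i j z0)"
    using posdef_lower_bound[of N "\<lambda>i j. B i j z0"] pos by auto
  \<comment> \<open>An error e in each entry changes the form by at most e N times the squared norm,
    which is at most half of the bound m; the \<open>+ 1\<close> covers N = 0.\<close>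
  define e where "e = m / (2 * (real N + 1))"
  have e: "e > 0" using m by (simp add: e_def)
  have "\<forall>\<^sub>F z in nhds z0. \<bar>B i j z - B i j z0\<bar> < e" if "i < N" "j < N" for i j
  proof -
    have "(B i j \<longlongrightarrow> B i j z0) (nhds z0)" using cont[OF that] by (simp add: continuous_at tendsto_nhds_iff)
    then show ?thesis using e tendstoD[of "B i j" "B i j z0" "nhds z0" e] by (simp add: dist_real_def)
  qed
  then have "\<forall>\<^sub>F z in nhds z0. \<forall>i\<in>{..<N}. \<forall>j\<in>{..<N}. \<bar>B i j z - B i j z0\<bar> < e"
    by (intro eventually_ball_finite ballI) auto
  then have "\<forall>\<^sub>F z in nhds z0. \<forall>c. m / 2 * (\<Sum>i<N. (c i)\<^sup>2) \<le> (\<Sum>i<N. \<Sum>j<N. c i * c j * B i j z)"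
  proof (eventually_elim, intro allI)
    fix z and c :: "nat \<Rightarrow> real" assume z: "\<forall>i\<in>{..<N}. \<forall>j\<in>{..<N}. \<bar>B i j z - B i j z0\<bar> < e"
    define s where "s = (\<Sum>i<N. (c i)\<^sup>2)"
    have s: "s \<ge> 0" by (simp add: s_def sum_nonneg)
    have "\<bar>\<Sum>i<N. \<Sum>j<N. c i * c j * (B i j z - B i j z0)\<bar> \<le> e * real N * s"
      unfolding s_def by (rule quadratic_form_le) (use z in \<open>auto intro: less_imp_le\<close>)
    moreover have "e * real N * s \<le> m / 2 * s"
      using m by (intro mult_right_mono s) (simp add: e_def divide_simps)
    moreover have "(\<Sum>i<N. \<Sum>j<N. c i * c j * (B i j z - B i j z0)) =
       (\<Sum>i<N. \<Sum>j<N. c i * c j * B i j z) - (\<Sum>i<N. \<Sum>j<N. c i * c j * B i j z0)"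
      by (simp add: right_diff_distrib sum_subtractf)
    ultimately have "(\<Sum>i<N. \<Sum>j<N. c i * c j * B i j z) \<ge> m * s - m / 2 * s"
      using m(2)[of c] unfolding s_def by linarith
    then show "m / 2 * (\<Sum>i<N. (c i)\<^sup>2) \<le> (\<Sum>i<N. \<Sum>j<N. c i * c j * B i j z)"
      by (simp add: s_def field_simps)
  qed
  then show ?thesis using m(1) by (intro exI[of _ "m / 2"]) simp
qed

section \<open>The spectral theorem for Hermitian forms\<close>

text \<open>A set forgets repetitions, so a family needs injectivity as well; a repetition would
  give a relation with coefficients 1 and -1.\<close>

lemma independent_family:
  fixes v :: "'i \<Rightarrow> 'e::real_vector"
  assumes "finite I" and indep: "\<And>a. (\<Sum>i\<in>I. a i *\<^sub>R v i) = 0 \<Longrightarrow> \<forall>i\<in>I. a i = 0"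
  shows "inj_on v I" and "independent (v ` I)"
proof -
  show inj: "inj_on v I"
  proof (rule inj_onI, rule ccontr)
    fix i k assume ik: "i \<in> I" "k \<in> I" "v i = v k" "i \<noteq> k"
    define a where "a x = (if x = i then 1 else if x = k then - 1 else 0 :: real)" for x
    have "(\<Sum>x\<in>I. a x *\<^sub>R v x) = (\<Sum>x\<in>{i,k}. a x *\<^sub>R v x)"
      by (rule sum.mono_neutral_right) (use assms(1) ik in \<open>auto simp: a_def\<close>)
    also have "\<dots> = 0" using ik by (simp add: a_def)
    finally show False using indep[of a] ik by (auto simp: a_def)
  qed
  show "independent (v ` I)"
  proof
    assume "dependent (v ` I)"
    then obtain u where u: "\<exists>x\<in>v ` I. u x \<noteq> 0" "(\<Sum>x\<in>v ` I. u x *\<^sub>R x) = 0"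
      using dependent_finite[of "v ` I"] assms(1) by auto
    have "(\<Sum>i\<in>I. u (v i) *\<^sub>R v i) = 0" using u(2) by (simp add: sum.reindex[OF inj])
    then show False using indep[of "\<lambda>i. u (v i)"] u(1) by auto
  qed
qed

text \<open>A complex vector space is rendered as a real subspace \<open>S\<close> with a complex structure \<open>j\<close>, and
  a Hermitian form as its real part, a symmetric \<open>j\<close>-invariant bilinear form.\<close>

locale complex_form =
  fixes S :: "'e::euclidean_space set" and j :: "'e \<Rightarrow> 'e" and g s :: "'e \<Rightarrow> 'e \<Rightarrow> real" and n :: nat
  assumes S: "subspace S" "dim S = 2 * n"
    and lin_j: "linear j" and bil_g: "bilinear g" and bil_s: "bilinear s"
    and j_in: "x \<in> S \<Longrightarrow> j x \<in> S" and jj: "x \<in> S \<Longrightarrow> j (j x) = - x"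
    and sym_g: "g x y = g y x" and sym_s: "s x y = s y x"
    and g_j: "x \<in> S \<Longrightarrow> y \<in> S \<Longrightarrow> g (j x) (j y) = g x y"
    and s_j: "x \<in> S \<Longrightarrow> y \<in> S \<Longrightarrow> s (j x) (j y) = s x y"
    and pos_g: "x \<in> S \<Longrightarrow> x \<noteq> 0 \<Longrightarrow> g x x > 0"
begin

lemmas g_simps = bilinear_ladd[OF bil_g] bilinear_radd[OF bil_g] bilinear_lmul[OF bil_g]
  bilinear_rmul[OF bil_g] bilinear_lzero[OF bil_g] bilinear_rzero[OF bil_g]
  bilinear_lneg[OF bil_g] bilinear_rneg[OF bil_g] bilinear_lsub[OF bil_g] bilinear_rsub[OF bil_g]

lemmas s_simps = bilinear_ladd[OF bil_s] bilinear_radd[OF bil_s] bilinear_lmul[OF bil_s]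
  bilinear_rmul[OF bil_s] bilinear_lzero[OF bil_s] bilinear_rzero[OF bil_s]
  bilinear_lneg[OF bil_s] bilinear_rneg[OF bil_s] bilinear_lsub[OF bil_s] bilinear_rsub[OF bil_s]

lemma g_sum: "g (sum f I) y = (\<Sum>i\<in>I. g (f i) y)"
  using bil_g linear_sum[of "\<lambda>x. g x y" f I] by (simp add: bilinear_def)

lemma g_skew: "x \<in> S \<Longrightarrow> y \<in> S \<Longrightarrow> g (j x) y = - g x (j y)"
  using g_j[of x "j y"] by (simp add: jj j_in g_simps)

lemma s_skew: "x \<in> S \<Longrightarrow> y \<in> S \<Longrightarrow> s (j x) y = - s x (j y)"
  using s_j[of x "j y"] by (simp add: jj j_in s_simps)

lemma g_x_jx: "x \<in> S \<Longrightarrow> g x (j x) = 0"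
  using g_skew[of x x] sym_g[of "j x" x] by simp

text \<open>The real part of the eigenvalue equation; since y may be replaced by \<open>j y\<close>,
  it contains the imaginary part. The zero vector is not excluded.\<close>

definition eig :: "real \<Rightarrow> 'e \<Rightarrow> bool" where
  "eig l x \<longleftrightarrow> x \<in> S \<and> (\<forall>y\<in>S. s x y = l * g x y)"

lemma eig_j: "eig l x \<Longrightarrow> eig l (j x)"
  unfolding eig_def by (simp add: g_skew s_skew j_in)

lemma eig_orth: "eig l x \<Longrightarrow> eig m y \<Longrightarrow> l \<noteq> m \<Longrightarrow> g x y = 0"
proof -
  assume a: "eig l x" "eig m y" "l \<noteq> m"
  have "l * g x y = m * g x y"
    using a sym_s[of x y] sym_g[of x y] unfolding eig_def by metis
  then show ?thesis using a by simp
qed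

text \<open>Complex linear combination, with \<i> acting as j.\<close>

definition comb :: "nat set \<Rightarrow> (nat \<Rightarrow> complex) \<Rightarrow> (nat \<Rightarrow> 'e) \<Rightarrow> 'e" where
  "comb K c e = (\<Sum>k\<in>K. Re (c k) *\<^sub>R e k + Im (c k) *\<^sub>R j (e k))"

definition jfam :: "nat set \<Rightarrow> (nat \<Rightarrow> 'e) \<Rightarrow> 'e set" where
  "jfam K e = e ` K \<union> (\<lambda>k. j (e k)) ` K"

lemma comb_in_S: "(\<And>k. k \<in> K \<Longrightarrow> e k \<in> S) \<Longrightarrow> comb K c e \<in> S"
  unfolding comb_def by (intro subspace_sum[OF S(1)] subspace_add[OF S(1)] subspace_scale[OF S(1)] j_in)

lemma comb_in_span: "comb K c e \<in> span (jfam K e)"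
  unfolding comb_def jfam_def by (intro span_sum span_add span_scale span_base) auto

text \<open>A complex relation among the \<open>e k\<close> is a real relation among the
  \<open>e k\<close> and the \<open>j (e k)\<close>. Indexing by pairs of an index and a truth value
  counts the doubled family without assuming beforehand that its members are distinct.\<close>

lemma jfam_independent:
  assumes K: "finite K" and indep: "\<And>c. comb K c e = 0 \<Longrightarrow> \<forall>k\<in>K. c k = 0"
  shows "independent (jfam K e)" and "card (jfam K e) = 2 * card K"
proof -
  define v where "v i = (if snd i then j (e (fst i)) else e (fst i))" for i :: "nat \<times> bool"
  have im: "v ` (K \<times> UNIV) = jfam K e"
    by (force simp: v_def jfam_def image_iff UNIV_bool)
  have *: "\<forall>i\<in>K \<times> UNIV. a i = 0" if "(\<Sum>i\<in>K \<times> UNIV. a i *\<^sub>R v i) = 0" for a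
  proof -
    have "(\<Sum>i\<in>K \<times> UNIV. a i *\<^sub>R v i) = (\<Sum>k\<in>K. \<Sum>b\<in>UNIV. a (k, b) *\<^sub>R v (k, b))"
      by (simp add: sum.cartesian_product)
    also have "\<dots> = comb K (\<lambda>k. Complex (a (k, False)) (a (k, True))) e"
      unfolding comb_def by (intro sum.cong) (auto simp: UNIV_bool v_def)
    finally have "comb K (\<lambda>k. Complex (a (k, False)) (a (k, True))) e = 0" using that by simp
    from indep[OF this] have "\<forall>k\<in>K. Complex (a (k, False)) (a (k, True)) = 0" .
    then have "a (k, b) = 0" if "k \<in> K" for k b using that by (cases b) (auto simp: complex_eq_iff)
    then show ?thesis by auto
  qed
  have fin: "finite (K \<times> (UNIV :: bool set))" using K by simp
  note ind = independent_family[of "K \<times> UNIV" v, OF fin *, unfolded im]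
  show "independent (jfam K e)" using ind(2) .
  show "card (jfam K e) = 2 * card K" using card_image[OF ind(1)] im by (simp add: card_cartesian_product)
qed

lemma jfam_in_S: "(\<And>k. k \<in> K \<Longrightarrow> e k \<in> S) \<Longrightarrow> jfam K e \<subseteq> S"
  unfolding jfam_def using j_in by auto

text \<open>Orthonormality for the Hermitian form with real part g: its imaginary part at x and y is
  \<open>g x (j y)\<close>.\<close>

definition orth :: "nat \<Rightarrow> (nat \<Rightarrow> 'e) \<Rightarrow> bool" where
  "orth m e \<longleftrightarrow> (\<forall>i<m. e i \<in> S) \<and>
     (\<forall>i<m. \<forall>k<m. g (e i) (e k) = (if i = k then 1 else 0) \<and> g (e i) (j (e k)) = 0)"

lemma orth_comb:
  assumes "orth m e" "k < m"
  shows "g (comb {..<m} c e) (e k) = Re (c k)" "g (comb {..<m} c e) (j (e k)) = Im (c k)"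
proof -
  have *: "g (j (e i)) (e k) = 0" "g (j (e i)) (j (e k)) = (if i = k then 1 else 0)"
    "g (e i) (e k) = (if i = k then 1 else 0)" "g (e i) (j (e k)) = 0" if "i < m" for i
    using assms that by (auto simp: orth_def g_skew g_j)
  show "g (comb {..<m} c e) (e k) = Re (c k)" "g (comb {..<m} c e) (j (e k)) = Im (c k)"
    unfolding comb_def using assms(2)
    by (auto simp: g_sum g_simps * if_distrib[of "\<lambda>x. _ * x"] cong: if_cong)
qed

lemma orth_indep: "orth m e \<Longrightarrow> comb {..<m} c e = 0 \<Longrightarrow> \<forall>k\<in>{..<m}. c k = 0"
  using orth_comb[of m e _ c] by (auto simp: complex_eq_iff g_simps)

lemma orth_le: "orth m e \<Longrightarrow> m \<le> n"
proof -
  assume o: "orth m e"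
  have "card (jfam {..<m} e) \<le> dim S"
    by (rule independent_card_le_dim[OF jfam_in_S jfam_independent(1)])
       (use o orth_indep in \<open>auto simp: orth_def\<close>)
  moreover have "card (jfam {..<m} e) = 2 * m"
    using jfam_independent(2)[of "{..<m}" e] orth_indep[OF o] by simp
  ultimately show ?thesis using S(2) by simp
qed

text \<open>The complex orthogonal complement of the family in S.\<close>

definition W :: "nat \<Rightarrow> (nat \<Rightarrow> 'e) \<Rightarrow> 'e set" where
  "W m e = {x \<in> S. \<forall>i<m. g x (e i) = 0 \<and> g x (j (e i)) = 0}"

lemma W_residual:
  assumes "orth m e" "x \<in> S"
  shows "x - comb {..<m} (\<lambda>k. Complex (g x (e k)) (g x (j (e k)))) e \<in> W m e"
  using assms orth_comb[OF assms(1)] comb_in_S[of "{..<m}" e]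
  by (auto simp: W_def g_simps orth_def intro!: subspace_diff[OF S(1)])

lemma subspace_W: "subspace (W m e)"
  using S(1) unfolding W_def subspace_def by (auto simp: g_simps)

text \<open>The invariant of a construction by successive minimization. The last clause, that the
  Rayleigh quotient on the complement stays above all eigenvalues found so far, makes the next one
  at least as large.\<close>

definition spec :: "nat \<Rightarrow> (nat \<Rightarrow> 'e) \<Rightarrow> (nat \<Rightarrow> real) \<Rightarrow> bool" where
  "spec m e l \<longleftrightarrow> orth m e \<and> (\<forall>i<m. eig (l i) (e i)) \<and> (\<forall>i<m. \<forall>k<m. i \<le> k \<longrightarrow> l i \<le> l k) \<and>
     (\<forall>i<m. \<forall>x\<in>W m e. l i * g x x \<le> s x x)"

text \<open>The quotient of s by g is homogeneous of degree 0, so it can be minimized on the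
  Euclidean unit sphere of V, which is compact; the minimizer is then rescaled to g-length
  1.\<close>

lemma rayleigh_minimum:
  assumes V: "subspace V" "V \<subseteq> S" "V \<noteq> {0}"
  obtains x l where "x \<in> V" "g x x = 1" "s x x = l" "\<And>y. y \<in> V \<Longrightarrow> l * g y y \<le> s y y"
proof -
  let ?K = "{x \<in> V. norm x = 1}"
  obtain v where v: "v \<in> V" "v \<noteq> 0" using V subspace_0 by fastforce
  have "v /\<^sub>R norm v \<in> ?K" using v subspace_scale[OF V(1)] by auto
  then have ne: "?K \<noteq> {}" by blast
  have "?K = V \<inter> sphere 0 1" by auto
  then have K: "compact ?K" using closed_subspace[OF V(1)] by (simp add: closed_Int_compact)
  have cg: "continuous_on ?K (\<lambda>x. g x x)" and cs: "continuous_on ?K (\<lambda>x. s x x)"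
    using bounded_bilinear.continuous_on[OF bil_g[unfolded bilinear_conv_bounded_bilinear] continuous_on_id continuous_on_id]
      bounded_bilinear.continuous_on[OF bil_s[unfolded bilinear_conv_bounded_bilinear] continuous_on_id continuous_on_id]
    by auto
  have pos: "g x x > 0" if "x \<in> V" "x \<noteq> 0" for x using pos_g that V(2) by auto
  have "continuous_on ?K (\<lambda>x. s x x / g x x)"
    by (rule continuous_on_divide[OF cs cg]) (use pos in fastforce)
  then obtain x0 where x0: "x0 \<in> ?K" "\<And>y. y \<in> ?K \<Longrightarrow> s x0 x0 / g x0 x0 \<le> s y y / g y y"
    using continuous_attains_inf[OF K ne] by blast
  define l where "l = s x0 x0 / g x0 x0"
  have p0: "g x0 x0 > 0" using pos x0 by force
  have min: "l * g y y \<le> s y y" if y: "y \<in> V" for y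
  proof (cases "y = 0")
    case False
    let ?y = "y /\<^sub>R norm y"
    have "?y \<in> ?K" using y False subspace_scale[OF V(1)] by auto
    from x0(2)[OF this] have "l \<le> s y y / g y y" using False by (simp add: l_def s_simps g_simps)
    then show ?thesis using pos[OF y False] by (simp add: field_simps)
  qed (simp add: g_simps s_simps)
  let ?x = "(1 / sqrt (g x0 x0)) *\<^sub>R x0"
  show ?thesis
  proof (rule that[of ?x l])
    show "?x \<in> V" using x0 subspace_scale[OF V(1)] by auto
    show "g ?x ?x = 1" using p0 by (simp add: g_simps)
    show "s ?x ?x = l" using p0 by (simp add: s_simps l_def)
  qed (rule min)
qed

lemma spec_extend:
  assumes sp: "spec m e l" and ne: "W m e \<noteq> {0}"
  shows "\<exists>e l. spec (Suc m) e l"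
proof -
  have o: "orth m e" using sp by (simp add: spec_def)
  have WS: "W m e \<subseteq> S" by (auto simp: W_def)
  obtain x r where x: "x \<in> W m e" "g x x = 1" "s x x = r" "\<And>y. y \<in> W m e \<Longrightarrow> r * g y y \<le> s y y"
    using rayleigh_minimum[OF subspace_W WS ne] by blast
  have xS: "x \<in> S" using x WS by auto
  \<comment> \<open>First variation: along x + t y the form s - r g stays nonnegative on the
    complement and is 0 at t = 0, so its linear coefficient vanishes.\<close>
  have eW: "s x y = r * g x y" if y: "y \<in> W m e" for y
  proof (rule ccontr)
    assume n: "s x y \<noteq> r * g x y"
    define f where "f = s x y - r * g x y"
    define d where "d = s y y - r * g y y"
    have d: "d \<ge> 0" using x(4)[OF y] by (simp add: d_def)
    have q: "0 \<le> 2 * t * f + t\<^sup>2 * d" for t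
    proof -
      have "x + t *\<^sub>R y \<in> W m e" using x y subspace_W subspace_add subspace_scale by blast
      from x(4)[OF this] show ?thesis
        using x(2,3) sym_s[of y x] sym_g[of y x]
        by (simp add: s_simps g_simps f_def d_def algebra_simps power2_eq_square)
    qed
    \<comment> \<open>The value t = - f / (d + 1) makes the quadratic polynomial negative; the
      \<open>+ 1\<close> allows d = 0.\<close>
    have "2 * (- f / (d + 1)) * f + (- f / (d + 1))\<^sup>2 * d = - (f\<^sup>2 * (d + 2)) / (d + 1)\<^sup>2"
      using d by (simp add: divide_simps power2_eq_square add_nonneg_eq_0_iff) (simp add: algebra_simps)
    moreover have "f\<^sup>2 * (d + 2) / (d + 1)\<^sup>2 > 0" using d n by (simp add: f_def)
    ultimately show False using q[of "- f / (d + 1)"] by simp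
  qed
  have ex: "eig r x"
    unfolding eig_def
  proof (intro conjI ballI xS)
    fix y assume y: "y \<in> S"
    define c where "c k = Complex (g y (e k)) (g y (j (e k)))" for k
    let ?c = "comb {..<m} c e"
    \<comment> \<open>Both sides are 0: x is orthogonal to \<open>e i\<close> and
      \<open>j (e i)\<close>, and these are eigenvectors.\<close>
    have b: "s x (e i) = r * g x (e i) \<and> s x (j (e i)) = r * g x (j (e i))" if i: "i < m" for i
    proof -
      have ei: "eig (l i) (e i)" and ei': "eig (l i) (j (e i))" using sp i eig_j by (auto simp: spec_def)
      have "g x (e i) = 0" "g x (j (e i)) = 0" using x i by (auto simp: W_def)
      moreover have "s x (e i) = l i * g x (e i)"
        using ei xS by (simp add: eig_def sym_s[of x] sym_g[of x])
      moreover have "s x (j (e i)) = l i * g x (j (e i))"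
        using ei' xS by (simp add: eig_def sym_s[of x] sym_g[of x])
      ultimately show ?thesis by simp
    qed
    have lg: "linear (\<lambda>y. g x y)" and ls: "linear (\<lambda>y. s x y)" using bil_g bil_s by (auto simp: bilinear_def)
    have "s x ?c = r * g x ?c"
      unfolding comb_def linear_sum[OF lg] linear_sum[OF ls]
      by (simp add: b g_simps s_simps sum_distrib_left algebra_simps)
    moreover have "s x (y - ?c) = r * g x (y - ?c)"
      using eW[OF W_residual[OF o y]] unfolding c_def .
    ultimately show "s x y = r * g x y" by (simp add: s_simps g_simps algebra_simps)
  qed
  define e' where "e' = e(m := x)"
  define l' where "l' = l(m := r)"
  have xe: "g x (e i) = 0" "g x (j (e i)) = 0" "g (e i) x = 0" "g (e i) (j x) = 0" "e i \<in> S" if "i < m" for i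
  proof -
    show eS: "e i \<in> S" using o that by (simp add: orth_def)
    show a: "g x (e i) = 0" "g x (j (e i)) = 0" using x that by (auto simp: W_def)
    then show "g (e i) x = 0" using sym_g by metis
    show "g (e i) (j x) = 0" using a g_skew[OF xS eS] sym_g by (metis neg_equal_0_iff_equal)
  qed
  have "orth (Suc m) e'"
    using o x(2) g_x_jx[OF xS] xe xS unfolding orth_def e'_def by (auto simp: less_Suc_eq)
  moreover have "\<forall>i<Suc m. eig (l' i) (e' i)"
    using sp ex by (auto simp: spec_def e'_def l'_def less_Suc_eq)
  moreover have "l i \<le> r" if "i < m" for i
    using sp x(1) that x(2,3) unfolding spec_def by (metis mult.right_neutral)
  then have "\<forall>i<Suc m. l' i \<le> r"
    by (auto simp: l'_def less_Suc_eq)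
  moreover have "\<forall>i<Suc m. \<forall>k<Suc m. i \<le> k \<longrightarrow> l' i \<le> l' k"
    using calculation(3) sp by (auto simp: spec_def l'_def less_Suc_eq)
  moreover have "W (Suc m) e' \<subseteq> W m e" by (auto simp: W_def e'_def)
  then have "\<forall>i<Suc m. \<forall>y\<in>W (Suc m) e'. l' i * g y y \<le> s y y"
    using sp x(4) by (auto simp: spec_def l'_def less_Suc_eq)
  ultimately have "spec (Suc m) e' l'" unfolding spec_def by blast
  then show ?thesis by blast
qed

lemma W_nontrivial: "orth m e \<Longrightarrow> m < n \<Longrightarrow> W m e \<noteq> {0}"
proof
  assume o: "orth m e" and m: "m < n" and W0: "W m e = {0}"
  have "S \<subseteq> span (jfam {..<m} e)"
  proof
    fix x assume "x \<in> S"
    from W_residual[OF o this] W0 show "x \<in> span (jfam {..<m} e)"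
      using comb_in_span by (metis eq_iff_diff_eq_0 singletonD)
  qed
  then have "dim S \<le> card (jfam {..<m} e)"
    by (rule dim_le_card) (simp add: jfam_def)
  also have "\<dots> \<le> m + m" unfolding jfam_def
    by (rule order_trans[OF card_Un_le add_mono]) (use card_image_le[of "{..<m}"] in auto)
  finally show False using S(2) m by simp
qed

lemma spec_exists: "\<exists>e l. spec n e l"
proof -
  have "m \<le> n \<Longrightarrow> \<exists>e l. spec m e l" for m
  proof (induction m)
    case 0
    then show ?case by (auto simp: spec_def orth_def)
  next
    case (Suc m)
    then obtain e l where sp: "spec m e l" by auto
    then show ?case
      using spec_extend[OF sp W_nontrivial] Suc.prems by (auto simp: spec_def)
  qed
  then show ?thesis by simp
qed

section \<open>Expansion in eigenvectors and uniqueness of the eigenvalues\<close>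

lemma spec_expand:
  assumes sp: "spec n e l" and x: "x \<in> S"
  shows "x = comb {..<n} (\<lambda>k. Complex (g x (e k)) (g x (j (e k)))) e"
proof -
  have o: "orth n e" using sp by (simp add: spec_def)
  \<comment> \<open>Otherwise \<open>spec_extend\<close> would produce n + 1 orthonormal vectors,
    contrary to \<open>orth_le\<close>.\<close>
  have "W n e = {0}"
    using spec_extend[OF sp] orth_le unfolding spec_def by (meson Suc_n_not_le_n)
  then show ?thesis using W_residual[OF o x] by auto
qed

definition eigenfam :: "(nat \<Rightarrow> 'e) \<Rightarrow> real list \<Rightarrow> bool" where
  "eigenfam e l \<longleftrightarrow> length l = n \<and> sorted l \<and> S = {comb {..<n} c e | c. True} \<and>
     (\<forall>c. comb {..<n} c e = 0 \<longrightarrow> (\<forall>k<n. c k = 0)) \<and> (\<forall>k<n. eig (l ! k) (e k))"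

lemma spec_eigenfam:
  assumes sp: "spec n e l" shows "eigenfam e (map l [0..<n])"
proof -
  have o: "orth n e" using sp by (simp add: spec_def)
  have "sorted (map l [0..<n])" using sp by (auto simp: spec_def sorted_iff_nth_mono)
  moreover have "S = {comb {..<n} c e | c. True}"
    using spec_expand[OF sp] comb_in_S[of "{..<n}" e] o by (fastforce simp: orth_def)
  ultimately show ?thesis
    using orth_indep[OF o] sp unfolding eigenfam_def spec_def by (intro conjI) simp_all
qed

text \<open>An eigenvector for \<open>l ! k\<close> has no component along \<open>f m\<close> unless
  \<open>r m\<close> is the same number, so the \<open>e k\<close> with k in K lie in the complex
  span of the \<open>f m\<close> with m in L. Both dimensions are counted over the reals, with a
  factor 2 that cancels.\<close>

lemma eigenfam_card_le:
  assumes ef: "eigenfam e l" and sp: "spec n f r" and K: "K \<subseteq> {..<n}" and L: "L \<subseteq> {..<n}"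
    and ne: "\<And>k m. k \<in> K \<Longrightarrow> m < n \<Longrightarrow> m \<notin> L \<Longrightarrow> l ! k \<noteq> r m"
  shows "card K \<le> card L"
proof -
  have fin: "finite K" "finite L" using K L finite_subset by auto
  have in_span: "x \<in> span (jfam L f)" if x: "eig (l ! k) x" and k: "k \<in> K" for x k
  proof -
    define c where "c k = Complex (g x (f k)) (g x (j (f k)))" for k
    have "c m = 0" if "m < n" "m \<notin> L" for m
    proof -
      have "eig (r m) (f m)" "eig (r m) (j (f m))" using sp that eig_j by (auto simp: spec_def)
      then show ?thesis using eig_orth[OF x _ ne[OF k that]] by (simp add: c_def complex_eq_iff)
    qed
    then have "comb {..<n} c f = comb L c f"
      unfolding comb_def by (intro sum.mono_neutral_right) (use L in auto)
    moreover have "x = comb {..<n} c f" using spec_expand[OF sp, of x] x by (simp add: c_def[abs_def] eig_def)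
    ultimately show ?thesis using comb_in_span by metis
  qed
  have "jfam K e \<subseteq> span (jfam L f)"
    using in_span ef K eig_j unfolding jfam_def[of K] eigenfam_def by (auto; blast)
  moreover have ind: "\<forall>k\<in>K. c k = 0" if "comb K c e = 0" for c
  proof -
    define c' where "c' k = (if k \<in> K then c k else 0)" for k
    have "comb {..<n} c' e = comb K c' e"
      unfolding comb_def by (intro sum.mono_neutral_right) (use K in \<open>auto simp: c'_def\<close>)
    also have "\<dots> = comb K c e" unfolding comb_def by (intro sum.cong) (auto simp: c'_def)
    finally have "\<forall>k<n. c' k = 0" using ef that by (metis eigenfam_def)
    then show ?thesis using K by (auto simp: c'_def)
  qed
  ultimately have "card (jfam K e) \<le> card (jfam L f)"
    using independent_span_bound[of "jfam L f" "jfam K e"] jfam_independent(1)[OF fin(1) ind] fin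
    by (auto simp: jfam_def)
  also have "\<dots> \<le> card L + card L" unfolding jfam_def
    by (rule order_trans[OF card_Un_le add_mono]) (use card_image_le[OF fin(2)] in auto)
  finally show ?thesis using jfam_independent(2)[OF fin(1) ind] by simp
qed

text \<open>If \<open>l ! i < r i\<close>, then the i + 1 vectors e 0, ..., e i would lie in the
  span of the i vectors f 0, ..., f (i - 1), since from index i on the r m are larger than the
  eigenvalues in question. The opposite inequality is excluded in the same way from the top
  end.\<close>

lemma eigenfam_unique:
  assumes ef: "eigenfam e l" and sp: "spec n f r"
  shows "l = map r [0..<n]"
proof (rule nth_equalityI)
  have len: "length l = n" and sorted: "sorted l" using ef by (auto simp: eigenfam_def)
  show "length l = length (map r [0..<n])" using len by simp
  fix i assume "i < length l"
  then have i: "i < n" using len by simp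
  have mono: "l ! a \<le> l ! b" if "a \<le> b" "b < n" for a b
    using sorted len that by (simp add: sorted_nth_mono)
  have rmono: "r a \<le> r b" if "a \<le> b" "b < n" for a b using sp that by (simp add: spec_def)
  have "\<not> l ! i < r i"
  proof
    assume a: "l ! i < r i"
    have "card {..i} \<le> card {..<i}"
    proof (rule eigenfam_card_le[OF ef sp])
      fix k m assume "k \<in> {..i}" "m < n" "m \<notin> {..<i}"
      then show "l ! k \<noteq> r m" using a mono[of k i] rmono[of i m] i by auto
    qed (use i in auto)
    then show False by simp
  qed
  moreover have "\<not> r i < l ! i"
  proof
    assume a: "r i < l ! i"
    have "card {i..<n} \<le> card {Suc i..<n}"
    proof (rule eigenfam_card_le[OF ef sp])
      fix k m assume "k \<in> {i..<n}" "m < n" "m \<notin> {Suc i..<n}"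
      then show "l ! k \<noteq> r m" using a mono[of i k] rmono[of m i] i by auto
    qed (use i in auto)
    then show False using i by simp
  qed
  ultimately show "l ! i = map r [0..<n] ! i" using i by simp
qed

text \<open>On the complex plane spanned by the first two eigenvectors s is at most r g. The
  conditions F x = 0 and F (j x) = 0 amount to one complex linear equation, so the plane contains a
  nonzero solution.\<close>

lemma spec_second:
  assumes sp: "spec n f l" and n: "2 \<le> n" and l1: "l 1 \<le> r" and F: "linear (F :: 'e \<Rightarrow> real)"
  shows "\<exists>x\<in>S. x \<noteq> 0 \<and> F x = 0 \<and> F (j x) = 0 \<and> s x x \<le> r * g x x"
proof -
  obtain u v where uv: "u = f 0" "v = f 1" by blast
  have o: "orth n f" using sp by (simp add: spec_def)
  have l0: "l 0 \<le> l 1" using sp n by (auto simp: spec_def)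
  have fS: "u \<in> S" "v \<in> S" using o n by (auto simp: orth_def uv)
  have eg: "eig (l 0) (u)" "eig (l 1) (v)" using sp n by (auto simp: spec_def uv)
  have q: "\<exists>x\<in>S. x \<noteq> 0 \<and> F x = 0 \<and> F (j x) = 0 \<and> s x x \<le> r * g x x"
    if ne: "(a, b, c, d) \<noteq> (0, 0, 0, 0)" and
      x: "x = (a *\<^sub>R u + b *\<^sub>R j (u)) + (c *\<^sub>R v + d *\<^sub>R j (v))" and Fx: "F x = 0" "F (j x) = 0"
    for a b c d x
  proof -
    have S': "a *\<^sub>R u + b *\<^sub>R j (u) \<in> S" "c *\<^sub>R v + d *\<^sub>R j (v) \<in> S"
      using fS j_in subspace_add[OF S(1)] subspace_scale[OF S(1)] by auto
    then have xS: "x \<in> S" using subspace_add[OF S(1)] x by auto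
    have G: "g (u) (u) = 1" "g (v) (v) = 1" "g (u) (v) = 0" "g (v) (u) = 0"
      "g (u) (j (u)) = 0" "g (u) (j (v)) = 0" "g (v) (j (u)) = 0" "g (v) (j (v)) = 0"
      using o n by (auto simp: orth_def uv)
    have gx: "g x x = a\<^sup>2 + b\<^sup>2 + (c\<^sup>2 + d\<^sup>2)"
      unfolding x by (simp add: g_simps G g_skew fS g_j j_in jj power2_eq_square)
    have sx: "s x x = l 0 * (a\<^sup>2 + b\<^sup>2) + l 1 * (c\<^sup>2 + d\<^sup>2)"
      using eg eig_j[OF eg(1)] eig_j[OF eg(2)] fS j_in
      unfolding x by (simp add: s_simps eig_def G g_skew g_j j_in jj g_simps power2_eq_square algebra_simps)
    have "x \<noteq> 0"
    proof
      assume "x = 0"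
      then have "a\<^sup>2 + b\<^sup>2 + (c\<^sup>2 + d\<^sup>2) = 0" using gx by (simp add: g_simps)
      moreover have "a\<^sup>2 \<ge> 0" "b\<^sup>2 \<ge> 0" "c\<^sup>2 \<ge> 0" "d\<^sup>2 \<ge> 0" by auto
      ultimately have "a\<^sup>2 = 0" "b\<^sup>2 = 0" "c\<^sup>2 = 0" "d\<^sup>2 = 0" by linarith+
      then show False using ne by simp
    qed
    moreover have "s x x \<le> r * (a\<^sup>2 + b\<^sup>2) + r * (c\<^sup>2 + d\<^sup>2)"
      unfolding sx using l0 l1 by (intro add_mono mult_right_mono) auto
    ultimately show ?thesis using xS Fx gx by (intro bexI[of _ x]) (auto simp: algebra_simps)
  qed
  note lF = linear_add[OF F] linear_cmul[OF F] linear_add[OF lin_j] linear_cmul[OF lin_j] linear_neg[OF F]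
    linear_diff[OF F] linear_diff[OF lin_j]
  define p p' q q' where "p = F (u)" "p' = F (j (u))" "q = F (v)" "q' = F (j (v))"
  show ?thesis
  proof (cases "p = 0 \<and> p' = 0")
    case True
    show ?thesis by (rule q[of 1 0 0 0, OF _ refl]) (use True in \<open>auto simp: lF p_p'_q_q'_def\<close>)
  next
    case False
    \<comment> \<open>With \<lambda>(x) = F x - \<i> F (j x), which is complex linear, these are the
      real coefficients of \<lambda>(v) u - \<lambda>(u) v.\<close>
    then show ?thesis
      by (intro q[of q "- q'" "- p" p', OF _ refl]) (auto simp: lF p_p'_q_q'_def jj fS)
  qed
qed

end

text \<open>T identifies the coordinate space S with a fibre of tangent vectors. For h Hermitian,
  complex linear in the first argument and with real part g, the imaginary part is
  \<open>g x (j y)\<close>.\<close>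

locale complex_form_tvec = complex_form S j g s n
  for S :: "'e::euclidean_space set" and j g s n +
  fixes T :: "'e \<Rightarrow> 'a tvec" and H J h q
  assumes T_add: "T (x + y) = T x +\<^sub>t T y" and T_scale: "T (r *\<^sub>R x) = complex_of_real r *\<^sub>t T x"
    and T_inj: "T x = T y \<Longrightarrow> x = y" and H: "H = T ` S"
    and J: "x \<in> S \<Longrightarrow> J (T x) = T (j x)"
    and h: "x \<in> S \<Longrightarrow> y \<in> S \<Longrightarrow> h (T x) (T y) = Complex (g x y) (g x (j y))"
    and q: "x \<in> S \<Longrightarrow> q (T x) = s x x"
begin

lemma T_zero: "T 0 = (\<lambda>f. 0)"
  using T_scale[of 0 0] by (simp add: tscale_def)

lemma T_sum: "T (\<Sum>i\<in>I. c i *\<^sub>R x i) = (\<lambda>f. \<Sum>i\<in>I. complex_of_real (c i) * T (x i) f)"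
  by (induction I rule: infinite_finite_induct) (auto simp: T_zero T_add T_scale tadd_def tscale_def)

lemma jlincomb_T:
  assumes "\<And>k. k < n \<Longrightarrow> E k = T (e k)" "\<And>k. k < n \<Longrightarrow> e k \<in> S"
  shows "jlincomb J n c E = T (comb {..<n} c e)"
  unfolding jlincomb_def lincomb_def comb_def sum.distrib T_add T_sum tadd_def
  by (intro ext arg_cong2[of _ _ _ _ "(+)"] sum.cong) (auto simp: assms J)

lemma polarize_T:
  assumes "x \<in> S" "y \<in> S"
  shows "polarize J q (T x) (T y) = Complex (s x y) (s x (j y))"
proof -
  have q': "(s (x + y) (x + y) - s x x - s y y) / 2 = s x y" for x y
    by (simp add: s_simps sym_s[of y x])
  show ?thesis
    unfolding polarize_def J[OF assms(2)] T_add[symmetric]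
    using q'[of x y] q'[of x "j y"] assms j_in
    by (simp add: q subspace_add[OF S(1)])
qed

lemma eigenvalue_list_iff:
  "eigenvalue_list H J h n q l \<longleftrightarrow> (\<exists>e. eigenfam e l)"
proof
  have eig_iff: "(\<forall>Y\<in>H. polarize J q (T x) Y = complex_of_real r * h (T x) Y) \<longleftrightarrow> eig r x"
    if x: "x \<in> S" for x r
    unfolding H eig_def using x polarize_T[OF x] h[OF x] j_in by (auto simp: complex_eq_iff)
  {
    assume A: "eigenvalue_list H J h n q l"
    have len: "length l = n" "sorted l" using A by (auto simp: eigenvalue_list_def)
    obtain E where E: "H = {jlincomb J n c E | c. True}"
      "\<forall>c. jlincomb J n c E = (\<lambda>f. 0) \<longrightarrow> (\<forall>k<n. c k = 0)"
      "\<forall>k<n. \<forall>Y\<in>H. polarize J q (E k) Y = complex_of_real (l ! k) * h (E k) Y"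
      using A unfolding eigenvalue_list_def by (elim conjE exE) (rule that; assumption)
    \<comment> \<open>\<open>eigenvalue_list\<close> does not say that the eigenvectors lie in H;
      unit coefficients show it.\<close>
    have "E k \<in> H" if "k < n" for k
    proof -
      have "jlincomb J n (\<lambda>i. if i = k then 1 else 0) E = E k"
        using that by (auto simp: jlincomb_def lincomb_def tadd_def if_distrib[of Re] if_distrib[of Im]
            if_distrib[of complex_of_real] if_distrib[of "\<lambda>x. x * _"] cong: if_cong)
      then show ?thesis unfolding E(1) by (intro CollectI exI conjI TrueI) (erule sym)
    qed
    then have "\<forall>k. \<exists>x. k < n \<longrightarrow> E k = T x \<and> x \<in> S" unfolding H by blast
    then obtain e where e: "\<And>k. k < n \<Longrightarrow> E k = T (e k)" "\<And>k. k < n \<Longrightarrow> e k \<in> S" by metis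
    note jl = jlincomb_T[of E e, OF e]
    have "S = {comb {..<n} c e | c. True}"
    proof
      show "S \<subseteq> {comb {..<n} c e | c. True}"
      proof
        fix x assume "x \<in> S"
        then have "T x \<in> H" by (simp add: H)
        then obtain c where "T x = T (comb {..<n} c e)" using E(1) jl by auto
        then show "x \<in> {comb {..<n} c e | c. True}" using T_inj by blast
      qed
      show "{comb {..<n} c e | c. True} \<subseteq> S" using comb_in_S[of "{..<n}" e] e by auto
    qed
    moreover have "\<forall>k<n. c k = 0" if "comb {..<n} c e = 0" for c
      using E(2) that by (auto simp: jl T_zero)
    moreover have "\<forall>k<n. eig (l ! k) (e k)" using E(3) e eig_iff by auto
    ultimately show "\<exists>e. eigenfam e l" using len unfolding eigenfam_def by blast
  }
  {
    assume "\<exists>e. eigenfam e l"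
    then obtain e where e: "eigenfam e l" by blast
    then have eS: "\<And>k. k < n \<Longrightarrow> e k \<in> S" by (auto simp: eigenfam_def eig_def)
    have jl: "jlincomb J n c (\<lambda>k. T (e k)) = T (comb {..<n} c e)" for c
      by (rule jlincomb_T) (auto simp: eS)
    have "S = {comb {..<n} c e | c. True}" using e by (simp add: eigenfam_def)
    then have "T ` S = range (\<lambda>c. T (comb {..<n} c e))" by blast
    then have "H = {jlincomb J n c (\<lambda>k. T (e k)) | c. True}"
      unfolding H jl by auto
    moreover have "\<forall>k<n. c k = 0" if "jlincomb J n c (\<lambda>k. T (e k)) = (\<lambda>f. 0)" for c
      using that e T_inj[of _ 0] by (simp add: jl T_zero eigenfam_def)
    moreover have "\<forall>k<n. \<forall>Y\<in>H. polarize J q (T (e k)) Y = complex_of_real (l ! k) * h (T (e k)) Y"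
      using eig_iff eS e by (auto simp: eigenfam_def)
    ultimately show "eigenvalue_list H J h n q l"
      unfolding eigenvalue_list_def using e unfolding eigenfam_def
      by (intro conjI exI[of _ "\<lambda>k. T (e k)"]) auto
  }
qed

text \<open>Existence and uniqueness of the list make the description denote; entry 1 is the second
  eigenvalue because lists are indexed from 0.\<close>

lemma second_eigenvalue:
  assumes n: "2 \<le> n" and l1: "(THE l. eigenvalue_list H J h n q l) ! 1 \<le> r" and F: "linear (F :: 'e \<Rightarrow> real)"
  shows "\<exists>x\<in>S. x \<noteq> 0 \<and> F x = 0 \<and> F (j x) = 0 \<and> s x x \<le> r * g x x"
proof -
  obtain f l where sp: "spec n f l" using spec_exists by blast
  have "(THE l. eigenvalue_list H J h n q l) = map l [0..<n]"
  proof (rule the_equality)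
    show "eigenvalue_list H J h n q (map l [0..<n])"
      using eigenvalue_list_iff spec_eigenfam[OF sp] by blast
    show "l' = map l [0..<n]" if "eigenvalue_list H J h n q l'" for l'
      using eigenvalue_list_iff eigenfam_unique[OF _ sp] that by blast
  qed
  then have "l 1 \<le> r" using l1 n by simp
  then show ?thesis using spec_second[OF sp n _ F] by blast
qed

end

section \<open>Tangent vectors and forms in a chart\<close>

lemma smooth_fun_subset: "smooth_fun A V f \<Longrightarrow> V' \<subseteq> V \<Longrightarrow> smooth_fun A V' f"
  unfolding smooth_fun_def by (fastforce intro: Cinf_on_subset)

text \<open>Serves to glue functions given on two overlapping open sets, one of which may reach
  beyond the chart.\<close>

lemma smooth_fun_local:
  assumes "\<And>p. p \<in> V \<Longrightarrow> \<exists>W. open W \<and> p \<in> W \<and> smooth_fun A W f" and "smooth_atlas A"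
  shows "smooth_fun A V f"
  unfolding smooth_fun_def
proof safe
  fix U \<phi> assume U: "(U, \<phi>) \<in> A"
  have hom: "homeomorphism U (\<phi> ` U) \<phi> (inv_into U \<phi>)" and oU: "open U" "open (\<phi> ` U)"
    using assms(2) U by (auto simp: smooth_atlas_def)
  show "Cinf_on (\<phi> ` (U \<inter> V)) (f \<circ> inv_into U \<phi>)"
  proof (rule Cinf_on_local)
    fix z assume "z \<in> \<phi> ` (U \<inter> V)"
    then obtain p where p: "p \<in> U" "p \<in> V" "z = \<phi> p" by blast
    obtain W where W: "open W" "p \<in> W" "smooth_fun A W f" using assms(1) p by blast
    have "openin (top_of_set (\<phi> ` U)) (\<phi> ` (U \<inter> W))"
      by (rule homeomorphism_imp_open_map[OF hom]) (use W oU in auto)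
    then have "open (\<phi> ` (U \<inter> W))" using oU openin_open_eq by blast
    moreover have "Cinf_on (\<phi> ` (U \<inter> W)) (f \<circ> inv_into U \<phi>)" using W(3) U by (auto simp: smooth_fun_def)
    ultimately show "\<exists>T. open T \<and> z \<in> T \<and> Cinf_on T (f \<circ> inv_into U \<phi>)" using p W by blast
  qed
qed

lemma smooth_section_subset:
  "smooth_section A V E X \<Longrightarrow> W \<subseteq> V \<Longrightarrow> smooth_section A W E X"
  unfolding smooth_section_def by (meson order_trans subsetD)

lemma smooth_section_mono:
  "smooth_section A V E X \<Longrightarrow> (\<And>p. p \<in> V \<Longrightarrow> E p \<subseteq> E' p) \<Longrightarrow> smooth_section A V E' X"
  unfolding smooth_section_def by (meson subsetD)

locale chart =
  fixes A :: "('a::t2_space, 'e::euclidean_space) chart set" and U0 \<phi>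
  assumes atlas: "smooth_atlas A" and in_atlas: "(U0, \<phi>) \<in> A"
begin

abbreviation \<Phi> where "\<Phi> \<equiv> inv_into U0 \<phi>"

abbreviation ct where "ct \<equiv> chart_tvec A (U0, \<phi>)"

lemma open_U0: "open U0" and hom: "homeomorphism U0 (\<phi> ` U0) \<phi> \<Phi>" and open_img0: "open (\<phi> ` U0)"
  using atlas in_atlas by (auto simp: smooth_atlas_def)

lemma \<Phi>_\<phi> [simp]: "q \<in> U0 \<Longrightarrow> \<Phi> (\<phi> q) = q"
  using hom by (simp add: homeomorphism_def)

lemma \<phi>_\<Phi>: "z \<in> \<phi> ` V \<Longrightarrow> V \<subseteq> U0 \<Longrightarrow> \<phi> (\<Phi> z) = z \<and> \<Phi> z \<in> V"
  by auto

lemma open_img: "open V \<Longrightarrow> V \<subseteq> U0 \<Longrightarrow> open (\<phi> ` V)"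
proof -
  assume V: "open V" "V \<subseteq> U0"
  have "openin (top_of_set (\<phi> ` U0)) (\<phi> ` V)"
    by (rule homeomorphism_imp_open_map[OF hom]) (simp add: openin_open_eq open_U0 V)
  then show ?thesis using open_img0 openin_open_eq by blast
qed

lemma continuous_\<phi>: "continuous_on U0 \<phi>" and continuous_\<Phi>: "continuous_on (\<phi> ` U0) \<Phi>"
  using hom by (auto simp: homeomorphism_def)

lemma open_vimage_\<phi>: "open O' \<Longrightarrow> open (U0 \<inter> \<phi> -` O')"
  using continuous_open_preimage[OF continuous_\<phi> open_U0] .

end

text \<open>Transition maps carry smoothness from one chart to all charts of the atlas.\<close>

lemma (in chart) smooth_iff:
  assumes V: "open V" "V \<subseteq> U0"
  shows "smooth_fun A V f \<longleftrightarrow> Cinf_on (\<phi> ` V) (f \<circ> \<Phi>)"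
proof
  assume "smooth_fun A V f"
  then show "Cinf_on (\<phi> ` V) (f \<circ> \<Phi>)"
    using in_atlas V(2) unfolding smooth_fun_def by (auto simp: Int_absorb1)
next
  assume f: "Cinf_on (\<phi> ` V) (f \<circ> \<Phi>)"
  show "smooth_fun A V f"
    unfolding smooth_fun_def
  proof safe
    fix W \<psi> assume W: "(W, \<psi>) \<in> A"
    interpret W: chart A W \<psi> using atlas W by unfold_locales
    have o: "open (\<psi> ` (W \<inter> V))" using W.open_img V W.open_U0 by auto
    have "Cinf_on (\<psi> ` (W \<inter> U0)) (\<phi> \<circ> W.\<Phi>)" using atlas W in_atlas by (auto simp: smooth_atlas_def)
    then have t: "Cinf_on (\<psi> ` (W \<inter> V)) (\<lambda>x. (\<phi> \<circ> W.\<Phi>) x)"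
      by (rule Cinf_on_subset) (use V in auto)
    have "Cinf_on (\<psi> ` (W \<inter> V)) (\<lambda>x. (f \<circ> \<Phi>) ((\<phi> \<circ> W.\<Phi>) x))"
      by (rule Cinf_on_compose[OF t f _ o]) auto
    then show "Cinf_on (\<psi> ` (W \<inter> V)) (f \<circ> W.\<Phi>)"
      by (rule Cinf_on_cong[OF o, rotated]) (use V in \<open>auto simp: subset_iff\<close>)
  qed
qed

lemmas (in chart) smooth_imp_Cinf_on = smooth_iff[THEN iffD1, unfolded o_def]

lemma smooth_fun_open_img: "smooth_atlas A \<Longrightarrow> (U, \<phi>) \<in> A \<Longrightarrow> open V \<Longrightarrow> open (\<phi> ` (U \<inter> V))"
  using chart.open_img[of A U \<phi> "U \<inter> V"] chart.open_U0[of A U \<phi>] by (simp add: chart_def open_Int)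

lemma smooth_fun_const: "smooth_fun A V (\<lambda>q. c)"
  by (simp add: smooth_fun_def o_def Cinf_on_const)

lemma smooth_fun_bounded_linear:
  "smooth_atlas A \<Longrightarrow> open V \<Longrightarrow> bounded_linear L \<Longrightarrow> smooth_fun A V f \<Longrightarrow> smooth_fun A V (\<lambda>q. L (f q))"
  unfolding smooth_fun_def o_def by (fast intro: Cinf_on_bounded_linear smooth_fun_open_img)

lemma smooth_fun_add:
  "smooth_atlas A \<Longrightarrow> open V \<Longrightarrow> smooth_fun A V f \<Longrightarrow> smooth_fun A V g \<Longrightarrow> smooth_fun A V (\<lambda>q. f q + g q)"
  unfolding smooth_fun_def o_def by (fast intro: Cinf_on_add smooth_fun_open_img)

lemma smooth_fun_mult:
  fixes f g :: "'a::t2_space \<Rightarrow> 'f::real_normed_algebra"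
  shows "smooth_atlas A \<Longrightarrow> open V \<Longrightarrow> smooth_fun A V f \<Longrightarrow> smooth_fun A V g \<Longrightarrow> smooth_fun A V (\<lambda>q. f q * g q)"
  unfolding smooth_fun_def o_def by (fast intro: Cinf_on_mult smooth_fun_open_img)

lemma smooth_fun_cong:
  assumes "smooth_atlas A" "open V" "smooth_fun A V f" "\<And>q. q \<in> V \<Longrightarrow> f q = g q"
  shows "smooth_fun A V g"
  unfolding smooth_fun_def
proof safe
  fix W \<psi> assume W: "(W, \<psi>) \<in> A"
  have "Cinf_on (\<psi> ` (W \<inter> V)) (f \<circ> inv_into W \<psi>)" using assms(3) W by (auto simp: smooth_fun_def)
  then show "Cinf_on (\<psi> ` (W \<inter> V)) (g \<circ> inv_into W \<psi>)"
  proof (rule Cinf_on_cong[OF smooth_fun_open_img[OF assms(1) W assms(2)], rotated])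
    fix z assume "z \<in> \<psi> ` (W \<inter> V)"
    moreover have "chart A W \<psi>" using assms(1) W by (simp add: chart_def)
    ultimately show "(f \<circ> inv_into W \<psi>) z = (g \<circ> inv_into W \<psi>) z"
      using assms(4) by (auto simp: chart.\<Phi>_\<phi>)
  qed
qed

context chart
begin

section \<open>Coordinate vectors and the tangent space\<close>

lemma smooth_at_nbhd:
  assumes "smooth_at A p f" "p \<in> U0" "open V" "p \<in> V"
  obtains W where "open W" "p \<in> W" "W \<subseteq> U0" "W \<subseteq> V" "smooth_fun A W f"
proof -
  obtain W where W: "open W" "p \<in> W" "smooth_fun A W f" using assms(1) by (auto simp: smooth_at_def)
  show ?thesis
    by (rule that[of "W \<inter> U0 \<inter> V"]) (use W assms open_U0 in \<open>auto intro: smooth_fun_subset\<close>)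
qed

lemma smooth_differentiable:
  assumes "smooth_fun A V f" "open V" "p \<in> V" "p \<in> U0"
  shows "(f \<circ> \<Phi>) differentiable at (\<phi> p)"
proof -
  have "Cinf_on (\<phi> ` (V \<inter> U0)) (f \<circ> \<Phi>)"
    using assms smooth_fun_subset[of A V f "V \<inter> U0"] smooth_iff[of "V \<inter> U0" f] open_U0 by auto
  then show ?thesis by (rule Cinf_on_differentiable) (use assms in auto)
qed

lemma ct_apply:
  assumes "smooth_fun A V f" "open V" "p \<in> V"
  shows "ct p w f = fd (f \<circ> \<Phi>) (\<phi> p) w"
  using assms by (auto simp: chart_tvec_def smooth_at_def)

lemma smooth_at_differentiable: "smooth_at A p f \<Longrightarrow> p \<in> U0 \<Longrightarrow> (f \<circ> \<Phi>) differentiable at (\<phi> p)"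
  using smooth_differentiable by (auto simp: smooth_at_def)

lemma ct_linear:
  assumes p: "p \<in> U0" shows "linear (\<lambda>w. ct p w f)"
proof (cases "smooth_at A p f")
  case True
  then show ?thesis
    using linear_frechet_derivative[OF smooth_at_differentiable[OF True p]] by (simp add: chart_tvec_def)
qed (simp add: chart_tvec_def module_hom_zero)

lemma ct_add: "p \<in> U0 \<Longrightarrow> ct p (x + y) = ct p x +\<^sub>t ct p y"
  using linear_add[OF ct_linear] unfolding tadd_def by blast

lemma ct_scale: "p \<in> U0 \<Longrightarrow> ct p (r *\<^sub>R x) = complex_of_real r *\<^sub>t ct p x"
  using linear_cmul[OF ct_linear] unfolding tscale_def scaleR_conv_of_real[symmetric] by blast

lemma ct_zero: "p \<in> U0 \<Longrightarrow> ct p 0 = (\<lambda>f. 0)"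
  using ct_scale[of p 0 0] by (simp add: tscale_def)

lemma ct_sum: "p \<in> U0 \<Longrightarrow> ct p (\<Sum>i\<in>I. c i *\<^sub>R x i) = (\<lambda>f. \<Sum>i\<in>I. complex_of_real (c i) * ct p (x i) f)"
  by (induction I rule: infinite_finite_induct) (auto simp: ct_zero ct_add ct_scale tadd_def tscale_def)

text \<open>The coordinate functions, complex valued so that tangent operators apply to them: on
  these functions a tangent vector shows its components.\<close>

definition xc :: "'e \<Rightarrow> 'a \<Rightarrow> complex" where
  "xc b q = complex_of_real (\<phi> q \<bullet> b)"

lemma bounded_linear_of_real_inner: "bounded_linear (\<lambda>z. complex_of_real (z \<bullet> b))"
  by (intro bounded_linear_compose[OF bounded_linear_of_real] bounded_linear_inner_left)

lemma xc_smooth: "smooth_fun A U0 (xc b)"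
proof -
  have "Cinf_on (\<phi> ` U0) (\<lambda>z. complex_of_real (z \<bullet> b))"
    by (rule Cinf_on_linear[OF bounded_linear_of_real_inner open_img0])
  then have "Cinf_on (\<phi> ` U0) (xc b \<circ> \<Phi>)"
    by (rule Cinf_on_cong[OF open_img0, rotated]) (auto simp: xc_def)
  then show ?thesis using smooth_iff[OF open_U0 order_refl] by blast
qed

lemma ct_xc: "p \<in> U0 \<Longrightarrow> ct p w (xc b) = complex_of_real (w \<bullet> b)"
proof -
  assume p: "p \<in> U0"
  have "((\<lambda>z. complex_of_real (z \<bullet> b)) has_derivative (\<lambda>w. complex_of_real (w \<bullet> b))) (at (\<phi> p))"
    using bounded_linear_of_real_inner by (rule bounded_linear_imp_has_derivative)
  then have "((xc b \<circ> \<Phi>) has_derivative (\<lambda>w. complex_of_real (w \<bullet> b))) (at (\<phi> p))"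
    by (rule has_derivative_transform_within_open[OF _ open_img0]) (use p in \<open>auto simp: xc_def\<close>)
  then show ?thesis unfolding ct_apply[OF xc_smooth open_U0 p] by (simp add: fd_eqI)
qed

lemma ct_inj: "p \<in> U0 \<Longrightarrow> ct p v = ct p w \<Longrightarrow> v = w"
proof (rule euclidean_eqI)
  fix b :: 'e assume "p \<in> U0" "ct p v = ct p w"
  then have "complex_of_real (v \<bullet> b) = complex_of_real (w \<bullet> b)" using ct_xc by metis
  then show "v \<bullet> b = w \<bullet> b" by simp
qed

text \<open>A vector given in another chart is carried to this one by the derivative of the
  transition map. For a function that is not smooth at p the default values 0 are compared.\<close>

lemma tangent_space_eq:
  assumes p: "p \<in> U0" shows "tangent_space A p = range (ct p)"
proof
  show "range (ct p) \<subseteq> tangent_space A p"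
    using in_atlas p unfolding tangent_space_def by fastforce
  show "tangent_space A p \<subseteq> range (ct p)"
  proof
    fix v assume "v \<in> tangent_space A p"
    then obtain W \<psi> w where W: "(W, \<psi>) \<in> A" "p \<in> W" "v = chart_tvec A (W, \<psi>) p w"
      unfolding tangent_space_def by auto
    interpret W: chart A W \<psi> using atlas W by unfold_locales
    define t where "t = \<phi> \<circ> W.\<Phi>"
    have tC: "Cinf_on (\<psi> ` (W \<inter> U0)) t" using atlas W in_atlas by (auto simp: smooth_atlas_def t_def)
    have oWU: "open (\<psi> ` (W \<inter> U0))" using W.open_img W.open_U0 open_U0 by auto
    have pW: "\<psi> p \<in> \<psi> ` (W \<inter> U0)" using p W by auto
    have dt: "t differentiable at (\<psi> p)" using Cinf_on_differentiable[OF tC] p W by auto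
    have tp: "t (\<psi> p) = \<phi> p" using W by (simp add: t_def)
    have "v f = ct p (fd t (\<psi> p) w) f" for f
    proof (cases "smooth_at A p f")
      case True
      have df: "(f \<circ> \<Phi>) differentiable at (t (\<psi> p))" using smooth_at_differentiable[OF True p] tp by simp
      have "fd (f \<circ> W.\<Phi>) (\<psi> p) = fd ((f \<circ> \<Phi>) \<circ> t) (\<psi> p)"
        by (rule fd_cong[OF oWU pW]) (use W.smooth_at_differentiable[OF True W(2)] in \<open>auto simp: t_def\<close>)
      also have "\<dots> = fd (f \<circ> \<Phi>) (\<phi> p) \<circ> fd t (\<psi> p)"
        using frechet_derivative_compose[OF dt df] unfolding tp .
      finally show ?thesis using True by (simp add: W(3) chart_tvec_def)
    qed (simp add: W(3) chart_tvec_def)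
    then show "v \<in> range (ct p)" by blast
  qed
qed

lemma tangent_in_ctangent:
  assumes p: "p \<in> U0" and v: "v \<in> tangent_space A p" shows "v \<in> ctangent_space A p"
proof -
  have "(\<lambda>f. 0) \<in> tangent_space A p" using tangent_space_eq[OF p] ct_zero[OF p] by (metis rangeI)
  moreover have "v = v +\<^sub>t \<i> *\<^sub>t (\<lambda>f. 0)" by (simp add: tadd_def tscale_def)
  ultimately show ?thesis unfolding ctangent_space_def using v by blast
qed

lemma ct_tangent: "p \<in> U0 \<Longrightarrow> ct p w \<in> tangent_space A p"
  using tangent_space_eq by blast

lemma ct_ctangent: "p \<in> U0 \<Longrightarrow> ct p w \<in> ctangent_space A p"
  using tangent_in_ctangent ct_tangent by blast

text \<open>The components of a real field are its values on the coordinate functions; for such a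
  field \<open>Re\<close> only changes the type.\<close>

definition comp :: "'a vfield \<Rightarrow> 'e \<Rightarrow> 'e" where
  "comp X z = (\<Sum>b\<in>Basis. Re (X (\<Phi> z) (xc b)) *\<^sub>R b)"

lemma comp_smooth:
  assumes X: "smooth_section A W (tangent_space A) X" and W: "open W" "W \<subseteq> U0"
  shows "Cinf_on (\<phi> ` W) (comp X)"
proof -
  have "Cinf_on (\<phi> ` W) (\<lambda>z. X (\<Phi> z) (xc b))" for b
  proof -
    have "smooth_fun A W (\<lambda>q. X q (xc b))"
      using X W smooth_fun_subset[OF xc_smooth W(2)] unfolding smooth_section_def by blast
    then show ?thesis by (rule smooth_imp_Cinf_on[OF W])
  qed
  then show ?thesis
    unfolding comp_def[abs_def]
    by (intro Cinf_on_sum Cinf_on_scaleR Cinf_on_const Cinf_on_bounded_linear[OF bounded_linear_Re] open_img W)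
qed

lemma comp_ct: "q \<in> U0 \<Longrightarrow> X q = ct q w \<Longrightarrow> comp X (\<phi> q) = w"
  by (simp add: comp_def ct_xc euclidean_representation)

lemma ct_comp: "q \<in> U0 \<Longrightarrow> X q \<in> tangent_space A q \<Longrightarrow> X q = ct q (comp X (\<phi> q))"
  using tangent_space_eq comp_ct by fastforce

lemma section_rep:
  assumes X: "smooth_section A W (tangent_space A) X" and W: "open W" "W \<subseteq> U0"
  obtains x where "Cinf_on (\<phi> ` W) x" "\<And>q. q \<in> W \<Longrightarrow> X q = ct q (x (\<phi> q))"
proof (rule that[OF comp_smooth[OF assms]])
  fix q assume "q \<in> W"
  then show "X q = ct q (comp X (\<phi> q))"
    using X W(2) by (intro ct_comp) (auto simp: smooth_section_def)
qed

section \<open>Vector fields and their brackets in coordinates\<close>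

lemma field_apply_smooth:
  assumes x: "Cinf_on (\<phi> ` W) x" and X: "\<And>q. q \<in> W \<Longrightarrow> X q = ct q (x (\<phi> q))"
    and W: "open W" "W \<subseteq> U0" and f: "smooth_fun A W f"
  shows "Cinf_on (\<phi> ` W) (\<lambda>z. fd (f \<circ> \<Phi>) z (x z))"
    and "\<And>z. z \<in> \<phi> ` W \<Longrightarrow> X (\<Phi> z) f = fd (f \<circ> \<Phi>) z (x z)"
    and "smooth_fun A W (\<lambda>q. X q f)"
proof -
  show 1: "Cinf_on (\<phi> ` W) (\<lambda>z. fd (f \<circ> \<Phi>) z (x z))"
    using Cinf_on_fd_field[OF _ x open_img[OF W]] f smooth_iff[OF W] by blast
  show 2: "X (\<Phi> z) f = fd (f \<circ> \<Phi>) z (x z)" if "z \<in> \<phi> ` W" for z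
    using \<phi>_\<Phi>[OF that W(2)] X ct_apply[OF f W(1)] by auto
  have "Cinf_on (\<phi> ` W) ((\<lambda>q. X q f) \<circ> \<Phi>)"
    by (rule Cinf_on_cong[OF open_img[OF W] _ 1]) (simp add: 2)
  then show "smooth_fun A W (\<lambda>q. X q f)" using smooth_iff[OF W] by blast
qed

lemma section_of_rep:
  assumes x: "Cinf_on (\<phi> ` W) x" and X: "\<And>q. q \<in> W \<Longrightarrow> X q = ct q (x (\<phi> q))"
    and W: "open W" "W \<subseteq> U0"
  shows "smooth_section A W (tangent_space A) X"
  unfolding smooth_section_def
proof (intro conjI ballI allI impI)
  show "X p \<in> tangent_space A p" "X p \<in> ctangent_space A p" if "p \<in> W" for p
    using X that W ct_tangent ct_ctangent by auto
  fix V and f :: "'a \<Rightarrow> complex" assume "open V \<and> V \<subseteq> W \<and> smooth_fun A V f"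
  then show "smooth_fun A V (\<lambda>q. X q f)"
    using field_apply_smooth(3)[of V x X f] x X W Cinf_on_subset[OF x] by (meson image_mono order_trans subsetD)
qed

text \<open>Each double application is a second derivative in frozen directions plus a first order
  term; the second derivatives cancel by symmetry. On functions that are not smooth at p both sides
  are 0.\<close>

lemma lie_bracket_ct:
  assumes x: "Cinf_on (\<phi> ` W) x" and X: "\<And>q. q \<in> W \<Longrightarrow> X q = ct q (x (\<phi> q))"
    and y: "Cinf_on (\<phi> ` W) y" and Y: "\<And>q. q \<in> W \<Longrightarrow> Y q = ct q (y (\<phi> q))"
    and W: "open W" "W \<subseteq> U0" and p: "p \<in> W"
  shows "lie_bracket A X Y p = ct p (fd y (\<phi> p) (x (\<phi> p)) - fd x (\<phi> p) (y (\<phi> p)))"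
proof
  fix f
  let ?z = "\<phi> p"
  have pU: "p \<in> U0" using p W by auto
  show "lie_bracket A X Y p f = ct p (fd y ?z (x ?z) - fd x ?z (y ?z)) f"
  proof (cases "smooth_at A p f")
    case True
    obtain V where V: "open V" "p \<in> V" "V \<subseteq> U0" "V \<subseteq> W" "smooth_fun A V f"
      using smooth_at_nbhd[OF True pU W(1) p] by blast
    have fC: "Cinf_on (\<phi> ` V) (f \<circ> \<Phi>)" using V smooth_iff by blast
    have oV: "open (\<phi> ` V)" using V open_img by blast
    have zV: "?z \<in> \<phi> ` V" using V by blast
    have *: "X' p (\<lambda>q. Y' q f) = fd (\<lambda>z. fd (f \<circ> \<Phi>) z (y' ?z)) ?z (x' ?z) + fd (f \<circ> \<Phi>) ?z (fd y' ?z (x' ?z))"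
      if "Cinf_on (\<phi> ` W) y'" "\<And>q. q \<in> W \<Longrightarrow> Y' q = ct q (y' (\<phi> q))" "\<And>q. q \<in> W \<Longrightarrow> X' q = ct q (x' (\<phi> q))"
      for X' Y' x' y'
    proof -
      have y': "Cinf_on (\<phi> ` V) y'" using that(1) V by (auto intro: Cinf_on_subset)
      have Y': "Y' q = ct q (y' (\<phi> q))" if "q \<in> V" for q using \<open>\<And>q. q \<in> W \<Longrightarrow> Y' q = _ q\<close> that V by auto
      note fa = field_apply_smooth[OF y' Y' V(1,3,5)]
      have "X' p (\<lambda>q. Y' q f) = fd ((\<lambda>q. Y' q f) \<circ> \<Phi>) ?z (x' ?z)"
        using that(3)[OF p] ct_apply[OF fa(3) V(1,2)] by simp
      also have "\<dots> = fd (\<lambda>z. fd (f \<circ> \<Phi>) z (y' z)) ?z (x' ?z)"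
      proof (rule fun_cong[OF fd_cong[OF oV zV]])
        show "((\<lambda>q. Y' q f) \<circ> \<Phi>) differentiable at ?z"
          by (rule smooth_differentiable[OF fa(3) V(1,2) pU])
      qed (simp add: fa(2))
      also have "\<dots> = fd (\<lambda>z. fd (f \<circ> \<Phi>) z (y' ?z)) ?z (x' ?z) + fd (f \<circ> \<Phi>) ?z (fd y' ?z (x' ?z))"
        by (rule fd_fd_field[OF fC y' oV zV])
      finally show ?thesis .
    qed
    have lin: "linear (fd (f \<circ> \<Phi>) ?z)" using Cinf_on_linear_fd[OF fC zV] .
    have "lie_bracket A X Y p f = X p (\<lambda>q. Y q f) - Y p (\<lambda>q. X q f)"
      using True by (simp add: lie_bracket_def)
    also have "\<dots> = fd (f \<circ> \<Phi>) ?z (fd y ?z (x ?z)) - fd (f \<circ> \<Phi>) ?z (fd x ?z (y ?z))"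
      using *[OF y Y X] *[OF x X Y] fd_fd_symmetric[OF fC oV zV] by simp
    also have "\<dots> = ct p (fd y ?z (x ?z) - fd x ?z (y ?z)) f"
      unfolding ct_apply[OF V(5,1,2)] by (simp add: linear_diff[OF lin])
    finally show ?thesis .
  qed (simp add: lie_bracket_def chart_tvec_def)
qed

section \<open>Covectors, one-forms and the exterior derivative in coordinates\<close>

lemma ccovector_add:
  assumes "\<xi> \<in> ccovectors A p" "v \<in> ctangent_space A p" "w \<in> ctangent_space A p"
  shows "\<xi> (v +\<^sub>t w) = \<xi> v + \<xi> w"
proof -
  have "\<xi> (1 *\<^sub>t v +\<^sub>t 1 *\<^sub>t w) = 1 * \<xi> v + 1 * \<xi> w" using assms unfolding ccovectors_def by blast
  then show ?thesis by (simp add: tscale_def)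
qed

lemma ccovector_scale:
  assumes "\<xi> \<in> ccovectors A p" "v \<in> ctangent_space A p"
  shows "\<xi> (c *\<^sub>t v) = c * \<xi> v"
proof -
  have "\<xi> (c *\<^sub>t v +\<^sub>t 0 *\<^sub>t v) = c * \<xi> v + 0 * \<xi> v" using assms unfolding ccovectors_def by blast
  then show ?thesis by (simp add: tscale_def tadd_def)
qed

lemma ccovector_linear:
  assumes "\<xi> \<in> ccovectors A p" "p \<in> U0"
  shows "linear (\<lambda>w. \<xi> (ct p w))"
proof
  fix r and x y :: 'e
  show "\<xi> (ct p (x + y)) = \<xi> (ct p x) + \<xi> (ct p y)"
    using ccovector_add[OF assms(1)] ct_ctangent assms(2) by (simp add: ct_add)
  show "\<xi> (ct p (r *\<^sub>R x)) = r *\<^sub>R \<xi> (ct p x)"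
    using ccovector_scale[OF assms(1)] ct_ctangent assms(2) by (simp add: ct_scale scaleR_conv_of_real)
qed

lemma ccovector_expand:
  assumes "\<xi> \<in> ccovectors A p" "p \<in> U0"
  shows "\<xi> (ct p w) = (\<Sum>b\<in>Basis. (w \<bullet> b) *\<^sub>R \<xi> (ct p b))"
proof -
  note l = ccovector_linear[OF assms]
  have "\<xi> (ct p w) = \<xi> (ct p (\<Sum>b\<in>Basis. (w \<bullet> b) *\<^sub>R b))" by (simp add: euclidean_representation)
  also have "\<dots> = (\<Sum>b\<in>Basis. (w \<bullet> b) *\<^sub>R \<xi> (ct p b))"
    using linear_sum[OF l, of "\<lambda>b. (w \<bullet> b) *\<^sub>R b" Basis] linear_cmul[OF l] by simp
  finally show ?thesis .
qed

text \<open>The coefficient of \<alpha> on the constant coordinate field b, as a function of the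
  coordinates.\<close>

definition fc :: "'a form \<Rightarrow> 'e \<Rightarrow> 'e \<Rightarrow> complex" where
  "fc \<alpha> b z = \<alpha> (\<Phi> z) (ct (\<Phi> z) b)"

lemma fc_smooth:
  assumes "one_form A V \<alpha>" "open W" "W \<subseteq> U0" "W \<subseteq> V"
  shows "Cinf_on (\<phi> ` W) (fc \<alpha> b)"
proof -
  have "smooth_section A W (tangent_space A) (\<lambda>q. ct q b)"
    by (rule section_of_rep[OF Cinf_on_const[of _ b]]) (use assms in auto)
  then have "smooth_section A W (ctangent_space A) (\<lambda>q. ct q b)"
    unfolding smooth_section_def by blast
  then have "smooth_fun A W (\<lambda>q. \<alpha> q (ct q b))"
    using assms unfolding one_form_def by blast
  then show ?thesis using smooth_imp_Cinf_on[OF assms(2,3)] unfolding fc_def[abs_def] by blast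
qed

lemma form_expand:
  assumes "one_form A V \<alpha>" "q \<in> V" "q \<in> U0"
  shows "\<alpha> q (ct q w) = (\<Sum>b\<in>Basis. (w \<bullet> b) *\<^sub>R fc \<alpha> b (\<phi> q))"
  using ccovector_expand[of "\<alpha> q" q w] assms by (auto simp: one_form_def fc_def)

text \<open>The coordinate formula for d \<alpha>, the sum over b of d(fc_b) \<and> dx_b, without a
  factor 1/2.\<close>

definition dform :: "'a form \<Rightarrow> 'e \<Rightarrow> 'e \<Rightarrow> 'e \<Rightarrow> complex" where
  "dform \<alpha> z v w = (\<Sum>b\<in>Basis. (w \<bullet> b) *\<^sub>R fd (fc \<alpha> b) z v - (v \<bullet> b) *\<^sub>R fd (fc \<alpha> b) z w)"

lemma field_form:
  assumes \<alpha>: "one_form A V \<alpha>" and W: "open W" "W \<subseteq> U0" "W \<subseteq> V" and p: "p \<in> W"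
    and y: "Cinf_on (\<phi> ` W) y" and Y: "\<And>q. q \<in> W \<Longrightarrow> Y q = ct q (y (\<phi> q))"
  shows "ct p v (\<lambda>q. \<alpha> q (Y q)) =
    (\<Sum>b\<in>Basis. (y (\<phi> p) \<bullet> b) *\<^sub>R fd (fc \<alpha> b) (\<phi> p) v + (fd y (\<phi> p) v \<bullet> b) *\<^sub>R fc \<alpha> b (\<phi> p))"
proof -
  let ?z = "\<phi> p"
  have oW: "open (\<phi> ` W)" "?z \<in> \<phi> ` W" using open_img W p by auto
  have "smooth_section A W (ctangent_space A) Y"
    using section_of_rep[OF y Y W(1,2)] unfolding smooth_section_def by blast
  then have sm: "smooth_fun A W (\<lambda>q. \<alpha> q (Y q))" using \<alpha> W unfolding one_form_def by blast
  have e: "((\<lambda>z. \<Sum>b\<in>Basis. (y z \<bullet> b) *\<^sub>R fc \<alpha> b z) has_derivative (\<lambda>v. \<Sum>b\<in>Basis.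
     (y ?z \<bullet> b) *\<^sub>R fd (fc \<alpha> b) ?z v + (fd y ?z v \<bullet> b) *\<^sub>R fc \<alpha> b ?z)) (at ?z)"
    by (rule has_derivative_sum, rule has_derivative_scaleR)
       (auto intro!: derivative_eq_intros Cinf_on_has_derivative[OF fc_smooth[OF \<alpha> W] oW(2)]
         Cinf_on_has_derivative[OF y oW(2)])
  have "((\<lambda>q. \<alpha> q (Y q)) \<circ> \<Phi> has_derivative (\<lambda>v. \<Sum>b\<in>Basis.
     (y ?z \<bullet> b) *\<^sub>R fd (fc \<alpha> b) ?z v + (fd y ?z v \<bullet> b) *\<^sub>R fc \<alpha> b ?z)) (at ?z)"
  proof (rule has_derivative_transform_within_open[OF e oW])
    fix z assume "z \<in> \<phi> ` W"
    then obtain q where q: "q \<in> W" "z = \<phi> q" by blast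
    then have "\<alpha> q (Y q) = (\<Sum>b\<in>Basis. (y z \<bullet> b) *\<^sub>R fc \<alpha> b z)"
      using form_expand[OF \<alpha>, of q] Y W by auto
    then show "(\<Sum>b\<in>Basis. (y z \<bullet> b) *\<^sub>R fc \<alpha> b z) = ((\<lambda>q. \<alpha> q (Y q)) \<circ> \<Phi>) z" using q W by auto
  qed
  then show ?thesis unfolding ct_apply[OF sm W(1) p] by (simp add: fd_eqI)
qed

text \<open>The derivatives of the components of X and Y cancel against the bracket term, so only
  the values at p remain: the defining formula of \<open>form_diff\<close> does not depend on the
  extensions.\<close>

lemma form_diff_expr:
  assumes \<alpha>: "one_form A V \<alpha>" and V: "open V" "p \<in> V" and pU: "p \<in> U0" and W: "open W" "p \<in> W"
    and X: "smooth_section A W (tangent_space A) X" and Y: "smooth_section A W (tangent_space A) Y"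
    and Xp: "X p = ct p v" and Yp: "Y p = ct p w"
  shows "X p (\<lambda>q. \<alpha> q (Y q)) - Y p (\<lambda>q. \<alpha> q (X q)) - \<alpha> p (lie_bracket A X Y p) = dform \<alpha> (\<phi> p) v w"
proof -
  define G where "G = W \<inter> V \<inter> U0"
  have G: "open G" "G \<subseteq> U0" "G \<subseteq> V" "p \<in> G" "G \<subseteq> W" using assms open_U0 by (auto simp: G_def)
  obtain x where x: "Cinf_on (\<phi> ` G) x" "\<And>q. q \<in> G \<Longrightarrow> X q = ct q (x (\<phi> q))"
    using section_rep[OF smooth_section_subset[OF X G(5)] G(1,2)] by blast
  obtain y where y: "Cinf_on (\<phi> ` G) y" "\<And>q. q \<in> G \<Longrightarrow> Y q = ct q (y (\<phi> q))"
    using section_rep[OF smooth_section_subset[OF Y G(5)] G(1,2)] by blast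
  have v: "x (\<phi> p) = v" and w: "y (\<phi> p) = w"
    using ct_inj[OF pU] x(2)[OF G(4)] y(2)[OF G(4)] Xp Yp by auto
  have b: "\<alpha> p (lie_bracket A X Y p) = (\<Sum>b\<in>Basis. ((fd y (\<phi> p) v - fd x (\<phi> p) w) \<bullet> b) *\<^sub>R fc \<alpha> b (\<phi> p))"
    using lie_bracket_ct[OF x y G(1,2,4)] form_expand[OF \<alpha> V(2) pU] unfolding v w by simp
  have "X p (\<lambda>q. \<alpha> q (Y q)) =
      (\<Sum>b\<in>Basis. (w \<bullet> b) *\<^sub>R fd (fc \<alpha> b) (\<phi> p) v + (fd y (\<phi> p) v \<bullet> b) *\<^sub>R fc \<alpha> b (\<phi> p))"
    using field_form[OF \<alpha> G(1-4) y, of v] by (simp add: w Xp)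
  moreover have "Y p (\<lambda>q. \<alpha> q (X q)) =
      (\<Sum>b\<in>Basis. (v \<bullet> b) *\<^sub>R fd (fc \<alpha> b) (\<phi> p) w + (fd x (\<phi> p) w \<bullet> b) *\<^sub>R fc \<alpha> b (\<phi> p))"
    using field_form[OF \<alpha> G(1-4) x, of w] by (simp add: v Yp)
  ultimately show ?thesis
    unfolding b dform_def by (simp add: sum.distrib sum_subtractf inner_diff_left algebra_simps)
qed

lemma form_diff_ct:
  assumes \<alpha>: "one_form A V \<alpha>" and V: "open V" "p \<in> V" and pU: "p \<in> U0"
  shows "form_diff A \<alpha> p (ct p v) (ct p w) = dform \<alpha> (\<phi> p) v w"
  unfolding form_diff_def
proof (rule the_equality)
  show "\<forall>X Y W. open W \<and> p \<in> W \<and> smooth_section A W (tangent_space A) X \<and>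
      smooth_section A W (tangent_space A) Y \<and> X p = ct p v \<and> Y p = ct p w \<longrightarrow>
      dform \<alpha> (\<phi> p) v w = X p (\<lambda>q. \<alpha> q (Y q)) - Y p (\<lambda>q. \<alpha> q (X q)) - \<alpha> p (lie_bracket A X Y p)"
    by (intro allI impI, elim conjE) (rule form_diff_expr[OF \<alpha> V pU, symmetric]; assumption)
  fix c
  assume c: "\<forall>X Y W. open W \<and> p \<in> W \<and> smooth_section A W (tangent_space A) X \<and>
      smooth_section A W (tangent_space A) Y \<and> X p = ct p v \<and> Y p = ct p w \<longrightarrow>
      c = X p (\<lambda>q. \<alpha> q (Y q)) - Y p (\<lambda>q. \<alpha> q (X q)) - \<alpha> p (lie_bracket A X Y p)"
  \<comment> \<open>Constant coordinate fields are extensions, so the condition on c is not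
    vacuous.\<close>
  have s: "smooth_section A U0 (tangent_space A) (\<lambda>q. ct q u)" for u
    by (rule section_of_rep[OF Cinf_on_const[of _ u]]) (auto simp: open_U0)
  have "c = ct p v (\<lambda>q. \<alpha> q (ct q w)) - ct p w (\<lambda>q. \<alpha> q (ct q v)) -
      \<alpha> p (lie_bracket A (\<lambda>q. ct q v) (\<lambda>q. ct q w) p)"
    using c[rule_format, of U0 "\<lambda>q. ct q v" "\<lambda>q. ct q w"] open_U0 pU s by simp
  then show "c = dform \<alpha> (\<phi> p) v w"
    using form_diff_expr[OF \<alpha> V pU open_U0 pU s[of v] s[of w] refl refl] by simp
qed

lemma form_diff_sections:
  assumes \<alpha>: "one_form A V \<alpha>" and V: "open V" "p \<in> V" and pU: "p \<in> U0" and W: "open W" "p \<in> W"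
    and X: "smooth_section A W (tangent_space A) X" and Y: "smooth_section A W (tangent_space A) Y"
  shows "form_diff A \<alpha> p (X p) (Y p) =
    X p (\<lambda>q. \<alpha> q (Y q)) - Y p (\<lambda>q. \<alpha> q (X q)) - \<alpha> p (lie_bracket A X Y p)"
proof -
  have "X p \<in> range (ct p)" "Y p \<in> range (ct p)"
    using X Y W(2) tangent_space_eq[OF pU] by (auto simp: smooth_section_def)
  then obtain v w where "X p = ct p v" "Y p = ct p w" by blast
  then show ?thesis using form_diff_ct[OF \<alpha> V pU] form_diff_expr[OF \<alpha> V pU W X Y] by simp
qed

end

section \<open>The Levi form and the complex Hessian in a frame\<close>

context chart
begin

text \<open>Coordinate derivatives are real, so they commute with conjugation. Off the smooth
  functions both sides are the default 0, because conjugation preserves smoothness.\<close>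

lemma tconj_ct: "p \<in> U0 \<Longrightarrow> tconj (ct p w) = ct p w"
proof
  fix f assume p: "p \<in> U0"
  have sm: "smooth_at A p (\<lambda>q. cnj (f q))" if sf: "smooth_at A p f" for f
  proof -
    obtain V where "open V" "p \<in> V" "smooth_fun A V f" using sf by (auto simp: smooth_at_def)
    then show ?thesis
      using smooth_fun_bounded_linear[OF atlas _ bounded_linear_cnj] unfolding smooth_at_def by blast
  qed
  show "tconj (ct p w) f = ct p w f"
  proof (cases "smooth_at A p f")
    case True
    have "fd (\<lambda>z. cnj ((f \<circ> \<Phi>) z)) (\<phi> p) w = cnj (fd (f \<circ> \<Phi>) (\<phi> p) w)"
      by (rule fd_bounded_linear[OF bounded_linear_cnj smooth_at_differentiable[OF True p]])
    then show ?thesis using True sm[OF True] by (simp add: tconj_def chart_tvec_def o_def)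
  next
    case False
    then have "\<not> smooth_at A p (\<lambda>q. cnj (f q))" using sm[of "\<lambda>q. cnj (f q)"] by auto
    then show ?thesis using False by (simp add: tconj_def chart_tvec_def)
  qed
qed

lemma ctangent_iff: "p \<in> U0 \<Longrightarrow> v \<in> ctangent_space A p \<longleftrightarrow> (\<exists>x y. v = ct p x +\<^sub>t \<i> *\<^sub>t ct p y)"
  unfolding ctangent_space_def tangent_space_eq by auto

lemma ctangent_add_scale:
  assumes p: "p \<in> U0" and v: "v \<in> ctangent_space A p" and w: "w \<in> ctangent_space A p"
  shows "c *\<^sub>t v +\<^sub>t d *\<^sub>t w \<in> ctangent_space A p"
proof -
  obtain x y x' y' where xy: "v = ct p x +\<^sub>t \<i> *\<^sub>t ct p y" "w = ct p x' +\<^sub>t \<i> *\<^sub>t ct p y'"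
    using v w ctangent_iff[OF p] by blast
  have "c *\<^sub>t v +\<^sub>t d *\<^sub>t w =
     ct p ((Re c *\<^sub>R x + (- Im c) *\<^sub>R y) + (Re d *\<^sub>R x' + (- Im d) *\<^sub>R y')) +\<^sub>t
     \<i> *\<^sub>t ct p ((Im c *\<^sub>R x + Re c *\<^sub>R y) + (Im d *\<^sub>R x' + Re d *\<^sub>R y'))"
    unfolding xy ct_add[OF p] ct_scale[OF p]
    by (subst (1) complex_eq[of c], subst (1) complex_eq[of d]) (auto simp: fun_eq_iff tadd_def tscale_def algebra_simps)
  then show ?thesis using ctangent_iff[OF p] by blast
qed

lemma ctangent_add: "p \<in> U0 \<Longrightarrow> v \<in> ctangent_space A p \<Longrightarrow> w \<in> ctangent_space A p \<Longrightarrow> v +\<^sub>t w \<in> ctangent_space A p"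
  using ctangent_add_scale[of p v w 1 1] by (simp add: tscale_def)

lemma ctangent_scale: "p \<in> U0 \<Longrightarrow> v \<in> ctangent_space A p \<Longrightarrow> c *\<^sub>t v \<in> ctangent_space A p"
  using ctangent_add_scale[of p v v c 0] by (simp add: tscale_def tadd_def)

end

lemma smooth_atlas_chart_at:
  assumes "smooth_atlas A"
  obtains U \<phi> where "chart A U \<phi>" "p \<in> U"
proof -
  have "p \<in> (\<Union>(U, \<phi>)\<in>A. U)" using assms by (simp add: smooth_atlas_def)
  then obtain U \<phi> where "(U, \<phi>) \<in> A" "p \<in> U" by auto
  then show ?thesis using assms that by (auto simp: chart_def)
qed

lemma one_form_fun_diff:
  assumes A: "smooth_atlas A" and f: "smooth_fun A V f" and V: "open V"
  shows "one_form A V (fun_diff A V f)"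
  unfolding one_form_def
proof (intro conjI ballI allI impI)
  fix p assume p: "p \<in> V"
  obtain U \<phi> where U: "chart A U \<phi>" "p \<in> U" using smooth_atlas_chart_at[OF A] by blast
  have "c *\<^sub>t v +\<^sub>t d *\<^sub>t w \<in> ctangent_space A p"
    if "v \<in> ctangent_space A p" "w \<in> ctangent_space A p" for v w c d
    using chart.ctangent_add_scale[OF U that] .
  then show "fun_diff A V f p \<in> ccovectors A p"
    using p by (auto simp: ccovectors_def fun_diff_def tadd_def tscale_def)
next
  fix W X assume "open W \<and> W \<subseteq> V \<and> smooth_section A W (ctangent_space A) X"
  then have W: "open W" "W \<subseteq> V" "smooth_section A W (ctangent_space A) X" by auto
  have "smooth_fun A V (\<lambda>q. complex_of_real (f q))"
    by (rule smooth_fun_bounded_linear[OF A V bounded_linear_of_real f])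
  then have "smooth_fun A W (\<lambda>q. X q (\<lambda>q. complex_of_real (f q)))"
    using W smooth_fun_subset unfolding smooth_section_def by blast
  then show "smooth_fun A W (\<lambda>q. fun_diff A V f q (X q))"
    by (rule smooth_fun_cong[OF A W(1)]) (use W in \<open>auto simp: fun_diff_def smooth_section_def subset_iff\<close>)
qed (simp add: fun_diff_def)

lemma one_form_add_cmult:
  assumes A: "smooth_atlas A" and "one_form A V \<alpha>" "one_form A V \<beta>"
  shows "one_form A V (\<lambda>p v. \<alpha> p v + c * \<beta> p v)"
  unfolding one_form_def
proof (intro conjI ballI allI impI)
  show "(\<lambda>v. \<alpha> p v + c * \<beta> p v) \<in> ccovectors A p" if "p \<in> V" for p
  proof -
    have "\<alpha> p \<in> ccovectors A p" "\<beta> p \<in> ccovectors A p" using assms that by (auto simp: one_form_def)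
    then show ?thesis unfolding ccovectors_def by (auto simp: algebra_simps)
  qed
  fix W X assume W: "open W \<and> W \<subseteq> V \<and> smooth_section A W (ctangent_space A) X"
  then have "smooth_fun A W (\<lambda>q. \<alpha> q (X q))" "smooth_fun A W (\<lambda>q. \<beta> q (X q))"
    using assms by (auto simp: one_form_def)
  then show "smooth_fun A W (\<lambda>q. \<alpha> q (X q) + c * \<beta> q (X q))"
    using W smooth_fun_add[OF A] smooth_fun_mult[OF A _ smooth_fun_const] by blast
qed (use assms in \<open>auto simp: one_form_def\<close>)

lemma fd_sum_scaleR:
  assumes "\<And>i. i \<in> I \<Longrightarrow> f i differentiable at z"
  shows "fd (\<lambda>z. \<Sum>i\<in>I. c i *\<^sub>R f i z) z v = (\<Sum>i\<in>I. c i *\<^sub>R fd (f i) z v)"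
proof -
  have "((\<lambda>z. \<Sum>i\<in>I. c i *\<^sub>R f i z) has_derivative (\<lambda>v. \<Sum>i\<in>I. c i *\<^sub>R fd (f i) z v)) (at z)"
    using assms by (intro has_derivative_sum has_derivative_scaleR_right has_derivative_fd)
  then show ?thesis by (simp add: fd_eqI)
qed

locale cr_frame = chart "atl M" U0 \<phi>
  for M :: "('a::t2_space, 'e::euclidean_space) cr_struct" and U0 \<phi> +
  fixes n k :: nat and W0 :: "'a set" and E :: "nat \<Rightarrow> 'a vfield"
  assumes CR: "CR_manifold n k M"
    and W0: "open W0" "W0 \<subseteq> U0"
    and E_section: "i < 2 * n \<Longrightarrow> smooth_section (atl M) W0 (tangent_space (atl M)) (E i)"
    and hor_frame: "q \<in> W0 \<Longrightarrow>
      hor M q = {lincomb (2 * n) (\<lambda>i. complex_of_real (c i)) (\<lambda>i. E i q) | c. True}"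
    and frame_indep: "q \<in> W0 \<Longrightarrow>
      lincomb (2 * n) (\<lambda>i. complex_of_real (c i)) (\<lambda>i. E i q) = (\<lambda>f. 0) \<Longrightarrow> i < 2 * n \<Longrightarrow> c i = 0"
begin

abbreviation "A \<equiv> atl M"

definition e where "e i = comp (E i)"
definition je where "je i = comp (\<lambda>q. cpx M q (E i q))"
text \<open>Coordinate expression of the section of HM with constant coefficients c in the frame;
  \<open>jvec c\<close> is that of its image under J. Quadratic forms on a fibre become quadratic
  forms in c, with matrices that depend on the point.\<close>

definition vec where "vec c z = (\<Sum>i<2*n. c i *\<^sub>R e i z)" for c :: "nat \<Rightarrow> real"
definition jvec where "jvec c z = (\<Sum>i<2*n. c i *\<^sub>R je i z)" for c :: "nat \<Rightarrow> real"

section \<open>The frame of HM and its image under J\<close>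

lemma open_imgW: "open (\<phi> ` W0)"
  using open_img[OF W0] .

lemma e_smooth: "i < 2 * n \<Longrightarrow> Cinf_on (\<phi> ` W0) (e i)"
  unfolding e_def using comp_smooth[OF E_section W0] .

lemma E_eq: "q \<in> W0 \<Longrightarrow> i < 2 * n \<Longrightarrow> E i q = ct q (e i (\<phi> q))"
  unfolding e_def using ct_comp[of q "E i"] E_section W0 by (auto simp: smooth_section_def)

lemma lincomb_E: "q \<in> W0 \<Longrightarrow> lincomb (2 * n) (\<lambda>i. complex_of_real (c i)) (\<lambda>i. E i q) = ct q (vec c (\<phi> q))"
  using W0 by (auto simp: lincomb_def vec_def ct_sum E_eq intro!: sum.cong)

lemma hor_eq: "q \<in> W0 \<Longrightarrow> hor M q = range (\<lambda>c. ct q (vec c (\<phi> q)))"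
  using hor_frame lincomb_E by auto

lemma vec_indep: "q \<in> W0 \<Longrightarrow> vec c (\<phi> q) = 0 \<Longrightarrow> i < 2 * n \<Longrightarrow> c i = 0"
  using frame_indep[of q c i] lincomb_E[of q c] ct_zero[of q] W0 by auto

lemma hor_tangent: "q \<in> W0 \<Longrightarrow> v \<in> hor M q \<Longrightarrow> v \<in> tangent_space A q"
  using W0(2) by (auto simp: hor_eq intro!: ct_tangent)

lemma vec_hor: "q \<in> W0 \<Longrightarrow> ct q (vec c (\<phi> q)) \<in> hor M q"
  by (auto simp: hor_eq)

lemma vec_unit: "i < 2 * n \<Longrightarrow> vec (\<lambda>j. if j = i then 1 else 0) z = e i z"
  by (simp add: vec_def if_distrib[of "\<lambda>x. x *\<^sub>R _"] cong: if_cong)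

lemma E_hor: "q \<in> W0 \<Longrightarrow> i < 2 * n \<Longrightarrow> E i q \<in> hor M q"
  using vec_hor[of q "\<lambda>j. if j = i then 1 else 0"] by (simp add: E_eq vec_unit)

lemmas CRD = CR[unfolded CR_manifold_def, THEN conjunct2, THEN conjunct2, THEN conjunct2]

lemma cpx_hor: "v \<in> hor M q \<Longrightarrow> cpx M q v \<in> hor M q"
  and cpx_cpx: "v \<in> hor M q \<Longrightarrow> cpx M q (cpx M q v) = (- 1) *\<^sub>t v"
  using CRD[THEN conjunct1, rule_format, of v q] by auto

lemma cpx_lin: "v \<in> hor M q \<Longrightarrow> w \<in> hor M q \<Longrightarrow>
    cpx M q (complex_of_real a *\<^sub>t v +\<^sub>t complex_of_real b *\<^sub>t w) =
    complex_of_real a *\<^sub>t cpx M q v +\<^sub>t complex_of_real b *\<^sub>t cpx M q w"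
  by (rule CRD[THEN conjunct2, THEN conjunct1, rule_format])

lemma cpx_section: "open V \<Longrightarrow> smooth_section A V (hor M) X \<Longrightarrow>
    smooth_section A V (hor M) (\<lambda>q. cpx M q (X q))"
  by (rule CRD[THEN conjunct2, THEN conjunct2, THEN conjunct1, rule_format]) (rule conjI)

lemma hor_section_tangent: "smooth_section A V (hor M) X \<Longrightarrow> V \<subseteq> W0 \<Longrightarrow>
    smooth_section A V (tangent_space A) X"
  by (erule smooth_section_mono) (use hor_tangent in blast)

lemma tangent_section_hor: "smooth_section A V (tangent_space A) X \<Longrightarrow> (\<And>q. q \<in> V \<Longrightarrow> X q \<in> hor M q) \<Longrightarrow>
    smooth_section A V (hor M) X"
  by (auto simp: smooth_section_def)

lemma E_hor_section: "i < 2 * n \<Longrightarrow> smooth_section A W0 (hor M) (E i)"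
  using E_section E_hor by (blast intro: tangent_section_hor)

lemma je_smooth: "i < 2 * n \<Longrightarrow> Cinf_on (\<phi> ` W0) (je i)"
  unfolding je_def
  by (rule comp_smooth[OF hor_section_tangent[OF cpx_section[OF W0(1) E_hor_section] order_refl] W0])

lemma cpx_E: "q \<in> W0 \<Longrightarrow> i < 2 * n \<Longrightarrow> cpx M q (E i q) = ct q (je i (\<phi> q))"
  unfolding je_def using ct_comp[of q "\<lambda>q. cpx M q (E i q)"] hor_tangent cpx_hor E_hor W0 by auto

lemma vec_smooth: "Cinf_on (\<phi> ` W0) (vec c)"
  unfolding vec_def[abs_def] by (intro Cinf_on_sum Cinf_on_scaleR Cinf_on_const e_smooth open_imgW) auto

lemma jvec_smooth: "Cinf_on (\<phi> ` W0) (jvec c)"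
  unfolding jvec_def[abs_def] by (intro Cinf_on_sum Cinf_on_scaleR Cinf_on_const je_smooth open_imgW) auto

lemma ct_sum_in_hor:
  assumes q: "q \<in> W0" and m: "m \<le> 2 * n"
  shows "ct q (\<Sum>i<m. c i *\<^sub>R e i (\<phi> q)) \<in> hor M q"
proof -
  have "vec (\<lambda>i. if i < m then c i else 0) (\<phi> q) = (\<Sum>i<m. c i *\<^sub>R e i (\<phi> q))"
    unfolding vec_def by (rule sum.mono_neutral_cong_right) (use m in auto)
  then show ?thesis using vec_hor[OF q, of "\<lambda>i. if i < m then c i else 0"] by simp
qed

lemma ct_sum_Suc:
  assumes q: "q \<in> U0"
  shows "ct q (\<Sum>i<Suc m. c i *\<^sub>R x i) =
    complex_of_real 1 *\<^sub>t ct q (\<Sum>i<m. c i *\<^sub>R x i) +\<^sub>t complex_of_real (c m) *\<^sub>t ct q (x m)"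
  using q by (simp add: ct_add ct_scale tscale_def)

lemma cpx_vec:
  assumes q: "q \<in> W0"
  shows "cpx M q (ct q (vec c (\<phi> q))) = ct q (jvec c (\<phi> q))"
proof -
  have qU: "q \<in> U0" using q W0 by auto
  \<comment> \<open>By induction on the number of terms, as \<open>cpx_lin\<close> splits two terms
    and only within HM.\<close>
  have "cpx M q (ct q (\<Sum>i<m. c i *\<^sub>R e i (\<phi> q))) = ct q (\<Sum>i<m. c i *\<^sub>R je i (\<phi> q))" if "m \<le> 2 * n" for m
    using that
  proof (induction m)
    case 0
    have z: "ct q 0 \<in> hor M q" using ct_sum_in_hor[OF q, of 0] by simp
    have "cpx M q (complex_of_real 0 *\<^sub>t ct q 0 +\<^sub>t complex_of_real 0 *\<^sub>t ct q 0) = (\<lambda>f. 0)"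
      unfolding cpx_lin[OF z z] by (simp add: tadd_def tscale_def)
    then show ?case by (simp add: ct_zero[OF qU] tadd_def tscale_def)
  next
    case (Suc m)
    have "ct q (e m (\<phi> q)) \<in> hor M q" using E_hor[OF q, of m] E_eq[OF q, of m] Suc.prems by simp
    moreover have "cpx M q (ct q (e m (\<phi> q))) = ct q (je m (\<phi> q))"
      using cpx_E[OF q, of m] E_eq[OF q, of m] Suc.prems by simp
    ultimately show ?case
      unfolding ct_sum_Suc[OF qU]
      using cpx_lin[OF ct_sum_in_hor[OF q, of m c], of "ct q (e m (\<phi> q))" 1 "c m"] Suc by simp
  qed
  from this[of "2 * n"] show ?thesis by (simp add: vec_def jvec_def)
qed

lemma jvec_hor: "q \<in> W0 \<Longrightarrow> ct q (jvec c (\<phi> q)) \<in> hor M q"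
  using cpx_hor[OF vec_hor] cpx_vec by metis

lemma vec_section: "smooth_section A W0 (hor M) (\<lambda>q. ct q (vec c (\<phi> q)))"
  by (rule tangent_section_hor[OF section_of_rep[OF vec_smooth _ W0]]) (auto intro: vec_hor)

lemma jvec_section: "smooth_section A W0 (hor M) (\<lambda>q. ct q (jvec c (\<phi> q)))"
  by (rule tangent_section_hor[OF section_of_rep[OF jvec_smooth _ W0]]) (auto intro: jvec_hor)

lemma subspace_vec: "subspace (range (\<lambda>c. vec c z))"
proof -
  have "vec (\<lambda>i. 0) z = 0" by (simp add: vec_def)
  moreover have "vec c z + vec d z = vec (\<lambda>i. c i + d i) z" "r *\<^sub>R vec c z = vec (\<lambda>i. r * c i) z" for c d r
    by (auto simp: vec_def sum.distrib scaleR_left_distrib scaleR_sum_right)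
  ultimately show ?thesis unfolding subspace_def by (auto simp: image_iff)
qed

text \<open>The Gram matrix of the frame is positive definite at q. The bound, uniform near q,
  controls the coefficients of a vector by its norm.\<close>

lemma vec_lower_bound:
  assumes q: "q \<in> W0"
  shows "\<exists>m>0. eventually (\<lambda>z. \<forall>c. m * (\<Sum>i<2*n. (c i)\<^sup>2) \<le> (norm (vec c z))\<^sup>2) (nhds (\<phi> q))"
proof -
  have n2: "(norm (vec c z))\<^sup>2 = (\<Sum>i<2*n. \<Sum>j<2*n. c i * c j * (e i z \<bullet> e j z))" for c z
    unfolding power2_norm_eq_inner vec_def
    by (simp add: inner_sum_left inner_sum_right sum_distrib_left mult_ac)
       (intro sum.cong refl, simp add: inner_commute)
  have "\<exists>m>0. eventually (\<lambda>z. \<forall>c. m * (\<Sum>i<2*n. (c i)\<^sup>2) \<le>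
     (\<Sum>i<2*n. \<Sum>j<2*n. c i * c j * (e i z \<bullet> e j z))) (nhds (\<phi> q))"
  proof (rule posdef_eventually_lower_bound)
    fix i j assume "i < 2 * n" "j < 2 * n"
    then have "isCont (e i) (\<phi> q)" "isCont (e j) (\<phi> q)"
      using Cinf_on_continuous_on[OF e_smooth] open_imgW q continuous_on_eq_continuous_at by blast+
    then show "isCont (\<lambda>z. e i z \<bullet> e j z) (\<phi> q)" by (intro continuous_intros)
  next
    fix c :: "nat \<Rightarrow> real" assume "\<exists>i<2*n. c i \<noteq> 0"
    then have "vec c (\<phi> q) \<noteq> 0" using vec_indep[OF q] by blast
    then show "0 < (\<Sum>i<2*n. \<Sum>j<2*n. c i * c j * (e i (\<phi> q) \<bullet> e j (\<phi> q)))"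
      unfolding n2[symmetric] by simp
  qed
  then show ?thesis unfolding n2 .
qed

text \<open>The difference quotients of \<open>d\<close> lie in nearby fibres, with bounded coefficients in the frame,
  so their distance to the fibre at \<open>q\<close>, a closed set, tends to \<open>0\<close>.\<close>

lemma vanishing_section_derivative:
  assumes q: "q \<in> G" and G: "open G" "G \<subseteq> W0" and d: "Cinf_on (\<phi> ` G) d"
    and hor: "\<And>z. z \<in> \<phi> ` G \<Longrightarrow> \<exists>c. d z = vec c z" and d0: "d (\<phi> q) = 0"
  shows "\<exists>c. fd d (\<phi> q) w = vec c (\<phi> q)"
proof -
  let ?z = "\<phi> q"
  have qW: "q \<in> W0" using q G by auto
  have oG: "open (\<phi> ` G)" using open_img G W0 by auto
  obtain m where m: "m > 0" and ev: "eventually (\<lambda>z. \<forall>c. m * (\<Sum>i<2*n. (c i)\<^sup>2) \<le> (norm (vec c z))\<^sup>2) (nhds ?z)"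
    using vec_lower_bound[OF qW] by blast
  obtain cf where cf: "\<And>z. z \<in> \<phi> ` G \<Longrightarrow> d z = vec (cf z) z" using hor by metis
  define u where "u t = (1 / t) *\<^sub>R d (?z + t *\<^sub>R w)" for t :: real
  define b where "b t i = cf (?z + t *\<^sub>R w) i / t" for t :: real and i
  have lin: "((\<lambda>t. ?z + t *\<^sub>R w) \<longlongrightarrow> ?z) (at_right 0)"
    by (auto intro!: tendsto_eq_intros)
  have evG: "eventually (\<lambda>t. ?z + t *\<^sub>R w \<in> \<phi> ` G) (at_right 0)"
    using lin oG q by (auto intro: topological_tendstoD)
  have u_eq: "u t = vec (b t) (?z + t *\<^sub>R w)" if "?z + t *\<^sub>R w \<in> \<phi> ` G" for t
    unfolding u_def cf[OF that] vec_def b_def by (simp add: scaleR_sum_right divide_inverse mult.commute)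
  have lim_u: "(u \<longlongrightarrow> fd d ?z w) (at_right 0)"
  proof -
    have l: "linear (fd d ?z)" using Cinf_on_linear_fd[OF d] q by auto
    have a: "((\<lambda>t. ?z + t *\<^sub>R w) has_derivative (\<lambda>h. h *\<^sub>R w)) (at 0)"
      by (auto intro!: derivative_eq_intros)
    have "((\<lambda>t. d (?z + t *\<^sub>R w)) has_derivative (\<lambda>h. fd d (?z + 0 *\<^sub>R w) (h *\<^sub>R w))) (at 0)"
      by (rule diff_chain_at[OF a Cinf_on_has_derivative[OF d], unfolded o_def]) (use q in simp)
    then have "((\<lambda>t. d (?z + t *\<^sub>R w)) has_derivative (\<lambda>h. h *\<^sub>R fd d ?z w)) (at 0)"
      by (simp add: linear_cmul[OF l])
    then have "((\<lambda>h. norm (d (?z + h *\<^sub>R w) - h *\<^sub>R fd d ?z w) / norm h) \<longlongrightarrow> 0) (at 0)"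
      by (simp add: has_derivative_at d0)
    moreover have "eventually (\<lambda>h. norm (d (?z + h *\<^sub>R w) - h *\<^sub>R fd d ?z w) / norm h = norm (u h - fd d ?z w)) (at 0)"
      unfolding eventually_at_filter
    proof (intro always_eventually allI impI)
      fix h :: real assume h: "h \<noteq> 0"
      have "d (?z + h *\<^sub>R w) - h *\<^sub>R fd d ?z w = h *\<^sub>R (u h - fd d ?z w)"
        using h by (simp add: u_def scaleR_diff_right)
      then show "norm (d (?z + h *\<^sub>R w) - h *\<^sub>R fd d ?z w) / norm h = norm (u h - fd d ?z w)"
        using h by simp
    qed
    ultimately have "((\<lambda>h. norm (u h - fd d ?z w)) \<longlongrightarrow> 0) (at 0)" by (rule Lim_transform_eventually)
    then have "(u \<longlongrightarrow> fd d ?z w) (at 0)" by (simp add: tendsto_norm_zero_iff LIM_zero_iff)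
    then show ?thesis by (rule filterlim_mono[OF _ order_refl]) (simp add: at_le)
  qed
  \<comment> \<open>The error of replacing the frame at the moving point by the frame at q, so that
    \<open>u t - r t\<close> lies in the fibre at q.\<close>
  define r where "r t = (\<Sum>i<2*n. b t i *\<^sub>R (e i (?z + t *\<^sub>R w) - e i ?z))" for t
  have lim_r: "(r \<longlongrightarrow> 0) (at_right 0)"
  proof (rule Lim_null_comparison)
    show "eventually (\<lambda>t. norm (r t) \<le> norm (u t) / sqrt m * (\<Sum>i<2*n. norm (e i (?z + t *\<^sub>R w) - e i ?z))) (at_right 0)"
      using evG eventually_compose_filterlim[OF ev lin]
    proof eventually_elim
      case (elim t)
      have "\<bar>b t i\<bar> \<le> norm (u t) / sqrt m" if i: "i < 2 * n" for i
      proof -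
        have "(b t i)\<^sup>2 \<le> (\<Sum>i<2*n. (b t i)\<^sup>2)" using i by (intro member_le_sum) auto
        then have "m * (b t i)\<^sup>2 \<le> m * (\<Sum>i<2*n. (b t i)\<^sup>2)" using m by simp
        also have "\<dots> \<le> (norm (u t))\<^sup>2" using elim(2) unfolding u_eq[OF elim(1)] by blast
        finally have "(b t i)\<^sup>2 \<le> (norm (u t) / sqrt m)\<^sup>2" using m by (simp add: power_divide field_simps)
        then show ?thesis using m abs_le_square_iff[of "b t i" "norm (u t) / sqrt m"] by simp
      qed
      then have "norm (b t i *\<^sub>R (e i (?z + t *\<^sub>R w) - e i ?z)) \<le>
          norm (u t) / sqrt m * norm (e i (?z + t *\<^sub>R w) - e i ?z)" if "i < 2 * n" for i
        unfolding norm_scaleR real_norm_def using that by (intro mult_right_mono) auto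
      then show ?case
        unfolding r_def sum_distrib_left by (intro order_trans[OF norm_sum] sum_mono) auto
    qed
    have "((\<lambda>t. e i (?z + t *\<^sub>R w)) \<longlongrightarrow> e i ?z) (at_right 0)" if "i < 2 * n" for i
    proof -
      have "isCont (e i) ?z"
        using Cinf_on_continuous_on[OF e_smooth[OF that]] open_imgW qW continuous_on_eq_continuous_at by blast
      then show ?thesis by (rule isCont_tendsto_compose[OF _ lin])
    qed
    then have "((\<lambda>t. \<Sum>i<2*n. norm (e i (?z + t *\<^sub>R w) - e i ?z)) \<longlongrightarrow> (\<Sum>i<2*n. norm (e i ?z - e i ?z))) (at_right 0)"
      by (intro tendsto_sum tendsto_norm tendsto_diff tendsto_const) auto
    moreover have "((\<lambda>t. norm (u t) / sqrt m) \<longlongrightarrow> norm (fd d ?z w) / sqrt m) (at_right 0)"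
      by (intro tendsto_divide tendsto_norm lim_u tendsto_const) (use m in auto)
    ultimately show "((\<lambda>t. norm (u t) / sqrt m * (\<Sum>i<2*n. norm (e i (?z + t *\<^sub>R w) - e i ?z))) \<longlongrightarrow> 0) (at_right 0)"
      using tendsto_mult by fastforce
  qed
  have lim: "((\<lambda>t. u t - r t) \<longlongrightarrow> fd d ?z w) (at_right 0)" using tendsto_diff[OF lim_u lim_r] by simp
  have ev_in: "eventually (\<lambda>t. u t - r t \<in> range (\<lambda>c. vec c ?z)) (at_right 0)"
    using evG
  proof eventually_elim
    case (elim t)
    have "u t - r t = vec (b t) ?z"
      unfolding u_eq[OF elim] r_def vec_def by (simp add: scaleR_diff_right sum_subtractf)
    then show ?case by blast
  qed
  have "fd d ?z w \<in> range (\<lambda>c. vec c ?z)"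
    by (rule Lim_in_closed_set[OF closed_subspace[OF subspace_vec] ev_in _ lim]) simp
  then show ?thesis by auto
qed

section \<open>The Levi form, and the action of a gauge on HM\<close>

lemma H0_ccovector: "\<xi> \<in> H0 M q \<Longrightarrow> \<xi> \<in> ccovectors A q"
  and H0_real: "\<xi> \<in> H0 M q \<Longrightarrow> v \<in> tangent_space A q \<Longrightarrow> \<xi> v \<in> \<real>"
  and H0_hor: "\<xi> \<in> H0 M q \<Longrightarrow> v \<in> hor M q \<Longrightarrow> \<xi> v = 0"
  by (auto simp: H0_def)

text \<open>Two sections of HM with the same value at q differ by one that vanishes there; its
  derivatives at q lie in the fibre, where \<xi> is 0. The bracket involves only first derivatives
  along the common values, so \<xi> of it does not see the extension.\<close>

lemma levi_unique:
  assumes q: "q \<in> W0" and \<xi>: "\<xi> \<in> H0 M q"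
    and X: "open W" "q \<in> W" "smooth_section A W (hor M) X"
    and Y: "open W'" "q \<in> W'" "smooth_section A W' (hor M) Y" and eq: "X q = Y q"
  shows "\<xi> (lie_bracket A (\<lambda>q. cpx M q (X q)) X q) = \<xi> (lie_bracket A (\<lambda>q. cpx M q (Y q)) Y q)"
    and "\<xi> (lie_bracket A (\<lambda>q. cpx M q (X q)) X q) \<in> \<real>"
proof -
  let ?z = "\<phi> q"
  define G where "G = W \<inter> W' \<inter> W0"
  have G: "open G" "q \<in> G" "G \<subseteq> W0" "G \<subseteq> U0" "G \<subseteq> W" "G \<subseteq> W'" using q X Y W0 by (auto simp: G_def)
  have qU: "q \<in> U0" using G by auto
  have Xs: "smooth_section A G (hor M) X" and Ys: "smooth_section A G (hor M) Y"
    by (rule smooth_section_subset[OF X(3) G(5)], rule smooth_section_subset[OF Y(3) G(6)])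
  note tan = hor_section_tangent[OF _ G(3)]
  obtain x where x: "Cinf_on (\<phi> ` G) x" "\<And>p. p \<in> G \<Longrightarrow> X p = ct p (x (\<phi> p))"
    using section_rep[OF tan[OF Xs] G(1,4)] by blast
  obtain y where y: "Cinf_on (\<phi> ` G) y" "\<And>p. p \<in> G \<Longrightarrow> Y p = ct p (y (\<phi> p))"
    using section_rep[OF tan[OF Ys] G(1,4)] by blast
  obtain jx where jx: "Cinf_on (\<phi> ` G) jx" "\<And>p. p \<in> G \<Longrightarrow> cpx M p (X p) = ct p (jx (\<phi> p))"
    using section_rep[OF tan[OF cpx_section[OF G(1) Xs]] G(1,4)] by blast
  obtain jy where jy: "Cinf_on (\<phi> ` G) jy" "\<And>p. p \<in> G \<Longrightarrow> cpx M p (Y p) = ct p (jy (\<phi> p))"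
    using section_rep[OF tan[OF cpx_section[OF G(1) Ys]] G(1,4)] by blast
  have z: "x ?z = y ?z" "jx ?z = jy ?z"
    using x(2)[OF G(2)] y(2)[OF G(2)] jx(2)[OF G(2)] jy(2)[OF G(2)] eq ct_inj[OF qU] by metis+
  have bx: "lie_bracket A (\<lambda>q. cpx M q (X q)) X q = ct q (fd x ?z (jx ?z) - fd jx ?z (x ?z))"
    by (rule lie_bracket_ct[OF jx x G(1,4,2)])
  have by': "lie_bracket A (\<lambda>q. cpx M q (Y q)) Y q = ct q (fd y ?z (jy ?z) - fd jy ?z (y ?z))"
    by (rule lie_bracket_ct[OF jy y G(1,4,2)])
  show "\<xi> (lie_bracket A (\<lambda>q. cpx M q (X q)) X q) \<in> \<real>"
    unfolding bx by (rule H0_real[OF \<xi> ct_tangent[OF qU]])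
  have diff: "\<xi> (ct q (fd f ?z w)) = \<xi> (ct q (fd g ?z w))"
    if f: "Cinf_on (\<phi> ` G) f" "\<And>p. p \<in> G \<Longrightarrow> ct p (f (\<phi> p)) \<in> hor M p"
      and g: "Cinf_on (\<phi> ` G) g" "\<And>p. p \<in> G \<Longrightarrow> ct p (g (\<phi> p)) \<in> hor M p" and fg: "f ?z = g ?z" for f g w
  proof -
    have oG: "open (\<phi> ` G)" "?z \<in> \<phi> ` G" using open_img G by auto
    have "\<exists>c. f (\<phi> p) - g (\<phi> p) = vec c (\<phi> p)" if p: "p \<in> G" for p
    proof -
      have pW: "p \<in> W0" "p \<in> U0" using G p by auto
      obtain c d where "f (\<phi> p) = vec c (\<phi> p)" "g (\<phi> p) = vec d (\<phi> p)"
        using f(2)[OF p] g(2)[OF p] ct_inj[OF pW(2)] unfolding hor_eq[OF pW(1)] by blast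
      then have "f (\<phi> p) \<in> range (\<lambda>c. vec c (\<phi> p))" "g (\<phi> p) \<in> range (\<lambda>c. vec c (\<phi> p))" by auto
      from subspace_diff[OF subspace_vec this] show ?thesis by auto
    qed
    then have "\<exists>c. fd (\<lambda>z. f z - g z) ?z w = vec c ?z"
      by (intro vanishing_section_derivative[OF G(2,1,3) Cinf_on_diff[OF f(1) g(1) oG(1)]]) (auto simp: fg)
    moreover have "fd (\<lambda>z. f z - g z) ?z w = fd f ?z w - fd g ?z w"
      using has_derivative_diff[OF Cinf_on_has_derivative[OF f(1) oG(2)] Cinf_on_has_derivative[OF g(1) oG(2)]]
      by (simp add: fd_eqI)
    ultimately have "\<xi> (ct q (fd f ?z w - fd g ?z w)) = 0" using H0_hor[OF \<xi>] vec_hor[OF q] by metis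
    then show ?thesis
      using linear_diff[OF ccovector_linear[OF H0_ccovector[OF \<xi>] qU], of "fd f ?z w" "fd g ?z w"] by simp
  qed
  have hx: "ct p (x (\<phi> p)) \<in> hor M p" "ct p (y (\<phi> p)) \<in> hor M p" "ct p (jx (\<phi> p)) \<in> hor M p"
    "ct p (jy (\<phi> p)) \<in> hor M p" if "p \<in> G" for p
    using x(2)[OF that] y(2)[OF that] jx(2)[OF that] jy(2)[OF that] Xs Ys cpx_hor that
    unfolding smooth_section_def by metis+
  note lin = linear_diff[OF ccovector_linear[OF H0_ccovector[OF \<xi>] qU]]
  show "\<xi> (lie_bracket A (\<lambda>q. cpx M q (X q)) X q) = \<xi> (lie_bracket A (\<lambda>q. cpx M q (Y q)) Y q)"
    unfolding bx by' lin z
    using diff[OF x(1) hx(1) y(1) hx(2) z(1)] diff[OF jx(1) hx(3) jy(1) hx(4) z(2)] by simp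
qed

lemma levi_section:
  assumes q: "q \<in> W0" and \<xi>: "\<xi> \<in> H0 M q" and X: "open W" "q \<in> W" "smooth_section A W (hor M) X"
  shows "levi_form M q \<xi> (X q) = Re (\<xi> (lie_bracket A (\<lambda>q. cpx M q (X q)) X q))"
  unfolding levi_form_def
proof (rule the_equality)
  show "\<forall>Y W. open W \<and> q \<in> W \<and> smooth_section A W (hor M) Y \<and> Y q = X q \<longrightarrow>
    complex_of_real (Re (\<xi> (lie_bracket A (\<lambda>q. cpx M q (X q)) X q))) =
    \<xi> (lie_bracket A (\<lambda>q. cpx M q (Y q)) Y q)"
  proof (intro allI impI, elim conjE)
    fix Y W' assume Y: "open W'" "q \<in> W'" "smooth_section A W' (hor M) Y" and eq: "Y q = X q"
    show "complex_of_real (Re (\<xi> (lie_bracket A (\<lambda>q. cpx M q (X q)) X q))) =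
      \<xi> (lie_bracket A (\<lambda>q. cpx M q (Y q)) Y q)"
      using levi_unique[OF q \<xi> X Y eq[symmetric]] by (simp add: of_real_Re)
  qed
  show "c = Re (\<xi> (lie_bracket A (\<lambda>q. cpx M q (X q)) X q))"
    if c: "\<forall>Y W. open W \<and> q \<in> W \<and> smooth_section A W (hor M) Y \<and> Y q = X q \<longrightarrow>
      complex_of_real c = \<xi> (lie_bracket A (\<lambda>q. cpx M q (Y q)) Y q)" for c
    using c[rule_format, of W X] X by (metis Re_complex_of_real)
qed

text \<open>\<open>fst lam \<alpha>\<close> is 0 on \<open>T01\<close>, and it agrees with \<alpha>
  on \<open>T10\<close> because \<open>snd lam \<alpha>\<close> is 0 there. These two equations, at
  v + \<i> Jv and v - \<i> Jv, determine it on HM whatever the gauge: it is the part of type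
  (1,0).\<close>

lemma gauge_hor:
  assumes lam: "CR_gauge M V lam" and \<alpha>: "one_form A V \<alpha>" and q: "q \<in> V" "q \<in> W0" and v: "v \<in> hor M q"
  shows "fst lam \<alpha> q v = (\<alpha> q v - \<i> * \<alpha> q (cpx M q v)) / 2"
proof -
  have qU: "q \<in> U0" using q W0 by auto
  define w where "w = cpx M q v"
  have vw: "v \<in> tangent_space A q" "w \<in> tangent_space A q"
    using hor_tangent[OF q(2)] v cpx_hor w_def by auto
  have vc: "v \<in> ctangent_space A q" "w \<in> ctangent_space A q" using tangent_in_ctangent[OF qU] vw by auto
  obtain x y where xy: "v = ct q x" "w = ct q y" using vw tangent_space_eq[OF qU] by auto
  define Z where "Z = v +\<^sub>t \<i> *\<^sub>t w"
  have Z: "Z \<in> T01 M q" using v by (auto simp: T01_def Z_def w_def)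
  have "tconj Z = tconj v +\<^sub>t (- \<i>) *\<^sub>t tconj w" by (simp add: Z_def tconj_def tadd_def tscale_def)
  \<comment> \<open>Both v and Jv are real vectors, so conjugation changes only the sign of
    \<i>.\<close>
  then have Zc: "tconj Z = v +\<^sub>t (- \<i>) *\<^sub>t w" by (simp add: xy tconj_ct[OF qU])
  have Z10: "tconj Z \<in> T10 M q" using Z by (simp add: T10_def)
  have \<beta>: "one_form A V (fst lam \<alpha>)" using lam \<alpha> by (auto simp: CR_gauge_def form_linear_def)
  have b: "fst lam \<alpha> q \<in> ccovectors A q" and a: "\<alpha> q \<in> ccovectors A q"
    using \<alpha> \<beta> q by (auto simp: one_form_def)
  have ap: "\<gamma> (v +\<^sub>t c *\<^sub>t w) = \<gamma> v + c * \<gamma> w" if "\<gamma> \<in> ccovectors A q" for \<gamma> c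
    using ccovector_add[OF that vc(1) ctangent_scale[OF qU vc(2)]] ccovector_scale[OF that vc(2)] by simp
  have 1: "fst lam \<alpha> q Z = 0" and 2: "snd lam \<alpha> q (tconj Z) = 0"
    and 3: "\<alpha> = (\<lambda>p v. fst lam \<alpha> p v - snd lam \<alpha> p v)"
    using lam \<alpha> q Z Z10 by (auto simp: CR_gauge_def)
  have "\<alpha> q (tconj Z) = fst lam \<alpha> q (tconj Z)" using 2 fun_cong[OF fun_cong[OF 3, of q], of "tconj Z"] by simp
  then have "\<alpha> q v - \<i> * \<alpha> q w = fst lam \<alpha> q v - \<i> * fst lam \<alpha> q w"
    unfolding Zc ap[OF a] ap[OF b] by simp
  moreover have "fst lam \<alpha> q v + \<i> * fst lam \<alpha> q w = 0" using 1 unfolding Z_def ap[OF b] .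
  ultimately show ?thesis unfolding w_def[symmetric] by (simp add: add_eq_0_iff)
qed

end

lemma bilinear_double_sum:
  fixes a :: "nat \<Rightarrow> 'e::real_vector \<Rightarrow> real"
  assumes "\<And>i. i < N \<Longrightarrow> linear (a i)"
  shows "bilinear (\<lambda>x y. \<Sum>i<N. \<Sum>j<N. a i x * a j y * m i j)"
proof -
  have "a i (x + y) = a i x + a i y" "a i (r *\<^sub>R x) = r * a i x" if "i < N" for i x y r
    using linear_add[OF assms[OF that]] linear_cmul[OF assms[OF that]] by auto
  then show ?thesis
    unfolding bilinear_def
    by (auto intro!: linearI simp: sum.distrib[symmetric] sum_distrib_left algebra_simps intro!: sum.cong)
qed

context chart
begin

lemma Re_ct:
  assumes g: "smooth_fun A G g" and G: "open G" "G \<subseteq> U0" "q \<in> G"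
    and eq: "\<And>p. p \<in> G \<Longrightarrow> Re (g p) = r * a (\<phi> p)" and a: "a differentiable at (\<phi> q)"
  shows "Re (ct q w g) = r * fd a (\<phi> q) w"
proof -
  have qU: "q \<in> U0" using G by auto
  have oG: "open (\<phi> ` G)" "\<phi> q \<in> \<phi> ` G" using open_img G by auto
  have d: "(g \<circ> \<Phi>) differentiable at (\<phi> q)" by (rule smooth_differentiable[OF g G(1,3) qU])
  have "Re (ct q w g) = fd (\<lambda>y. Re ((g \<circ> \<Phi>) y)) (\<phi> q) w"
    unfolding ct_apply[OF g G(1,3)] by (rule fd_bounded_linear[OF bounded_linear_Re d, symmetric])
  also have "\<dots> = fd (\<lambda>y. r * a y) (\<phi> q) w"
  proof (rule fun_cong[OF fd_cong[OF oG]])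
    show "(\<lambda>y. Re ((g \<circ> \<Phi>) y)) differentiable at (\<phi> q)"
      using bounded_linear.has_derivative[OF bounded_linear_Re has_derivative_fd[OF d]] differentiable_def by blast
  qed (use eq G in auto)
  also have "\<dots> = r * fd a (\<phi> q) w"
    by (rule fd_bounded_linear[OF bounded_linear_mult_right a])
  finally show ?thesis .
qed

lemma ct_of_real:
  assumes f: "smooth_fun A V (f :: 'a \<Rightarrow> real)" and V: "open V" "q \<in> V" "q \<in> U0"
  shows "ct q w (\<lambda>q. complex_of_real (f q)) = complex_of_real (fd (f \<circ> \<Phi>) (\<phi> q) w)"
proof -
  have "ct q w (\<lambda>q. complex_of_real (f q)) = fd (\<lambda>z. complex_of_real ((f \<circ> \<Phi>) z)) (\<phi> q) w"
    using ct_apply[OF smooth_fun_bounded_linear[OF atlas V(1) bounded_linear_of_real f] V(1,2)] by (simp add: o_def)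
  also have "\<dots> = complex_of_real (fd (f \<circ> \<Phi>) (\<phi> q) w)"
    by (rule fd_bounded_linear[OF bounded_linear_of_real smooth_differentiable[OF f V]])
  finally show ?thesis .
qed

end

text \<open>No derivative falls on the constant coefficients, so the second derivative along the
  field is a quadratic form in c.\<close>

lemma fd_fd_field_sum:
  fixes f :: "'e::euclidean_space \<Rightarrow> real"
  assumes f: "Cinf_on S f" and u: "\<And>i. i < N \<Longrightarrow> Cinf_on S (u i)" and S: "open S" "z \<in> S"
  shows "fd (\<lambda>y. fd f y (\<Sum>i<N. c i *\<^sub>R u i y)) z (\<Sum>i<N. c i *\<^sub>R u i z) =
    (\<Sum>i<N. \<Sum>j<N. c i * c j * fd (\<lambda>y. fd f y (u j y)) z (u i z))"
proof -
  have d: "(\<lambda>y. fd f y (u j y)) differentiable at z" if "j < N" for j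
    using Cinf_on_differentiable[OF Cinf_on_fd_field[OF f u[OF that] S(1)] S(2)] .
  have C: "Cinf_on S (\<lambda>y. \<Sum>i<N. c i *\<^sub>R u i y)"
    by (intro Cinf_on_sum Cinf_on_scaleR Cinf_on_const u S) auto
  have "fd (\<lambda>y. fd f y (\<Sum>i<N. c i *\<^sub>R u i y)) z = fd (\<lambda>y. \<Sum>j<N. c j *\<^sub>R fd f y (u j y)) z"
  proof (rule fd_cong[OF S])
    show "fd f y (\<Sum>i<N. c i *\<^sub>R u i y) = (\<Sum>j<N. c j *\<^sub>R fd f y (u j y))" if "y \<in> S" for y
      using Cinf_on_linear_fd[OF f that] by (simp add: linear_sum linear_cmul)
    show "(\<lambda>y. fd f y (\<Sum>i<N. c i *\<^sub>R u i y)) differentiable at z"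
      by (rule Cinf_on_differentiable[OF Cinf_on_fd_field[OF f C S(1)] S(2)])
  qed
  then have "fd (\<lambda>y. fd f y (\<Sum>i<N. c i *\<^sub>R u i y)) z v = (\<Sum>j<N. c j *\<^sub>R fd (\<lambda>y. fd f y (u j y)) z v)" for v
    using fd_sum_scaleR[of "{..<N}" "\<lambda>j y. fd f y (u j y)" z c v] d by simp
  moreover have "fd (\<lambda>y. fd f y (u j y)) z (\<Sum>i<N. c i *\<^sub>R u i z) =
      (\<Sum>i<N. c i * fd (\<lambda>y. fd f y (u j y)) z (u i z))" if "j < N" for j
    using linear_frechet_derivative[OF d[OF that]] by (simp add: linear_sum linear_cmul)
  ultimately have "fd (\<lambda>y. fd f y (\<Sum>i<N. c i *\<^sub>R u i y)) z (\<Sum>i<N. c i *\<^sub>R u i z) =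
      (\<Sum>j<N. \<Sum>i<N. c i * c j * fd (\<lambda>y. fd f y (u j y)) z (u i z))"
    by (simp add: sum_distrib_left mult_ac)
  then show ?thesis by (rule trans) (rule sum.swap)
qed

context cr_frame
begin

text \<open>Components of the bracket of E_i with J E_j.\<close>

definition br where "br i j z = fd (je j) z (e i z) - fd (e i) z (je j z)"

text \<open>Matrix in the frame of the complex Hessian of a jet with function f, where \<theta> is
  the form under the exterior derivative. It need not be symmetric; only its quadratic form
  matters.\<close>

definition hmat :: "'a form \<Rightarrow> ('a \<Rightarrow> real) \<Rightarrow> nat \<Rightarrow> nat \<Rightarrow> 'e \<Rightarrow> real" where
  "hmat \<theta> f i j z = (fd (\<lambda>y. fd (f \<circ> \<Phi>) y (e j y)) z (e i z) + fd (\<lambda>y. fd (f \<circ> \<Phi>) y (je j y)) z (je i z)) / 2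
     - Re (\<theta> (\<Phi> z) (ct (\<Phi> z) (br i j z)))"

section \<open>Levi form and Hessian as quadratic forms in the frame coefficients\<close>

lemma bracket_vec:
  assumes z: "z \<in> \<phi> ` W0"
  shows "fd (jvec c) z (vec c z) - fd (vec c) z (jvec c z) = (\<Sum>i<2*n. \<Sum>j<2*n. (c i * c j) *\<^sub>R br i j z)"
proof -
  note de = Cinf_on_differentiable[OF e_smooth z] and dj = Cinf_on_differentiable[OF je_smooth z]
  have "fd (jvec c) z (vec c z) = (\<Sum>j<2*n. c j *\<^sub>R fd (je j) z (vec c z))"
    unfolding jvec_def[abs_def] by (rule fd_sum_scaleR) (use dj in auto)
  also have "\<dots> = (\<Sum>j<2*n. \<Sum>i<2*n. (c i * c j) *\<^sub>R fd (je j) z (e i z))"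
    unfolding vec_def
    by (intro sum.cong refl) (simp add: linear_sum[OF linear_frechet_derivative[OF dj]]
        linear_cmul[OF linear_frechet_derivative[OF dj]] scaleR_sum_right mult.commute)
  finally have 1: "fd (jvec c) z (vec c z) = (\<Sum>i<2*n. \<Sum>j<2*n. (c i * c j) *\<^sub>R fd (je j) z (e i z))"
    by (rule trans) (rule sum.swap)
  have "fd (vec c) z (jvec c z) = (\<Sum>i<2*n. c i *\<^sub>R fd (e i) z (jvec c z))"
    unfolding vec_def[abs_def] by (rule fd_sum_scaleR) (use de in auto)
  also have "\<dots> = (\<Sum>i<2*n. \<Sum>j<2*n. (c i * c j) *\<^sub>R fd (e i) z (je j z))"
    unfolding jvec_def
    by (intro sum.cong refl) (simp add: linear_sum[OF linear_frechet_derivative[OF de]]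
        linear_cmul[OF linear_frechet_derivative[OF de]] scaleR_sum_right)
  finally show ?thesis using 1 by (simp add: br_def scaleR_diff_right sum_subtractf)
qed

lemma cpx_jvec: "q \<in> W0 \<Longrightarrow> cpx M q (ct q (jvec c (\<phi> q))) = ct q (- vec c (\<phi> q))"
  using cpx_cpx[OF vec_hor[of q c]] cpx_vec[of q c] ct_scale[of q "- 1" "vec c (\<phi> q)"] W0 by auto

text \<open>The sign arises because the Levi form uses [JX, X] while \<open>br\<close> comes from
  [X, JX]. The second claim holds since [JJX, JX] = [-X, JX] = [JX, X].\<close>

lemma levi_vec:
  assumes q: "q \<in> W0" and \<xi>: "\<xi> \<in> H0 M q"
  shows "levi_form M q \<xi> (ct q (vec c (\<phi> q))) = - Re (\<xi> (ct q (fd (jvec c) (\<phi> q) (vec c (\<phi> q)) - fd (vec c) (\<phi> q) (jvec c (\<phi> q)))))"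
    and "levi_form M q \<xi> (ct q (jvec c (\<phi> q))) = levi_form M q \<xi> (ct q (vec c (\<phi> q)))"
proof -
  have qU: "q \<in> U0" using q W0 by auto
  let ?z = "\<phi> q"
  have z: "?z \<in> \<phi> ` W0" using q by blast
  note l = ccovector_linear[OF H0_ccovector[OF \<xi>] qU]
  have 1: "levi_form M q \<xi> (ct q (vec c ?z)) = Re (\<xi> (ct q (fd (vec c) ?z (jvec c ?z) - fd (jvec c) ?z (vec c ?z))))"
    unfolding levi_section[OF q \<xi> W0(1) q vec_section]
    by (subst lie_bracket_ct[OF jvec_smooth cpx_vec vec_smooth refl W0 q]) auto
  also have "\<dots> = - Re (\<xi> (ct q (fd (jvec c) ?z (vec c ?z) - fd (vec c) ?z (jvec c ?z))))"
    using linear_neg[OF l, of "fd (jvec c) ?z (vec c ?z) - fd (vec c) ?z (jvec c ?z)"] by simp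
  finally show "levi_form M q \<xi> (ct q (vec c ?z)) = - Re (\<xi> (ct q (fd (jvec c) ?z (vec c ?z) - fd (vec c) ?z (jvec c ?z))))" .
  have nv: "Cinf_on (\<phi> ` W0) (\<lambda>z. - vec c z)"
    by (rule Cinf_on_bounded_linear[OF bounded_linear_minus[OF bounded_linear_ident] vec_smooth open_imgW])
  have "levi_form M q \<xi> (ct q (jvec c ?z)) = Re (\<xi> (ct q (fd (jvec c) ?z (- vec c ?z) - fd (\<lambda>z. - vec c z) ?z (jvec c ?z))))"
    unfolding levi_section[OF q \<xi> W0(1) q jvec_section]
    by (subst lie_bracket_ct[OF nv cpx_jvec jvec_smooth refl W0 q]) auto
  also have "fd (jvec c) ?z (- vec c ?z) = - fd (jvec c) ?z (vec c ?z)"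
    by (rule linear_neg[OF Cinf_on_linear_fd[OF jvec_smooth z]])
  also have "fd (\<lambda>z. - vec c z) ?z (jvec c ?z) = - fd (vec c) ?z (jvec c ?z)"
    by (rule fd_bounded_linear[OF bounded_linear_minus[OF bounded_linear_ident] Cinf_on_differentiable[OF vec_smooth z]])
  finally show "levi_form M q \<xi> (ct q (jvec c ?z)) = levi_form M q \<xi> (ct q (vec c ?z))" using 1 by simp
qed

lemma ccovector_bracket:
  assumes q: "q \<in> W0" and \<xi>: "\<xi> \<in> ccovectors A q"
  shows "Re (\<xi> (ct q (fd (jvec c) (\<phi> q) (vec c (\<phi> q)) - fd (vec c) (\<phi> q) (jvec c (\<phi> q))))) =
    (\<Sum>i<2*n. \<Sum>j<2*n. c i * c j * Re (\<xi> (ct q (br i j (\<phi> q)))))"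
proof -
  have qU: "q \<in> U0" using q W0 by auto
  note l = ccovector_linear[OF \<xi> qU]
  show ?thesis
    using linear_sum[OF l, of "\<lambda>i. \<Sum>j<2*n. (c i * c j) *\<^sub>R br i j (\<phi> q)" "{..<2*n}"]
      linear_sum[OF l, of "\<lambda>j. (c i * c j) *\<^sub>R br i j (\<phi> q)" "{..<2*n}" for i] linear_cmul[OF l] q
    by (simp add: bracket_vec)
qed

end

text \<open>The form whose exterior derivative at (X, JX) gives the complex Hessian of the jet
  represented by f and \<eta>.\<close>

definition jet_form :: "('a::t2_space, 'e::euclidean_space) chart set \<Rightarrow> 'a set \<Rightarrow> 'a gauge \<Rightarrow> ('a \<Rightarrow> real) \<Rightarrow> 'a form \<Rightarrow> 'a form" where
  "jet_form A V lam f \<eta> = (\<lambda>q v. \<eta> q v - \<i> * fst lam (fun_diff A V f) q v)"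

text \<open>A jet through its representative in one gauge. It is used for the given jet and, with
  \<eta> = 0, for the localizing weight.\<close>

locale cr_jet = cr_frame M U0 \<phi> n k W0 E
  for M :: "('a::t2_space, 'e::euclidean_space) cr_struct" and U0 \<phi> n k W0 E +
  fixes V lam f \<eta>
  assumes V: "open V" and f: "smooth_fun A V (f :: 'a \<Rightarrow> real)" and lam: "CR_gauge M V lam"
    and \<eta>: "one_form A V \<eta>" and \<eta>_H0: "q \<in> V \<Longrightarrow> \<eta> q \<in> H0 M q"
begin

abbreviation \<theta> :: "'a form" where "\<theta> \<equiv> jet_form A V lam f \<eta>"

lemma df: "one_form A V (fun_diff A V f)"
  by (rule one_form_fun_diff[OF atlas f V])

lemma one_form_\<theta>: "one_form A V \<theta>"
proof -
  have "one_form A V (fst lam (fun_diff A V f))"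
    using lam df by (auto simp: CR_gauge_def form_linear_def)
  from one_form_add_cmult[OF atlas \<eta> this, of "- \<i>"] show ?thesis by (simp add: jet_form_def)
qed

lemma df_ct: "q \<in> V \<Longrightarrow> q \<in> U0 \<Longrightarrow> fun_diff A V f q (ct q w) = complex_of_real (fd (f \<circ> \<Phi>) (\<phi> q) w)"
  using ct_of_real[OF f V] ct_ctangent by (simp add: fun_diff_def)

text \<open>On HM the form \<eta> vanishes and the gauge is determined by \<open>gauge_hor\<close>,
  so the real part of the jet form at v is - df(Jv) / 2, independent of \<eta> and of the
  gauge.\<close>

lemma Re_\<theta>:
  assumes q: "q \<in> V" "q \<in> W0"
  shows "Re (\<theta> q (ct q (vec c (\<phi> q)))) = - (1 / 2) * fd (f \<circ> \<Phi>) (\<phi> q) (jvec c (\<phi> q))"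
    and "Re (\<theta> q (ct q (jvec c (\<phi> q)))) = (1 / 2) * fd (f \<circ> \<Phi>) (\<phi> q) (vec c (\<phi> q))"
proof -
  have qU: "q \<in> U0" using q W0 by auto
  have l: "linear (fd (f \<circ> \<Phi>) (\<phi> q))"
    by (rule linear_frechet_derivative[OF smooth_differentiable[OF f V q(1) qU]])
  note gh = gauge_hor[OF lam df q] and h0 = H0_hor[OF \<eta>_H0[OF q(1)]]
  have "Im (fst lam (fun_diff A V f) q (ct q (vec c (\<phi> q)))) = - (1 / 2) * fd (f \<circ> \<Phi>) (\<phi> q) (jvec c (\<phi> q))"
    using arg_cong[OF gh[OF vec_hor[OF q(2), of c]], of Im]
    by (simp add: cpx_vec[OF q(2)] df_ct[OF q(1) qU])
  then show "Re (\<theta> q (ct q (vec c (\<phi> q)))) = - (1 / 2) * fd (f \<circ> \<Phi>) (\<phi> q) (jvec c (\<phi> q))"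
    using h0[OF vec_hor[OF q(2), of c]] by (simp add: jet_form_def)
  have "Im (fst lam (fun_diff A V f) q (ct q (jvec c (\<phi> q)))) = (1 / 2) * fd (f \<circ> \<Phi>) (\<phi> q) (vec c (\<phi> q))"
    using arg_cong[OF gh[OF jvec_hor[OF q(2), of c]], of Im]
    by (simp add: cpx_jvec[OF q(2)] df_ct[OF q(1) qU] linear_neg[OF l])
  then show "Re (\<theta> q (ct q (jvec c (\<phi> q)))) = (1 / 2) * fd (f \<circ> \<Phi>) (\<phi> q) (vec c (\<phi> q))"
    using h0[OF jvec_hor[OF q(2), of c]] by (simp add: jet_form_def)
qed

lemma hmat_vec:
  assumes q: "q \<in> V" "q \<in> W0"
  shows "(\<Sum>i<2*n. \<Sum>j<2*n. c i * c j * hmat \<theta> f i j (\<phi> q)) =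
     (1 / 2) * fd (\<lambda>y. fd (f \<circ> \<Phi>) y (vec c y)) (\<phi> q) (vec c (\<phi> q))
     + (1 / 2) * fd (\<lambda>y. fd (f \<circ> \<Phi>) y (jvec c y)) (\<phi> q) (jvec c (\<phi> q))
     - Re (\<theta> q (ct q (fd (jvec c) (\<phi> q) (vec c (\<phi> q)) - fd (vec c) (\<phi> q) (jvec c (\<phi> q)))))"
proof -
  let ?z = "\<phi> q"
  define G where "G = V \<inter> W0"
  have G: "open G" "G \<subseteq> U0" "q \<in> G" "G \<subseteq> W0" "G \<subseteq> V" using V W0 q by (auto simp: G_def)
  have qU: "q \<in> U0" using G by auto
  have oG: "open (\<phi> ` G)" "?z \<in> \<phi> ` G" using open_img G by auto
  have fC: "Cinf_on (\<phi> ` G) (f \<circ> \<Phi>)"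
    using smooth_iff[OF G(1,2)] smooth_fun_subset[OF f G(5)] by blast
  have eC: "Cinf_on (\<phi> ` G) (e i)" "Cinf_on (\<phi> ` G) (je i)" if "i < 2 * n" for i
    using e_smooth[OF that] je_smooth[OF that] G(4) by (auto intro: Cinf_on_subset)
  have \<theta>c: "\<theta> q \<in> ccovectors A q" using one_form_\<theta> q by (auto simp: one_form_def)
  show ?thesis
    unfolding ccovector_bracket[OF q(2) \<theta>c]
    using fd_fd_field_sum[OF fC eC(1) oG, where N="2 * n" and c=c] fd_fd_field_sum[OF fC eC(2) oG, where N="2 * n" and c=c] qU
    by (simp add: vec_def[abs_def] jvec_def[abs_def] hmat_def right_diff_distrib distrib_left
        sum_subtractf sum.distrib add_divide_distrib sum_divide_distrib[symmetric])
qed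

text \<open>The invariant formula for d with the fields X = \<open>vec c\<close> and JX =
  \<open>jvec c\<close>: by \<open>Re_\<theta>\<close> the first two terms are X X f / 2 and JX JX f
  / 2. This is how second derivatives of f along both fields enter the Hessian.\<close>

lemma hessian_vec:
  assumes q: "q \<in> V" "q \<in> W0"
  shows "Re (form_diff A \<theta> q (ct q (vec c (\<phi> q))) (ct q (jvec c (\<phi> q)))) =
    (\<Sum>i<2*n. \<Sum>j<2*n. c i * c j * hmat \<theta> f i j (\<phi> q))"
proof -
  let ?z = "\<phi> q"
  define G where "G = V \<inter> W0"
  have G: "open G" "G \<subseteq> U0" "q \<in> G" "G \<subseteq> W0" "G \<subseteq> V" using V W0 q by (auto simp: G_def)
  have qU: "q \<in> U0" using G by auto
  have oG: "open (\<phi> ` G)" "?z \<in> \<phi> ` G" using open_img G by auto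
  have fC: "Cinf_on (\<phi> ` G) (f \<circ> \<Phi>)"
    using smooth_iff[OF G(1,2)] smooth_fun_subset[OF f G(5)] by blast
  have vC: "Cinf_on (\<phi> ` G) (vec c)" "Cinf_on (\<phi> ` G) (jvec c)"
    using Cinf_on_subset[OF vec_smooth image_mono[OF G(4)]] Cinf_on_subset[OF jvec_smooth image_mono[OF G(4)]] by auto
  have sm: "smooth_fun A G (\<lambda>p. \<theta> p (ct p (x (\<phi> p))))" if x: "Cinf_on (\<phi> ` G) x" for x
  proof -
    have "smooth_section A G (ctangent_space A) (\<lambda>p. ct p (x (\<phi> p)))"
      using section_of_rep[OF x refl G(1,2)] unfolding smooth_section_def by auto
    then show ?thesis using one_form_\<theta> G(1,5) unfolding one_form_def by auto
  qed
  have d: "(\<lambda>y. fd (f \<circ> \<Phi>) y (x y)) differentiable at ?z" if "Cinf_on (\<phi> ` G) x" for x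
    by (rule Cinf_on_differentiable[OF Cinf_on_fd_field[OF fC that oG(1)] oG(2)])
  have 1: "Re (ct q w (\<lambda>p. \<theta> p (ct p (jvec c (\<phi> p))))) = (1 / 2) * fd (\<lambda>y. fd (f \<circ> \<Phi>) y (vec c y)) ?z w" for w
    by (rule Re_ct[OF sm[OF vC(2)] G(1-3) _ d[OF vC(1)]]) (rule Re_\<theta>(2), auto simp: G_def)
  have 2: "Re (ct q w (\<lambda>p. \<theta> p (ct p (vec c (\<phi> p))))) = - (1 / 2) * fd (\<lambda>y. fd (f \<circ> \<Phi>) y (jvec c y)) ?z w" for w
    by (rule Re_ct[OF sm[OF vC(1)] G(1-3) _ d[OF vC(2)]]) (rule Re_\<theta>(1), auto simp: G_def)
  have vs: "smooth_section A G (tangent_space A) (\<lambda>p. ct p (vec c (\<phi> p)))"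
      "smooth_section A G (tangent_space A) (\<lambda>p. ct p (jvec c (\<phi> p)))"
    using section_of_rep[OF vC(1) refl G(1,2)] section_of_rep[OF vC(2) refl G(1,2)] by auto
  have b: "lie_bracket A (\<lambda>p. ct p (vec c (\<phi> p))) (\<lambda>p. ct p (jvec c (\<phi> p))) q =
      ct q (fd (jvec c) ?z (vec c ?z) - fd (vec c) ?z (jvec c ?z))"
    by (rule lie_bracket_ct[OF vC(1) refl vC(2) refl G(1-3)])
  have "Re (form_diff A \<theta> q (ct q (vec c ?z)) (ct q (jvec c ?z))) =
     (1 / 2) * fd (\<lambda>y. fd (f \<circ> \<Phi>) y (vec c y)) ?z (vec c ?z)
     + (1 / 2) * fd (\<lambda>y. fd (f \<circ> \<Phi>) y (jvec c y)) ?z (jvec c ?z)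
     - Re (\<theta> q (ct q (fd (jvec c) ?z (vec c ?z) - fd (vec c) ?z (jvec c ?z))))"
    using form_diff_sections[OF one_form_\<theta> V q(1) qU G(1,3) vs] unfolding b by (simp add: 1 2)
  then show ?thesis unfolding hmat_vec[OF q] .
qed

text \<open>d is alternating and J(JX) = -X, hence d\<theta>(JX, -X) = d\<theta>(X, JX): the complex
  Hessian is J-invariant.\<close>

lemma hessian_jvec:
  assumes q: "q \<in> V" "q \<in> W0"
  shows "form_diff A \<theta> q (ct q (jvec c (\<phi> q))) (cpx M q (ct q (jvec c (\<phi> q)))) =
    form_diff A \<theta> q (ct q (vec c (\<phi> q))) (ct q (jvec c (\<phi> q)))"
proof -
  let ?z = "\<phi> q"
  have qU: "q \<in> U0" using q W0 by auto
  have l: "linear (fd (fc \<theta> b) ?z)" for b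
  proof (rule Cinf_on_linear_fd)
    show "Cinf_on (\<phi> ` (V \<inter> U0)) (fc \<theta> b)"
      by (rule fc_smooth[OF one_form_\<theta>]) (use V open_U0 in auto)
  qed (use q qU in auto)
  show ?thesis
    unfolding cpx_jvec[OF q(2)] form_diff_ct[OF one_form_\<theta> V q(1) qU] dform_def
    by (simp add: linear_neg[OF l] algebra_simps)
qed

end

context cr_frame
begin

definition gmat :: "('a \<Rightarrow> 'a tvec \<Rightarrow> 'a tvec \<Rightarrow> complex) \<Rightarrow> nat \<Rightarrow> nat \<Rightarrow> 'e \<Rightarrow> real" where
  "gmat h i j z = Re (h (\<Phi> z) (E i (\<Phi> z)) (E j (\<Phi> z)))"

text \<open>The coefficient functionals are extended from the fibre to the whole coordinate space,
  so that matrices in the frame become bilinear forms on it, as \<open>complex_form\<close>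
  requires.\<close>

lemma frame_dual:
  assumes q: "q \<in> W0"
  obtains cf where "\<And>i. linear (cf i :: 'e \<Rightarrow> real)" "\<And>i c. i < 2 * n \<Longrightarrow> cf i (vec c (\<phi> q)) = c i"
    and "dim (range (\<lambda>c. vec c (\<phi> q))) = 2 * n"
proof -
  let ?z = "\<phi> q"
  have ind: "\<forall>i\<in>{..<2*n}. c i = 0" if "(\<Sum>i<2*n. c i *\<^sub>R e i ?z) = 0" for c
    using vec_indep[OF q] that by (auto simp: vec_def)
  note fam = independent_family[of "{..<2*n}" "\<lambda>i. e i ?z", OF finite_lessThan ind]
  have "\<exists>g. linear g \<and> (\<forall>x\<in>(\<lambda>i. e i ?z) ` {..<2*n}. g x = (if x = e i ?z then 1 else 0 :: real))" for i
    by (rule linear_independent_extend[OF fam(2)])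
  then have "\<exists>cf. \<forall>i. linear (cf i) \<and> (\<forall>x\<in>(\<lambda>i. e i ?z) ` {..<2*n}. cf i x = (if x = e i ?z then 1 else 0 :: real))"
    by (intro choice allI)
  then obtain cf where cf: "\<And>i. linear (cf i)"
    "\<And>i k. k < 2 * n \<Longrightarrow> cf i (e k ?z) = (if e k ?z = e i ?z then 1 else 0 :: real)"
    by auto
  have cf': "cf i (e k ?z) = (if k = i then 1 else 0)" if "i < 2 * n" "k < 2 * n" for i k
    using cf(2)[OF that(2), of i] fam(1) that by (auto simp: inj_on_def)
  have "cf i (vec c ?z) = c i" if "i < 2 * n" for i c
  proof -
    have "cf i (vec c ?z) = (\<Sum>k<2*n. c k * cf i (e k ?z))"
      by (simp add: vec_def linear_sum[OF cf(1)] linear_cmul[OF cf(1)])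
    also have "\<dots> = (\<Sum>k<2*n. if k = i then c k else 0)"
      by (intro sum.cong) (auto simp: cf' that)
    finally show ?thesis using that by simp
  qed
  moreover have "range (\<lambda>c. vec c ?z) = span ((\<lambda>i. e i ?z) ` {..<2*n})"
  proof
    show "range (\<lambda>c. vec c ?z) \<subseteq> span ((\<lambda>i. e i ?z) ` {..<2*n})"
      unfolding vec_def by (intro image_subsetI span_sum span_scale span_base) auto
    show "span ((\<lambda>i. e i ?z) ` {..<2*n}) \<subseteq> range (\<lambda>c. vec c ?z)"
      by (rule span_minimal[OF _ subspace_vec]) (use vec_unit in \<open>auto simp: image_iff; metis\<close>)
  qed
  then have "dim (range (\<lambda>c. vec c ?z)) = 2 * n"
    using dim_span_eq_card_independent[OF fam(2)] card_image[OF fam(1)] by simp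
  ultimately show ?thesis using that cf(1) by blast
qed

text \<open>Linearity of h is given in the first argument. Hermitian symmetry carries it to the
  second up to conjugation, which real coefficients do not feel.\<close>

lemma hermitian_vec:
  assumes q: "q \<in> W0" and h: "hermitian_metric M h"
  shows "Re (h q (ct q (vec c (\<phi> q))) (ct q (vec d (\<phi> q)))) = (\<Sum>i<2*n. \<Sum>j<2*n. c i * d j * gmat h i j (\<phi> q))"
proof -
  let ?z = "\<phi> q"
  have qU: "q \<in> U0" using q W0 by auto
  note H1 = h[unfolded hermitian_metric_def, THEN conjunct1, rule_format]
  have H2: "h q w v = cnj (h q v w)" if "v \<in> hor M q" "w \<in> hor M q" for v w
    using h[unfolded hermitian_metric_def, THEN conjunct2, THEN conjunct1, rule_format, OF that] by blast
  have lin: "h q (ct q (vec c ?z)) v = (\<Sum>i<2*n. complex_of_real (c i) * h q (E i q) v)"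
    if v: "v \<in> hor M q" for c v
  proof -
    have "h q (ct q (\<Sum>i<m. c i *\<^sub>R e i ?z)) v = (\<Sum>i<m. complex_of_real (c i) * h q (E i q) v)" if "m \<le> 2 * n" for m
      using that
    proof (induction m)
      case 0
      have z: "ct q 0 \<in> hor M q" using ct_sum_in_hor[OF q, of 0] by simp
      from H1[OF z z v, of 0 0] show ?case by (simp add: ct_zero[OF qU] tadd_def tscale_def)
    next
      case (Suc m)
      have m: "m < 2 * n" using Suc.prems by simp
      then have "ct q (e m ?z) \<in> hor M q" using E_hor[OF q m] E_eq[OF q m] by simp
      then show ?case
        unfolding ct_sum_Suc[OF qU]
        using H1[OF ct_sum_in_hor[OF q, of m c] _ v, of "ct q (e m ?z)" 1 "c m"] Suc E_eq[OF q m] by simp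
    qed
    from this[of "2 * n"] show ?thesis by (simp add: vec_def)
  qed
  have "h q (E i q) (ct q (vec d ?z)) = (\<Sum>j<2*n. complex_of_real (d j) * h q (E i q) (E j q))" if i: "i < 2 * n" for i
  proof -
    have "h q (E i q) (ct q (vec d ?z)) = cnj (h q (ct q (vec d ?z)) (E i q))"
      by (rule H2[OF vec_hor[OF q] E_hor[OF q i]])
    also have "\<dots> = (\<Sum>j<2*n. complex_of_real (d j) * h q (E i q) (E j q))"
      unfolding lin[OF E_hor[OF q i]] cnj_sum
      by (intro sum.cong refl) (simp add: H2[OF E_hor[OF q] E_hor[OF q i]])
    finally show ?thesis .
  qed
  then have "h q (ct q (vec c ?z)) (ct q (vec d ?z)) =
      (\<Sum>i<2*n. \<Sum>j<2*n. complex_of_real (c i * d j) * h q (E i q) (E j q))"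
    unfolding lin[OF vec_hor[OF q]] by (intro sum.cong refl) (simp add: sum_distrib_left mult_ac)
  then show ?thesis using qU by (simp add: gmat_def)
qed

text \<open>The spectral theorem applied to the fibre at q. Only the quadratic form Q is known in
  the frame; symmetry and J-invariance of a bilinear form that induces it are recovered
  here.\<close>

lemma second_eigenvalue_frame:
  assumes q: "q \<in> W0" and h: "hermitian_metric M h" and n: "2 \<le> n"
    and Q: "\<And>c. Q (ct q (vec c (\<phi> q))) = (\<Sum>i<2*n. \<Sum>j<2*n. c i * c j * B i j)"
    and QJ: "\<And>c. Q (ct q (jvec c (\<phi> q))) = Q (ct q (vec c (\<phi> q)))"
    and ev: "(THE l. eigenvalue_list (hor M q) (cpx M q) (h q) n Q l) ! 1 \<le> r"
    and F: "linear (F :: 'e \<Rightarrow> real)"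
  shows "\<exists>c. (\<exists>i<2*n. c i \<noteq> 0) \<and> F (vec c (\<phi> q)) = 0 \<and> F (jvec c (\<phi> q)) = 0 \<and>
    (\<Sum>i<2*n. \<Sum>j<2*n. c i * c j * B i j) \<le> r * (\<Sum>i<2*n. \<Sum>j<2*n. c i * c j * gmat h i j (\<phi> q))"
proof -
  let ?z = "\<phi> q"
  have qU: "q \<in> U0" using q W0 by auto
  obtain cf where cf: "\<And>i. linear (cf i :: 'e \<Rightarrow> real)" "\<And>i c. i < 2 * n \<Longrightarrow> cf i (vec c ?z) = c i"
    and dim: "dim (range (\<lambda>c. vec c ?z)) = 2 * n"
    using frame_dual[OF q] by blast
  define S where "S = range (\<lambda>c. vec c ?z)"
  define j where "j w = jvec (\<lambda>i. cf i w) ?z" for w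
  define g where "g x y = (\<Sum>i<2*n. \<Sum>k<2*n. cf i x * cf k y * gmat h i k ?z)" for x y
  \<comment> \<open>B need not be symmetric, so the bilinear form is built from its symmetric
    part.\<close>
  define s where "s x y = (\<Sum>i<2*n. \<Sum>k<2*n. cf i x * cf k y * ((B i k + B k i) / 2))" for x y
  have jv: "j (vec c ?z) = jvec c ?z" for c
    unfolding j_def jvec_def by (intro sum.cong) (auto simp: cf)
  have lin_j: "linear j"
    unfolding j_def jvec_def
    by (intro linear_compose_sum ballI linearI)
       (auto simp: linear_add[OF cf(1)] linear_cmul[OF cf(1)] scaleR_left_distrib)
  have jvS: "jvec c ?z \<in> S" for c
    using jvec_hor[OF q, of c] ct_inj[OF qU] unfolding hor_eq[OF q] S_def by blast
  have jS: "j x \<in> S" if "x \<in> S" for x using that jv jvS unfolding S_def by auto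
  have J: "cpx M q (ct q x) = ct q (j x)" if "x \<in> S" for x
    using that cpx_vec[OF q] jv unfolding S_def by auto
  have hS: "ct q x \<in> hor M q" if "x \<in> S" for x using that vec_hor[OF q] by (auto simp: S_def)
  have jj: "j (j x) = - x" if x: "x \<in> S" for x
  proof -
    have "ct q (j (j x)) = cpx M q (cpx M q (ct q x))" using J[OF jS[OF x]] J[OF x] by simp
    also have "\<dots> = ct q (- x)" using cpx_cpx[OF hS[OF x]] ct_scale[OF qU, of "- 1" x] by simp
    finally show ?thesis by (rule ct_inj[OF qU])
  qed
  have gh: "g x y = Re (h q (ct q x) (ct q y))" if "x \<in> S" "y \<in> S" for x y
    using that hermitian_vec[OF q h] unfolding S_def g_def by (auto simp: cf)
  note H = h[unfolded hermitian_metric_def, THEN conjunct2]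
  have H2: "h q (cpx M q v) w = \<i> * h q v w" "h q w v = cnj (h q v w)"
    if "v \<in> hor M q" "w \<in> hor M q" for v w
    using H[THEN conjunct1, rule_format, OF that] by auto
  have H3: "Re (h q v v) > 0" if "v \<in> hor M q" "v \<noteq> (\<lambda>f. 0)" for v
    using H[THEN conjunct2, THEN conjunct1, rule_format, OF that] .
  have H4: "h q v (cpx M q w) = - \<i> * h q v w" if "v \<in> hor M q" "w \<in> hor M q" for v w
  proof -
    have "h q v (cpx M q w) = cnj (h q (cpx M q w) v)" by (rule H2(2)[OF cpx_hor[OF that(2)] that(1)])
    also have "\<dots> = - \<i> * cnj (h q w v)" using H2(1)[OF that(2,1)] by simp
    finally show ?thesis using H2(2)[OF that(2,1)] by simp
  qed
  have gsym: "gmat h i k ?z = gmat h k i ?z" if "i < 2 * n" "k < 2 * n" for i k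
    using H2(2)[OF E_hor[OF q that(1)] E_hor[OF q that(2)]] qU by (simp add: gmat_def)
  have sym_g: "g x y = g y x" for x y
  proof -
    have "g x y = (\<Sum>k<2*n. \<Sum>i<2*n. cf i x * cf k y * gmat h i k ?z)" unfolding g_def by (rule sum.swap)
    also have "\<dots> = g y x" unfolding g_def by (intro sum.cong refl) (simp add: gsym)
    finally show ?thesis .
  qed
  have sym_s: "s x y = s y x" for x y
  proof -
    have "s x y = (\<Sum>k<2*n. \<Sum>i<2*n. cf i x * cf k y * ((B i k + B k i) / 2))" unfolding s_def by (rule sum.swap)
    also have "\<dots> = s y x" unfolding s_def by (intro sum.cong refl) (simp add: algebra_simps)
    finally show ?thesis .
  qed
  have bil_g: "bilinear g" and bil_s: "bilinear s"
    unfolding g_def[abs_def] s_def[abs_def] by (rule bilinear_double_sum[OF cf(1)])+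
  have ss: "s (vec c ?z) (vec c ?z) = (\<Sum>i<2*n. \<Sum>j<2*n. c i * c j * B i j)" for c
  proof -
    have "s (vec c ?z) (vec c ?z) = (\<Sum>i<2*n. \<Sum>k<2*n. c i * c k * B i k) / 2 + (\<Sum>i<2*n. \<Sum>k<2*n. c i * c k * B k i) / 2"
      unfolding s_def
      by (simp add: cf sum_divide_distrib sum.distrib[symmetric] add_divide_distrib distrib_left)
    also have "(\<Sum>i<2*n. \<Sum>k<2*n. c i * c k * B k i) = (\<Sum>k<2*n. \<Sum>i<2*n. c i * c k * B k i)" by (rule sum.swap)
    finally show ?thesis by (simp add: mult.commute[of "c _" "c _"])
  qed
  have Qs: "Q (ct q x) = s x x" if "x \<in> S" for x
    using that Q ss unfolding S_def by auto
  have sj: "s (j x) (j x) = s x x" if x: "x \<in> S" for x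
    using x QJ Qs[OF x] Qs[OF jS[OF x]] jv unfolding S_def by auto
  note sb = bilinear_ladd[OF bil_s] bilinear_radd[OF bil_s]
  have subS: "subspace S" unfolding S_def by (rule subspace_vec)
  interpret complex_form_tvec S j g s n "ct q" "hor M q" "cpx M q" "h q" Q
  proof (intro complex_form_tvec.intro complex_form.intro complex_form_tvec_axioms.intro)
    \<comment> \<open>By polarization from the invariance of the quadratic form at x, y and x +
      y.\<close>
    show "s (j x) (j y) = s x y" if "x \<in> S" "y \<in> S" for x y
      using sj[OF that(1)] sj[OF that(2)] sj[OF subspace_add[OF subS that]] sym_s[of y x] sym_s[of "j y" "j x"]
      by (simp add: linear_add[OF lin_j] sb)
    show "g (j x) (j y) = g x y" if "x \<in> S" "y \<in> S" for x y
      using that H2(1) H4 cpx_hor hS by (simp add: gh jS J[symmetric])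
    show "g x x > 0" if "x \<in> S" "x \<noteq> 0" for x
      using H3[OF hS[OF that(1)]] gh[OF that(1,1)] ct_inj[OF qU, of x 0] ct_zero[OF qU] that(2) by auto
    show "h q (ct q x) (ct q y) = Complex (g x y) (g x (j y))" if "x \<in> S" "y \<in> S" for x y
      using that H4[OF hS[OF that(1)] hS[OF that(2)]] by (simp add: gh jS J[symmetric] complex_eq_iff)
    show "hor M q = ct q ` S" unfolding hor_eq[OF q] S_def by auto
    show "dim S = 2 * n" using dim by (simp add: S_def)
  qed (rule subS lin_j bil_g bil_s jS jj sym_g sym_s ct_add[OF qU] ct_scale[OF qU] ct_inj[OF qU] J Qs; assumption?)+
  obtain x where x: "x \<in> S" "x \<noteq> 0" "F x = 0" "F (j x) = 0" "s x x \<le> r * g x x"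
    using second_eigenvalue[OF n ev F] by blast
  obtain c where c: "x = vec c ?z" using x(1) by (auto simp: S_def)
  have "\<exists>i<2*n. c i \<noteq> 0"
  proof (rule ccontr)
    assume "\<not> ?thesis"
    then have "vec c ?z = 0" by (simp add: vec_def)
    then show False using x(2) c by simp
  qed
  moreover have "g x x = (\<Sum>i<2*n. \<Sum>j<2*n. c i * c j * gmat h i j ?z)"
    unfolding g_def c by (simp add: cf)
  ultimately show ?thesis using x ss jv c by auto
qed

end

section \<open>The maximum principle\<close>

text \<open>The field X applied twice to f, in coordinates.\<close>

definition LL :: "('e::euclidean_space \<Rightarrow> 'e) \<Rightarrow> ('e \<Rightarrow> 'f::real_normed_vector) \<Rightarrow> 'e \<Rightarrow> 'f" where
  "LL X f z = fd (\<lambda>y. fd f y (X y)) z (X z)"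

section \<open>Second derivatives along a field, and the inequalities at a maximum\<close>

lemma fd_mult:
  fixes a b :: "'e::euclidean_space \<Rightarrow> real"
  assumes "a differentiable at y" "b differentiable at y"
  shows "fd (\<lambda>y. a y * b y) y w = a y * fd b y w + fd a y w * b y"
  by (simp add: fd_eqI[OF has_derivative_mult[OF has_derivative_fd[OF assms(1)] has_derivative_fd[OF assms(2)]]])

lemma fd_add:
  assumes "a differentiable at y" "b differentiable at y"
  shows "fd (\<lambda>y. a y + b y) y w = fd a y w + fd b y w"
  by (simp add: fd_eqI[OF has_derivative_add[OF has_derivative_fd[OF assms(1)] has_derivative_fd[OF assms(2)]]])

context
  fixes S :: "'e::euclidean_space set" and z :: 'e and X :: "'e \<Rightarrow> 'e"
  assumes S: "open S" "z \<in> S" and X: "Cinf_on S X"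
begin

lemma LL_add:
  assumes a: "Cinf_on S a" and b: "Cinf_on S b"
  shows "LL X (\<lambda>y. a y + b y) z = LL X a z + LL X b z"
proof -
  note Da = Cinf_on_fd_field[OF a X S(1)] and Db = Cinf_on_fd_field[OF b X S(1)]
  have "fd (\<lambda>y. fd (\<lambda>y. a y + b y) y (X y)) z = fd (\<lambda>y. fd a y (X y) + fd b y (X y)) z"
  proof (rule fd_cong[OF S])
    show "(\<lambda>y. fd (\<lambda>y. a y + b y) y (X y)) differentiable at z"
      by (rule Cinf_on_differentiable[OF Cinf_on_fd_field[OF Cinf_on_add[OF a b S(1)] X S(1)] S(2)])
  qed (rule fd_add, auto intro: Cinf_on_differentiable a b)
  then show ?thesis
    unfolding LL_def by (simp add: fd_add Cinf_on_differentiable[OF Da S(2)] Cinf_on_differentiable[OF Db S(2)])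
qed

lemma LL_mult:
  fixes a b :: "'e \<Rightarrow> real"
  assumes a: "Cinf_on S a" and b: "Cinf_on S b"
  shows "LL X (\<lambda>y. a y * b y) z = a z * LL X b z + 2 * fd a z (X z) * fd b z (X z) + LL X a z * b z"
proof -
  note Da = Cinf_on_fd_field[OF a X S(1)] and Db = Cinf_on_fd_field[OF b X S(1)]
  note d = Cinf_on_differentiable[OF a S(2)] Cinf_on_differentiable[OF b S(2)]
    Cinf_on_differentiable[OF Da S(2)] Cinf_on_differentiable[OF Db S(2)]
  have "fd (\<lambda>y. fd (\<lambda>y. a y * b y) y (X y)) z = fd (\<lambda>y. a y * fd b y (X y) + fd a y (X y) * b y) z"
  proof (rule fd_cong[OF S])
    show "(\<lambda>y. fd (\<lambda>y. a y * b y) y (X y)) differentiable at z"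
      by (rule Cinf_on_differentiable[OF Cinf_on_fd_field[OF Cinf_on_mult[OF a b S(1)] X S(1)] S(2)])
  qed (rule fd_mult, auto intro: Cinf_on_differentiable a b)
  moreover have "fd (\<lambda>y. a y * fd b y (X y) + fd a y (X y) * b y) z w =
      fd (\<lambda>y. a y * fd b y (X y)) z w + fd (\<lambda>y. fd a y (X y) * b y) z w" for w
    by (rule fd_add) (auto intro!: differentiable_mult d)
  ultimately show ?thesis
    unfolding LL_def by (simp add: fd_mult d)
qed

lemma LL_bounded_linear:
  assumes L: "bounded_linear L" and a: "Cinf_on S a"
  shows "LL X (\<lambda>y. L (a y)) z = L (LL X a z)"
proof -
  note Da = Cinf_on_fd_field[OF a X S(1)]
  have "fd (\<lambda>y. fd (\<lambda>y. L (a y)) y (X y)) z = fd (\<lambda>y. L (fd a y (X y))) z"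
  proof (rule fd_cong[OF S])
    show "(\<lambda>y. fd (\<lambda>y. L (a y)) y (X y)) differentiable at z"
      by (rule Cinf_on_differentiable[OF Cinf_on_fd_field[OF Cinf_on_bounded_linear[OF L a S(1)] X S(1)] S(2)])
  qed (rule fd_bounded_linear[OF L], auto intro: Cinf_on_differentiable a)
  then show ?thesis
    unfolding LL_def by (simp add: fd_bounded_linear[OF L] Cinf_on_differentiable[OF Da S(2)])
qed

end

text \<open>Writing [X, Y] v = X(Yv) - Y(Xv) and inserting Yv = \<i> Xv twice gives YYv = \<i> YXv =
  - XXv - \<i> [X, Y] v.\<close>

lemma CR_sum_of_squares:
  fixes v :: "'e::euclidean_space \<Rightarrow> complex"
  assumes S: "open S" "z \<in> S" and X: "Cinf_on S X" and Y: "Cinf_on S Y" and v: "Cinf_on S v"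
    and CR: "\<And>y. y \<in> S \<Longrightarrow> fd v y (Y y) = \<i> * fd v y (X y)"
  shows "LL X v z + LL Y v z = - \<i> * fd v z (fd Y z (X z) - fd X z (Y z))"
proof -
  have c: "fd (\<lambda>y. fd v y (Y y)) z w = \<i> * fd (\<lambda>y. fd v y (X y)) z w" for w
  proof -
    have "fd (\<lambda>y. fd v y (Y y)) z = fd (\<lambda>y. \<i> * fd v y (X y)) z"
      by (rule fd_cong[OF S CR Cinf_on_differentiable[OF Cinf_on_fd_field[OF v Y S(1)] S(2)]])
    then show ?thesis
      by (simp add: fd_bounded_linear[OF bounded_linear_mult_right Cinf_on_differentiable[OF Cinf_on_fd_field[OF v X S(1)] S(2)]])
  qed
  have l: "linear (fd v z)" by (rule Cinf_on_linear_fd[OF v S(2)])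
  have "fd (\<lambda>y. fd v y (Y y)) z (X z) - fd (\<lambda>y. fd v y (X y)) z (Y z) = fd v z (fd Y z (X z) - fd X z (Y z))"
    unfolding fd_fd_field[OF v Y S] fd_fd_field[OF v X S] fd_fd_symmetric[OF v S, of "Y z" "X z"]
    by (simp add: linear_diff[OF l])
  then have 1: "fd (\<lambda>y. fd v y (X y)) z (Y z) = \<i> * LL X v z - fd v z (fd Y z (X z) - fd X z (Y z))"
    unfolding c LL_def by (simp add: algebra_simps)
  have "LL Y v z = \<i> * fd (\<lambda>y. fd v y (X y)) z (Y z)" unfolding LL_def c ..
  then show ?thesis unfolding 1 by (simp add: right_diff_distrib mult.assoc[symmetric])
qed

text \<open>The vanishing gradient of |v|^2 (\<delta> - \<psi>) gives the first claim, with
  multiplier c. For the second, the product is differentiated twice along X and along Y; both are in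
  the kernel of d \<psi> at z, so no mixed term survives, and \<open>CR_sum_of_squares\<close>
  replaces the second derivatives of v by a first derivative along the bracket.\<close>

lemma weighted_modulus_local_max:
  fixes v :: "'e::euclidean_space \<Rightarrow> complex" and \<psi> :: "'e \<Rightarrow> real"
  assumes S: "open S" "z \<in> S" and v: "Cinf_on S v" and \<psi>: "Cinf_on S \<psi>"
    and max: "\<And>y. y \<in> S \<Longrightarrow> (cmod (v y))\<^sup>2 * (\<delta> - \<psi> y) \<le> (cmod (v z))\<^sup>2 * (\<delta> - \<psi> z)"
    and pos: "\<psi> z < \<delta>"
  defines "c \<equiv> (cmod (v z))\<^sup>2 / (\<delta> - \<psi> z)"
  shows "2 * Re (cnj (v z) * fd v z w) = c * fd \<psi> z w"
    and "Cinf_on S X \<Longrightarrow> Cinf_on S Y \<Longrightarrow> (\<And>y. y \<in> S \<Longrightarrow> fd v y (Y y) = \<i> * fd v y (X y)) \<Longrightarrow>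
      fd \<psi> z (X z) = 0 \<Longrightarrow> fd \<psi> z (Y z) = 0 \<Longrightarrow>
      2 * Im (cnj (v z) * fd v z (fd Y z (X z) - fd X z (Y z))) \<le> c * (LL X \<psi> z + LL Y \<psi> z)"
proof -
  define p where "p y = Re (v y)" for y
  define r where "r y = Im (v y)" for y
  define N where "N y = p y * p y + r y * r y" for y
  define k where "k y = \<delta> - \<psi> y" for y
  define F where "F y = N y * k y" for y
  have N: "N y = (cmod (v y))\<^sup>2" for y unfolding N_def p_def r_def cmod_power2 by (simp add: power2_eq_square)
  have pC: "Cinf_on S p" and rC: "Cinf_on S r"
    unfolding p_def[abs_def] r_def[abs_def]
    by (rule Cinf_on_bounded_linear[OF bounded_linear_Re v S(1)], rule Cinf_on_bounded_linear[OF bounded_linear_Im v S(1)])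
  have ppC: "Cinf_on S (\<lambda>y. p y * p y)" and rrC: "Cinf_on S (\<lambda>y. r y * r y)"
    by (rule Cinf_on_mult[OF pC pC S(1)], rule Cinf_on_mult[OF rC rC S(1)])
  have NC: "Cinf_on S N" unfolding N_def[abs_def] by (rule Cinf_on_add[OF ppC rrC S(1)])
  have kC: "Cinf_on S k" unfolding k_def[abs_def] by (rule Cinf_on_diff[OF Cinf_on_const \<psi> S(1)])
  have FC: "Cinf_on S F" unfolding F_def[abs_def] by (rule Cinf_on_mult[OF NC kC S(1)])
  have F_max: "F y \<le> F z" if "y \<in> S" for y using max[OF that] by (simp add: F_def N k_def)
  have kz: "k z > 0" using pos by (simp add: k_def)
  note diff = Cinf_on_differentiable[OF _ S(2)]
  have dk: "fd k z w = - fd \<psi> z w" for w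
    unfolding k_def[abs_def]
    by (simp add: fd_eqI[OF has_derivative_diff[OF has_derivative_const[where c=\<delta>] has_derivative_fd[OF diff[OF \<psi>]]]])
  have dN: "fd N z w = 2 * Re (cnj (v z) * fd v z w)" for w
  proof -
    have "fd N z w = 2 * p z * fd p z w + 2 * r z * fd r z w"
      unfolding N_def[abs_def] by (simp add: fd_add fd_mult diff pC rC ppC rrC)
    moreover have "fd p z w = Re (fd v z w)" "fd r z w = Im (fd v z w)"
      unfolding p_def[abs_def] r_def[abs_def]
      by (rule fd_bounded_linear[OF bounded_linear_Re diff[OF v]], rule fd_bounded_linear[OF bounded_linear_Im diff[OF v]])
    ultimately show ?thesis by (simp add: p_def r_def)
  qed
  have "fd F z w = 0" for w by (rule local_max_fd_fd(1)[OF FC S F_max])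
  then have "N z * fd k z w + fd N z w * k z = 0" for w
    unfolding F_def[abs_def] by (simp add: fd_mult diff NC kC)
  then have dN': "fd N z w = c * fd \<psi> z w" for w
    using kz by (simp add: dk c_def N[symmetric] k_def[symmetric] field_simps)
  then show "2 * Re (cnj (v z) * fd v z w) = c * fd \<psi> z w" using dN by simp
  assume X: "Cinf_on S X" and Y: "Cinf_on S Y" and CR: "\<And>y. y \<in> S \<Longrightarrow> fd v y (Y y) = \<i> * fd v y (X y)"
    and X0: "fd \<psi> z (X z) = 0" and Y0: "fd \<psi> z (Y z) = 0"
  have LLk: "LL Z k z = - LL Z \<psi> z" if "Cinf_on S Z" for Z
  proof -
    have "LL Z k z = LL Z (\<lambda>y. \<delta> + - \<psi> y) z" by (simp add: k_def[abs_def])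
    also have "\<dots> = LL Z (\<lambda>y. \<delta>) z + LL Z (\<lambda>y. - \<psi> y) z"
      by (rule LL_add[OF S that Cinf_on_const Cinf_on_bounded_linear[OF bounded_linear_minus[OF bounded_linear_ident] \<psi> S(1)]])
    also have "LL Z (\<lambda>y. - \<psi> y) z = - LL Z \<psi> z"
      by (rule LL_bounded_linear[OF S that bounded_linear_minus[OF bounded_linear_ident] \<psi>])
    finally show ?thesis by (simp add: LL_def)
  qed
  \<comment> \<open>The squares of the first derivatives of the real and imaginary parts are
    nonnegative and are dropped.\<close>
  have LLN: "LL Z N z \<ge> 2 * Re (cnj (v z) * LL Z v z)" if Z: "Cinf_on S Z" for Z
  proof -
    have "LL Z p z = Re (LL Z v z)" "LL Z r z = Im (LL Z v z)"
      unfolding p_def[abs_def] r_def[abs_def]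
      by (rule LL_bounded_linear[OF S Z bounded_linear_Re v], rule LL_bounded_linear[OF S Z bounded_linear_Im v])
    then have "LL Z N z = 2 * Re (cnj (v z) * LL Z v z) + 2 * (fd p z (Z z))\<^sup>2 + 2 * (fd r z (Z z))\<^sup>2"
      unfolding N_def[abs_def] LL_add[OF S Z ppC rrC] LL_mult[OF S Z pC pC] LL_mult[OF S Z rC rC]
      by (simp add: p_def r_def power2_eq_square algebra_simps)
    then show ?thesis by simp
  qed
  \<comment> \<open>The mixed term 2 (Z N) (Z k) of the product rule is 0 as Z \<psi> = 0 at z;
    dividing by \<delta> - \<psi> produces c.\<close>
  have LLF: "LL Z N z \<le> c * LL Z \<psi> z" if Z: "Cinf_on S Z" and Z0: "fd \<psi> z (Z z) = 0" for Z
  proof -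
    have "LL Z F z \<le> 0" unfolding LL_def by (rule local_max_along_field[OF FC Z S F_max])
    moreover have "LL Z F z = LL Z N z * k z - N z * LL Z \<psi> z"
      unfolding F_def[abs_def] LL_mult[OF S Z NC kC] LLk[OF Z] by (simp add: dk Z0)
    ultimately show ?thesis using kz by (simp add: c_def N[symmetric] k_def[symmetric] field_simps)
  qed
  have "2 * Re (cnj (v z) * (LL X v z + LL Y v z)) \<le> c * (LL X \<psi> z + LL Y \<psi> z)"
    using LLN[OF X] LLN[OF Y] LLF[OF X X0] LLF[OF Y Y0] by (simp add: distrib_left)
  also have "LL X v z + LL Y v z = - \<i> * fd v z (fd Y z (X z) - fd X z (Y z))"
    by (rule CR_sum_of_squares[OF S X Y v CR])
  finally show "2 * Im (cnj (v z) * fd v z (fd Y z (X z) - fd X z (Y z))) \<le> c * (LL X \<psi> z + LL Y \<psi> z)"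
    by (simp add: algebra_simps)
qed

context cr_frame
begin

text \<open>A real functional on the coordinate space becomes a covector by evaluating operators on
  the coordinate functions; this is complex linear without any splitting of vectors into real and
  imaginary parts.\<close>

lemma H0_extend:
  assumes q: "q \<in> W0" and L: "linear (L :: 'e \<Rightarrow> real)" and L0: "\<And>c. L (vec c (\<phi> q)) = 0"
  obtains \<xi> where "\<xi> \<in> H0 M q" "\<And>w. \<xi> (ct q w) = complex_of_real (L w)"
proof -
  have qU: "q \<in> U0" using q W0 by auto
  define l where "l v = (\<Sum>b\<in>Basis. v (xc b) * complex_of_real (L b))" for v
  define \<xi> where "\<xi> v = (if v \<in> ctangent_space A q then l v else 0)" for v
  have ct: "\<xi> (ct q w) = complex_of_real (L w)" for w
  proof -
    have "\<xi> (ct q w) = complex_of_real (\<Sum>b\<in>Basis. (w \<bullet> b) * L b)"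
      by (simp add: \<xi>_def l_def ct_ctangent[OF qU] ct_xc[OF qU])
    also have "(\<Sum>b\<in>Basis. (w \<bullet> b) * L b) = L w"
      using linear_sum[OF L, of "\<lambda>b. (w \<bullet> b) *\<^sub>R b" Basis] linear_cmul[OF L] by (simp add: euclidean_representation)
    finally show ?thesis .
  qed
  have "l (c *\<^sub>t v +\<^sub>t d *\<^sub>t w) = c * l v + d * l w" for c d v w
    by (simp add: l_def tadd_def tscale_def sum.distrib sum_distrib_left algebra_simps)
  then have "\<xi> \<in> ccovectors A q"
    unfolding ccovectors_def by (auto simp: \<xi>_def ctangent_add_scale[OF qU])
  then have "\<xi> \<in> H0 M q"
    unfolding H0_def using ct L0 by (auto simp: tangent_space_eq[OF qU] hor_eq[OF q])
  then show ?thesis using that ct by blast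
qed

text \<open>With q and the constants fixed the contradiction is pointwise. At a vector given by the
  second eigenvalue, the Hessian of the jet of f plus L(\<xi>, .) is at least - \<epsilon> times the
  Hessian of \<rho>. The bounds C and m turn this into more than - c0 times the metric, against the
  choice of the vector.\<close>

lemma no_local_max:
  assumes f: "cr_jet M U0 \<phi> n k W0 E V lam f \<eta>" and \<rho>: "cr_jet M U0 \<phi> n k W0 E V lam \<rho> \<eta>'"
    and h: "hermitian_metric M h" and n: "2 \<le> n"
    and conc: "\<And>\<xi>. \<xi> \<in> H0 M q \<Longrightarrow> jet_eigenvalues n M h V lam (f, \<eta>) q \<xi> ! 1 \<le> - c0"
    and m: "m > 0" "\<And>c. m * (\<Sum>i<2*n. (c i)\<^sup>2) \<le> (\<Sum>i<2*n. \<Sum>j<2*n. c i * c j * gmat h i j (\<phi> q))"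
    and C: "\<And>i j. i < 2 * n \<Longrightarrow> j < 2 * n \<Longrightarrow> \<bar>hmat (jet_form A V lam \<rho> \<eta>') \<rho> i j (\<phi> q)\<bar> \<le> C"
    and \<epsilon>: "\<epsilon> > 0" "\<epsilon> * (C * real (2 * n)) < c0 * m" and c0: "c0 > 0"
    and G: "open G" "G \<subseteq> W0" "G \<subseteq> V" "q \<in> G" and v: "Cinf_on (\<phi> ` G) v"
    and CR: "\<And>y c. y \<in> \<phi> ` G \<Longrightarrow> fd v y (jvec c y) = \<i> * fd v y (vec c y)"
    and \<psi>: "\<psi> = (\<lambda>y. (f \<circ> \<Phi>) y + \<epsilon> * (\<rho> \<circ> \<Phi>) y)"
    and max: "\<And>y. y \<in> \<phi> ` G \<Longrightarrow> (cmod (v y))\<^sup>2 * (\<delta> - \<psi> y) \<le> (cmod (v (\<phi> q)))\<^sup>2 * (\<delta> - \<psi> (\<phi> q))"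
    and v0: "v (\<phi> q) \<noteq> 0" and \<psi>0: "\<psi> (\<phi> q) < \<delta>"
  shows False
proof -
  let ?z = "\<phi> q"
  let ?S = "\<phi> ` G"
  interpret f: cr_jet M U0 \<phi> n k W0 E V lam f \<eta> by (rule f)
  interpret \<rho>: cr_jet M U0 \<phi> n k W0 E V lam \<rho> \<eta>' by (rule \<rho>)
  have GU: "G \<subseteq> U0" using G W0 by auto
  have q: "q \<in> W0" "q \<in> V" "q \<in> U0" using G GU by auto
  have S: "open ?S" "?z \<in> ?S" using open_img[OF G(1) GU] G(4) by auto
  have fC: "Cinf_on ?S (f \<circ> \<Phi>)" and \<rho>C: "Cinf_on ?S (\<rho> \<circ> \<Phi>)"
    using smooth_iff[OF G(1) GU] smooth_fun_subset[OF f.f G(3)] smooth_fun_subset[OF \<rho>.f G(3)] by auto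
  have e\<rho>C: "Cinf_on ?S (\<lambda>y. \<epsilon> * (\<rho> \<circ> \<Phi>) y)" by (rule Cinf_on_cmult[OF \<rho>C S(1)])
  have \<psi>C: "Cinf_on ?S \<psi>" unfolding \<psi> by (rule Cinf_on_add[OF fC e\<rho>C S(1)])
  have vC: "Cinf_on ?S (vec c)" "Cinf_on ?S (jvec c)" for c
    using Cinf_on_subset[OF vec_smooth image_mono[OF G(2)]] Cinf_on_subset[OF jvec_smooth image_mono[OF G(2)]] by auto
  note dv = Cinf_on_linear_fd[OF v S(2)]
  have d\<psi>: "fd \<psi> ?z w = fd (f \<circ> \<Phi>) ?z w + \<epsilon> * fd (\<rho> \<circ> \<Phi>) ?z w" for w
    unfolding \<psi> fd_add[OF Cinf_on_differentiable[OF fC S(2)] Cinf_on_differentiable[OF e\<rho>C S(2)]]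
    unfolding fd_bounded_linear[OF bounded_linear_mult_right Cinf_on_differentiable[OF \<rho>C S(2)]] ..
  have LL\<psi>: "LL X \<psi> ?z = LL X (f \<circ> \<Phi>) ?z + \<epsilon> * LL X (\<rho> \<circ> \<Phi>) ?z" if "Cinf_on ?S X" for X
    unfolding \<psi> LL_add[OF S that fC e\<rho>C] LL_bounded_linear[OF S that bounded_linear_mult_right \<rho>C] ..
  define c where "c = (cmod (v ?z))\<^sup>2 / (\<delta> - \<psi> ?z)"
  have c: "c > 0" using v0 \<psi>0 by (simp add: c_def)
  note wm = weighted_modulus_local_max[OF S v \<psi>C max \<psi>0, folded c_def]
  define \<tau> where "\<tau> \<alpha> w = Re (\<alpha> q (ct q w))" for \<alpha> :: "'a form" and w
  have lin\<tau>: "linear (\<tau> \<alpha>)" if "one_form A V \<alpha>" for \<alpha>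
  proof -
    have "\<alpha> q \<in> ccovectors A q" using that q by (auto simp: one_form_def)
    from linear_compose[OF ccovector_linear[OF this q(3)] bounded_linear.linear[OF bounded_linear_Re]]
    show ?thesis by (simp add: \<tau>_def[abs_def] o_def)
  qed
  let ?tf = "\<tau> (jet_form A V lam f \<eta>)" and ?tr = "\<tau> (jet_form A V lam \<rho> \<eta>')"
  \<comment> \<open>The candidate for \<xi>. Division by c matches the differential of v to that of
    \<psi>, and both jets are subtracted because \<psi> is f + \<epsilon> \<rho>.\<close>
  define L where "L w = Im (cnj (v ?z) * fd v ?z w) / c - ?tf w - \<epsilon> * ?tr w" for w
  have "linear L"
    unfolding L_def
    by (intro linearI) (auto simp: linear_add[OF dv] linear_cmul[OF dv] linear_add[OF lin\<tau>[OF f.one_form_\<theta>]]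
        linear_cmul[OF lin\<tau>[OF f.one_form_\<theta>]] linear_add[OF lin\<tau>[OF \<rho>.one_form_\<theta>]]
        linear_cmul[OF lin\<tau>[OF \<rho>.one_form_\<theta>]] algebra_simps add_divide_distrib diff_divide_distrib)
  moreover have "L (vec d ?z) = 0" for d
  proof -
    \<comment> \<open>The first order condition is used along J of the vector: by the CR equation Im
      at X is minus Re at JX, and \<open>Re_\<theta>\<close> also gives derivatives along
      JX.\<close>
    have "2 * Re (cnj (v ?z) * fd v ?z (jvec d ?z)) = c * fd \<psi> ?z (jvec d ?z)" by (rule wm(1))
    moreover have "Re (cnj (v ?z) * fd v ?z (jvec d ?z)) = - Im (cnj (v ?z) * fd v ?z (vec d ?z))"
      unfolding CR[OF S(2)] by (simp add: algebra_simps)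
    ultimately have "Im (cnj (v ?z) * fd v ?z (vec d ?z)) / c = - fd \<psi> ?z (jvec d ?z) / 2"
      using c by (simp add: field_simps)
    then show ?thesis
      unfolding L_def \<tau>_def f.Re_\<theta>(1)[OF q(2,1)] \<rho>.Re_\<theta>(1)[OF q(2,1)] d\<psi> by (simp add: field_simps)
  qed
  ultimately obtain \<xi> where \<xi>: "\<xi> \<in> H0 M q" "\<And>w. \<xi> (ct q w) = complex_of_real (L w)"
    using H0_extend[OF q(1)] by blast
  define Q where "Q X = jet_hessian M V lam (f, \<eta>) q X + levi_form M q \<xi> X" for X
  define B where "B i j = hmat (jet_form A V lam f \<eta>) f i j ?z - Re (\<xi> (ct q (br i j ?z)))" for i j
  have jh: "jet_hessian M V lam (f, \<eta>) q X = Re (form_diff A (jet_form A V lam f \<eta>) q X (cpx M q X))" for X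
    by (simp add: jet_hessian_def jet_form_def)
  have QB: "Q (ct q (vec d ?z)) = (\<Sum>i<2*n. \<Sum>j<2*n. d i * d j * B i j)" for d
    unfolding Q_def jh cpx_vec[OF q(1)] f.hessian_vec[OF q(2,1)] levi_vec(1)[OF q(1) \<xi>(1)]
      ccovector_bracket[OF q(1) H0_ccovector[OF \<xi>(1)]]
    by (simp add: B_def right_diff_distrib sum_subtractf)
  have QJ: "Q (ct q (jvec d ?z)) = Q (ct q (vec d ?z))" for d
    unfolding Q_def jh f.hessian_jvec[OF q(2,1)] levi_vec(2)[OF q(1) \<xi>(1)] cpx_vec[OF q(1)] ..
  have ev: "(THE l. eigenvalue_list (hor M q) (cpx M q) (h q) n Q l) ! 1 \<le> - c0"
    using conc[OF \<xi>(1)] by (simp add: jet_eigenvalues_def Q_def[abs_def])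
  \<comment> \<open>The functional is d \<psi>, so that X and JX both lie in its kernel, as the
    second order condition requires.\<close>
  obtain d where d: "\<exists>i<2*n. d i \<noteq> 0" "fd \<psi> ?z (vec d ?z) = 0" "fd \<psi> ?z (jvec d ?z) = 0"
    "(\<Sum>i<2*n. \<Sum>j<2*n. d i * d j * B i j) \<le> - c0 * (\<Sum>i<2*n. \<Sum>j<2*n. d i * d j * gmat h i j ?z)"
    using second_eigenvalue_frame[OF q(1) h n QB QJ ev Cinf_on_linear_fd[OF \<psi>C S(2)]] by blast
  let ?X = "vec d" and ?Y = "jvec d"
  define b where "b = fd ?Y ?z (?X ?z) - fd ?X ?z (?Y ?z)"
  define lf where "lf = LL ?X (f \<circ> \<Phi>) ?z + LL ?Y (f \<circ> \<Phi>) ?z"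
  define lr where "lr = LL ?X (\<rho> \<circ> \<Phi>) ?z + LL ?Y (\<rho> \<circ> \<Phi>) ?z"
  define s where "s = (\<Sum>i<2*n. (d i)\<^sup>2)"
  have s: "s > 0"
  proof -
    obtain i where "i < 2 * n" "d i \<noteq> 0" using d(1) by blast
    then show ?thesis unfolding s_def by (intro sum_pos2[of _ i]) auto
  qed
  have "2 * Im (cnj (v ?z) * fd v ?z b) \<le> c * (LL ?X \<psi> ?z + LL ?Y \<psi> ?z)"
    unfolding b_def by (rule wm(2)[OF _ vC(1) vC(2) CR d(2,3)])
  then have 1: "Im (cnj (v ?z) * fd v ?z b) / c \<le> (LL ?X \<psi> ?z + LL ?Y \<psi> ?z) / 2"
    using c by (simp add: field_simps)
  \<comment> \<open>The term - L(b) cancels the value of the jet form of f at the bracket b and puts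
    the derivative of v in its place, which is what the maximum controls.\<close>
  have "(\<Sum>i<2*n. \<Sum>j<2*n. d i * d j * B i j) =
      (\<Sum>i<2*n. \<Sum>j<2*n. d i * d j * hmat (jet_form A V lam f \<eta>) f i j ?z) - L b"
  proof -
    have "(\<Sum>i<2*n. \<Sum>j<2*n. d i * d j * Re (\<xi> (ct q (br i j ?z)))) = L b"
      using ccovector_bracket[OF q(1) H0_ccovector[OF \<xi>(1)], of d] \<xi>(2) by (simp add: b_def)
    then show ?thesis by (simp add: B_def right_diff_distrib sum_subtractf)
  qed
  also have "\<dots> = lf / 2 + \<epsilon> * ?tr b - Im (cnj (v ?z) * fd v ?z b) / c"
    unfolding f.hmat_vec[OF q(2,1)] b_def[symmetric] L_def lf_def LL_def \<tau>_def by (simp add: field_simps)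
  finally have B: "(\<Sum>i<2*n. \<Sum>j<2*n. d i * d j * B i j) = lf / 2 + \<epsilon> * ?tr b - Im (cnj (v ?z) * fd v ?z b) / c" .
  have "LL ?X \<psi> ?z + LL ?Y \<psi> ?z = lf + \<epsilon> * lr"
    unfolding LL\<psi>[OF vC(1)] LL\<psi>[OF vC(2)] lf_def lr_def by (simp add: distrib_left)
  with 1 B have B': "(\<Sum>i<2*n. \<Sum>j<2*n. d i * d j * B i j) \<ge> - \<epsilon> * (lr / 2 - ?tr b)"
    by (simp add: field_simps)
  have "lr / 2 - ?tr b = (\<Sum>i<2*n. \<Sum>j<2*n. d i * d j * hmat (jet_form A V lam \<rho> \<eta>') \<rho> i j ?z)"
    unfolding \<rho>.hmat_vec[OF q(2,1)] b_def[symmetric] lr_def LL_def \<tau>_def by (simp add: field_simps)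
  with B' have 2: "- \<epsilon> * (\<Sum>i<2*n. \<Sum>j<2*n. d i * d j * hmat (jet_form A V lam \<rho> \<eta>') \<rho> i j ?z) \<le>
      (\<Sum>i<2*n. \<Sum>j<2*n. d i * d j * B i j)" by simp
  have "\<bar>\<Sum>i<2*n. \<Sum>j<2*n. d i * d j * hmat (jet_form A V lam \<rho> \<eta>') \<rho> i j ?z\<bar> \<le> C * real (2 * n) * s"
    unfolding s_def by (rule quadratic_form_le[OF C])
  then have "\<epsilon> * (\<Sum>i<2*n. \<Sum>j<2*n. d i * d j * hmat (jet_form A V lam \<rho> \<eta>') \<rho> i j ?z) \<le> \<epsilon> * (C * real (2 * n) * s)"
    using \<epsilon>(1) by (intro mult_left_mono) auto
  also have "\<dots> = \<epsilon> * (C * real (2 * n)) * s" by simp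
  also have "\<dots> < c0 * m * s" using \<epsilon>(2) s by (rule mult_strict_right_mono)
  also have "\<dots> = c0 * (m * s)" by simp
  also have "\<dots> \<le> c0 * (\<Sum>i<2*n. \<Sum>j<2*n. d i * d j * gmat h i j ?z)"
    unfolding s_def using c0 m(2) by (intro mult_left_mono) auto
  finally show False using 2 d(4) by simp
qed

text \<open>Needed at all points, also off W0, where the cut-off section below is 0.\<close>

lemma zero_hor: "(\<lambda>f. 0) \<in> hor M p"
proof -
  have "smooth_subbundle A (2 * n) (hor M)" using CR by (simp add: CR_manifold_def)
  then obtain V' E' where VE: "p \<in> V'" "\<And>q. q \<in> V' \<Longrightarrow>
      hor M q = {lincomb (2 * n) (\<lambda>i. complex_of_real (c i)) (\<lambda>i. E' i q) | c. True}"
    unfolding smooth_subbundle_def by metis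
  have "(\<lambda>f. 0) = lincomb (2 * n) (\<lambda>i. complex_of_real 0) (\<lambda>i. E' i p)" by (simp add: lincomb_def)
  then show ?thesis unfolding VE(2)[OF VE(1)] by (intro CollectI exI conjI TrueI)
qed

lemma zero_ctangent: "(\<lambda>f. 0) \<in> ctangent_space A p"
proof -
  obtain U \<psi> where U: "chart A U \<psi>" "p \<in> U" using smooth_atlas_chart_at[OF atlas] by blast
  show ?thesis using chart.ct_ctangent[OF U, of 0] chart.ct_zero[OF U] by simp
qed

text \<open>CR functions are only tested on sections over all of their domain, hence the cut-off.\<close>

lemma CR_fun_vec:
  assumes u: "CR_fun M U u" and U: "open U" and q: "q \<in> W0" "q \<in> U"
  shows "fd (u \<circ> \<Phi>) (\<phi> q) (jvec c (\<phi> q)) = \<i> * fd (u \<circ> \<Phi>) (\<phi> q) (vec c (\<phi> q))"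
proof -
  let ?z = "\<phi> q"
  have qU: "q \<in> U0" using q W0 by auto
  obtain r where r: "r > 0" "cball ?z r \<subseteq> \<phi> ` W0"
    using open_imgW q(1) open_contains_cball by (metis imageI)
  define K where "K = \<Phi> ` cball ?z r"
  have "\<phi> ` W0 \<subseteq> \<phi> ` U0" using W0 by auto
  then have "compact K" unfolding K_def
    by (intro compact_continuous_image continuous_on_subset[OF continuous_\<Phi>]) (use r in auto)
  \<comment> \<open>Compact sets are closed in a Hausdorff space, so the complement of K is open;
    together with W0 it covers the manifold, and smoothness can be checked on both.\<close>
  then have K: "closed K" by (rule compact_imp_closed)
  have KW: "K \<subseteq> W0"
  proof
    fix p assume "p \<in> K"
    then obtain y where "y \<in> cball ?z r" "p = \<Phi> y" by (auto simp: K_def)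
    then show "p \<in> W0" using r(2) \<phi>_\<Phi>[OF _ W0(2)] by auto
  qed
  define x where "x y = bump r ?z y *\<^sub>R vec c y" for y
  define X where "X p = (if p \<in> W0 then ct p (x (\<phi> p)) else (\<lambda>f. 0))" for p
  have xC: "Cinf_on (\<phi> ` W0) x"
    unfolding x_def[abs_def]
    by (rule Cinf_on_scaleR[OF Cinf_on_subset[OF Cinf_on_bump] vec_smooth open_imgW]) auto
  have x_vec: "x y = vec (\<lambda>i. bump r ?z y * c i) y" for y
    by (simp add: x_def vec_def scaleR_sum_right)
  have X0: "X p = (\<lambda>f. 0)" if "p \<notin> K" for p
  proof (cases "p \<in> W0")
    case True
    then have pU: "p \<in> U0" using W0 by auto
    have "\<phi> p \<notin> cball ?z r" using that pU by (metis K_def \<Phi>_\<phi> imageI)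
    then have "bump r ?z (\<phi> p) = 0" using r(1) by (intro bump_eq_0) (auto simp: dist_commute)
    then show ?thesis using pU by (simp add: X_def x_def ct_zero)
  qed (simp add: X_def)
  have Xhor: "X p \<in> hor M p" for p
    using zero_hor vec_hor x_vec by (simp add: X_def)
  have Xct: "X p \<in> ctangent_space A p" for p
    using zero_ctangent ct_ctangent W0 by (auto simp: X_def)
  have "smooth_section A U (hor M) X"
    unfolding smooth_section_def
  proof (intro conjI ballI allI impI Xhor Xct)
    fix W and f :: "'a \<Rightarrow> complex" assume W: "open W \<and> W \<subseteq> U \<and> smooth_fun A W f"
    show "smooth_fun A W (\<lambda>p. X p f)"
    proof (rule smooth_fun_local[OF _ atlas])
      fix p assume p: "p \<in> W"
      show "\<exists>G. open G \<and> p \<in> G \<and> smooth_fun A G (\<lambda>p. X p f)"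
      proof (cases "p \<in> W0")
        case True
        have o: "open (W \<inter> W0)" "W \<inter> W0 \<subseteq> U0" using W W0 by auto
        have xW: "Cinf_on (\<phi> ` (W \<inter> W0)) x" by (rule Cinf_on_subset[OF xC]) auto
        have XW: "X p = ct p (x (\<phi> p))" if "p \<in> W \<inter> W0" for p using that by (simp add: X_def)
        have fW: "smooth_fun A (W \<inter> W0) f" by (rule smooth_fun_subset[of A W]) (use W in auto)
        have "smooth_fun A (W \<inter> W0) (\<lambda>p. X p f)" by (rule field_apply_smooth(3)[OF xW XW o fW])
        then show ?thesis using True p W W0 by (intro exI[of _ "W \<inter> W0"]) auto
      next
        case False
        have o: "open (W - K)" using W K by auto
        have "smooth_fun A (W - K) (\<lambda>p. X p f)"
          by (rule smooth_fun_cong[OF atlas o smooth_fun_const[of _ _ 0]]) (simp add: X0)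
        then show ?thesis using o False p KW by (intro exI[of _ "W - K"]) auto
      qed
    qed
  qed
  note Xs = this
  note JXs = cpx_section[OF U Xs]
  define Z where "Z p = X p +\<^sub>t \<i> *\<^sub>t cpx M p (X p)" for p
  have "smooth_section A U (T01 M) Z"
    unfolding smooth_section_def
  proof (intro conjI ballI allI impI)
    fix p assume p: "p \<in> U"
    show "Z p \<in> T01 M p" using Xhor by (auto simp: Z_def T01_def)
    obtain U' \<psi> where U': "chart A U' \<psi>" "p \<in> U'" using smooth_atlas_chart_at[OF atlas] by blast
    have "cpx M p (X p) \<in> ctangent_space A p" using JXs p by (auto simp: smooth_section_def)
    then show "Z p \<in> ctangent_space A p"
      unfolding Z_def using chart.ctangent_add[OF U' Xct] chart.ctangent_scale[OF U'] by blast
  next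
    fix W and f :: "'a \<Rightarrow> complex" assume W: "open W \<and> W \<subseteq> U \<and> smooth_fun A W f"
    have "smooth_fun A W (\<lambda>p. X p f)" "smooth_fun A W (\<lambda>p. cpx M p (X p) f)"
      using Xs JXs W unfolding smooth_section_def by auto
    then have "smooth_fun A W (\<lambda>p. X p f + \<i> * cpx M p (X p) f)"
      using W by (intro smooth_fun_add[OF atlas] smooth_fun_mult[OF atlas] smooth_fun_const) auto
    then show "smooth_fun A W (\<lambda>p. Z p f)" by (simp add: Z_def tadd_def tscale_def)
  qed
  then have "Z q u = 0" using u q(2) unfolding CR_fun_def by blast
  moreover have uU: "smooth_fun A U u" using u by (simp add: CR_fun_def)
  moreover have "cpx M q (X q) = ct q (bump r ?z ?z *\<^sub>R jvec c ?z)"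
    using q(1) cpx_vec[OF q(1), of "\<lambda>i. bump r ?z ?z * c i"]
    by (simp add: X_def x_vec jvec_def scaleR_sum_right)
  ultimately have "bump r ?z ?z *\<^sub>R fd (u \<circ> \<Phi>) ?z (vec c ?z) + \<i> * (bump r ?z ?z *\<^sub>R fd (u \<circ> \<Phi>) ?z (jvec c ?z)) = 0"
    using q(1) linear_cmul[OF linear_frechet_derivative[OF smooth_differentiable[OF uU U q(2) qU]]]
    by (simp add: Z_def tadd_def tscale_def X_def x_def ct_apply[OF uU U q(2)])
  then have "bump r ?z ?z *\<^sub>R (fd (u \<circ> \<Phi>) ?z (vec c ?z) + \<i> * fd (u \<circ> \<Phi>) ?z (jvec c ?z)) = 0"
    by (simp add: scaleR_add_right)
  moreover have "bump r ?z ?z > 0" using r(1) by (intro bump_pos) simp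
  ultimately have "fd (u \<circ> \<Phi>) ?z (vec c ?z) + \<i> * fd (u \<circ> \<Phi>) ?z (jvec c ?z) = 0" by simp
  then have "fd (u \<circ> \<Phi>) ?z (vec c ?z) = - \<i> * fd (u \<circ> \<Phi>) ?z (jvec c ?z)" by (simp add: add_eq_0_iff)
  then show ?thesis by simp
qed

end

text \<open>Were x > B > 0, the powers of (x / B)^2 would exceed the constant D / t. The case B = 0
  is settled by N = 1 alone.\<close>

lemma le_of_power_bounds:
  fixes x B t D :: real
  assumes x: "0 \<le> x" and B: "0 \<le> B" and t: "0 < t" and le: "\<And>N. (x ^ N)\<^sup>2 * t \<le> (B ^ N)\<^sup>2 * D"
  shows "x \<le> B"
proof (rule ccontr)
  assume "\<not> x \<le> B"
  then have xB: "B < x" by simp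
  show False
  proof (cases "B = 0")
    case True
    then show False using le[of 1] t xB by (simp add: mult_le_0_iff)
  next
    case False
    then have B: "B > 0" using B by simp
    have "1 < x / B" using xB B by simp
    then have "1 < (x / B)\<^sup>2" by (rule one_less_power) simp
    then obtain N where N: "D / t < ((x / B)\<^sup>2) ^ N" using real_arch_pow by blast
    have "((x / B)\<^sup>2) ^ N = (x ^ N)\<^sup>2 / (B ^ N)\<^sup>2"
      by (simp add: power_divide power_mult[symmetric] mult.commute)
    moreover have "(x ^ N)\<^sup>2 / (B ^ N)\<^sup>2 \<le> D / t" using le[of N] B t by (simp add: field_simps)
    ultimately show False using N by simp
  qed
qed

lemma fd_power:
  fixes f :: "'e::euclidean_space \<Rightarrow> complex"
  assumes "f differentiable at y"
  shows "fd (\<lambda>y. f y ^ N) y w = of_nat N * fd f y w * f y ^ (N - 1)"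
  using fd_eqI[OF has_derivative_power[OF has_derivative_fd[OF assms], of N]] by simp

text \<open>A gauge on \<open>V\<close> acts only on forms on \<open>V\<close>, so the weight that localizes at \<open>z0\<close> has to
  be smooth beyond the chart, unlike the squared coordinate distance.\<close>

lemma (in chart) localizer_smooth:
  assumes r: "r > 0" "cball z0 r \<subseteq> \<phi> ` U0"
  shows "smooth_fun A V (\<lambda>p. if p \<in> U0 then bump r z0 z0 - bump r z0 (\<phi> p) else bump r z0 z0)"
    (is "smooth_fun A V ?\<rho>")
proof (rule smooth_fun_local[OF _ atlas])
  define K where "K = \<Phi> ` cball z0 r"
  have "compact K" unfolding K_def
    by (intro compact_continuous_image continuous_on_subset[OF continuous_\<Phi>]) (use r in auto)
  then have K: "open (- K)" by (simp add: compact_imp_closed open_Compl)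
  have KU: "K \<subseteq> U0" unfolding K_def using r(2) by (auto simp: inv_into_into subset_iff)
  fix p
  show "\<exists>W. open W \<and> p \<in> W \<and> smooth_fun A W ?\<rho>"
  proof (cases "p \<in> U0")
    case True
    have "Cinf_on (\<phi> ` U0) (\<lambda>y. bump r z0 z0 - bump r z0 y)"
      by (rule Cinf_on_diff[OF Cinf_on_const Cinf_on_subset[OF Cinf_on_bump] open_img0]) auto
    then have "Cinf_on (\<phi> ` U0) (?\<rho> \<circ> \<Phi>)"
      by (rule Cinf_on_cong[OF open_img0, rotated]) auto
    then have "smooth_fun A U0 ?\<rho>" using smooth_iff[OF open_U0 order_refl] by blast
    then show ?thesis using True open_U0 by blast
  next
    case False
    have "bump r z0 (\<phi> q) = 0" if "q \<in> - K" "q \<in> U0" for q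
    proof -
      have "\<phi> q \<notin> cball z0 r" using that by (metis ComplD K_def \<Phi>_\<phi> imageI)
      then show ?thesis using r(1) by (intro bump_eq_0) (auto simp: dist_commute)
    qed
    then have "smooth_fun A (- K) ?\<rho>"
      by (intro smooth_fun_cong[OF atlas K smooth_fun_const[of _ _ "bump r z0 z0"]]) auto
    then show ?thesis using False K KU by blast
  qed
qed

text \<open>\<open>hmat\<close> evaluates \<theta> at points of the manifold; expanding in the
  coefficients \<open>fc\<close> makes it an expression in continuous functions of the coordinates.
  This bounds the Hessian of the weight near the base point.\<close>

lemma (in cr_jet) hmat_continuous:
  assumes q: "q \<in> V" "q \<in> W0" and ij: "i < 2 * n" "j < 2 * n"
  shows "isCont (hmat \<theta> f i j) (\<phi> q)"
proof -
  define G where "G = V \<inter> W0"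
  have G: "open G" "G \<subseteq> U0" "q \<in> G" "G \<subseteq> W0" "G \<subseteq> V" using V W0 q by (auto simp: G_def)
  have oG: "open (\<phi> ` G)" "\<phi> q \<in> \<phi> ` G" using open_img G by auto
  have fC: "Cinf_on (\<phi> ` G) (f \<circ> \<Phi>)"
    using smooth_iff[OF G(1,2)] smooth_fun_subset[OF f G(5)] by blast
  have eC: "Cinf_on (\<phi> ` G) (e i)" "Cinf_on (\<phi> ` G) (je i)" if "i < 2 * n" for i
    using e_smooth[OF that] je_smooth[OF that] G(4) by (auto intro: Cinf_on_subset)
  have c: "continuous_on (\<phi> ` G) (\<lambda>y. fd g y (X y))" if "Cinf_on (\<phi> ` G) g" "Cinf_on (\<phi> ` G) X"
    for g :: "'e \<Rightarrow> 'g::real_normed_vector" and X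
    using Cinf_on_continuous_on[OF Cinf_on_fd_field[OF that oG(1)]] .
  have fcC: "continuous_on (\<phi> ` G) (fc \<theta> b)" for b
    by (rule Cinf_on_continuous_on[OF fc_smooth[OF one_form_\<theta> G(1,2,5)]])
  have brC: "continuous_on (\<phi> ` G) (br i j)"
    unfolding br_def[abs_def] by (intro continuous_on_diff c eC ij)
  have "continuous_on (\<phi> ` G) (\<lambda>y. (fd (\<lambda>y. fd (f \<circ> \<Phi>) y (e j y)) y (e i y) + fd (\<lambda>y. fd (f \<circ> \<Phi>) y (je j y)) y (je i y)) / 2
     - Re (\<Sum>b\<in>Basis. (br i j y \<bullet> b) *\<^sub>R fc \<theta> b y))"
    by (intro continuous_intros c brC fcC Cinf_on_fd_field fC eC ij oG(1)) auto
  moreover have "hmat \<theta> f i j y = (fd (\<lambda>y. fd (f \<circ> \<Phi>) y (e j y)) y (e i y) + fd (\<lambda>y. fd (f \<circ> \<Phi>) y (je j y)) y (je i y)) / 2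
     - Re (\<Sum>b\<in>Basis. (br i j y \<bullet> b) *\<^sub>R fc \<theta> b y)" if y: "y \<in> \<phi> ` G" for y
  proof -
    obtain p where p: "p \<in> G" "y = \<phi> p" using y by blast
    then have pV: "p \<in> V" "p \<in> U0" using G by auto
    show ?thesis using form_expand[OF one_form_\<theta> pV] pV(2) by (simp add: hmat_def p(2))
  qed
  ultimately have "continuous_on (\<phi> ` G) (hmat \<theta> f i j)" by (metis (no_types, lifting) continuous_on_cong)
  then show ?thesis using oG continuous_on_eq_continuous_at by blast
qed

context cr_frame
begin

section \<open>The maximum principle near a boundary point\<close>

lemma gmat_continuous:
  assumes h: "hermitian_metric M h" and q: "q \<in> W0" and ij: "i < 2 * n" "j < 2 * n"
  shows "isCont (gmat h i j) (\<phi> q)"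
proof -
  have "smooth_fun A W0 (\<lambda>p. h p (E i p) (E j p))"
    using h[unfolded hermitian_metric_def, THEN conjunct2, THEN conjunct2, THEN conjunct2, rule_format]
      W0(1) E_hor_section ij by blast
  then have "Cinf_on (\<phi> ` W0) (\<lambda>z. h (\<Phi> z) (E i (\<Phi> z)) (E j (\<Phi> z)))" by (rule smooth_imp_Cinf_on[OF W0])
  then have "continuous_on (\<phi> ` W0) (gmat h i j)"
    unfolding gmat_def[abs_def] by (intro continuous_intros Cinf_on_continuous_on)
  then show ?thesis using open_imgW q continuous_on_eq_continuous_at by blast
qed

lemma gmat_lower_bound:
  assumes h: "hermitian_metric M h" and q: "q \<in> W0"
  shows "\<exists>m>0. eventually (\<lambda>z. \<forall>c. m * (\<Sum>i<2*n. (c i)\<^sup>2) \<le> (\<Sum>i<2*n. \<Sum>j<2*n. c i * c j * gmat h i j z)) (nhds (\<phi> q))"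
proof (rule posdef_eventually_lower_bound)
  fix c :: "nat \<Rightarrow> real" assume "\<exists>i<2*n. c i \<noteq> 0"
  then have "vec c (\<phi> q) \<noteq> 0" using vec_indep[OF q] by blast
  then have "ct q (vec c (\<phi> q)) \<noteq> (\<lambda>f. 0)" using ct_inj[of q _ 0] ct_zero[of q] q W0 by auto
  then have "Re (h q (ct q (vec c (\<phi> q))) (ct q (vec c (\<phi> q)))) > 0"
    using h[unfolded hermitian_metric_def, THEN conjunct2, THEN conjunct2, THEN conjunct1, rule_format, OF vec_hor[OF q]] by blast
  then show "0 < (\<Sum>i<2*n. \<Sum>j<2*n. c i * c j * gmat h i j (\<phi> q))"
    unfolding hermitian_vec[OF q h] .
qed (rule gmat_continuous[OF h q])

text \<open>The neighborhood is chosen from the jet, the metric and the frame, before u and B. A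
  real bound B where f < 0 stands for the supremum over Y and avoids infinite suprema.\<close>

lemma local_maximum_principle:
  assumes f: "cr_jet M U0 \<phi> n k W0 E V lam f \<eta>" and h: "hermitian_metric M h" and n: "2 \<le> n"
    and conc: "\<And>q \<xi>. q \<in> W0 \<Longrightarrow> \<xi> \<in> H0 M q \<Longrightarrow> jet_eigenvalues n M h V lam (f, \<eta>) q \<xi> ! 1 \<le> - c0"
    and c0: "c0 > 0" and a: "a \<in> W0" "f a \<le> 0" and WV: "W0 \<subseteq> V" and U: "open U" "W0 \<subseteq> U"
  shows "\<exists>\<omega>. open \<omega> \<and> a \<in> \<omega> \<and> \<omega> \<subseteq> W0 \<and> (\<forall>u B. CR_fun M U u \<longrightarrow> 0 \<le> B \<longrightarrow>
    (\<forall>p\<in>W0. f p < 0 \<longrightarrow> cmod (u p) \<le> B) \<longrightarrow> (\<forall>p\<in>\<omega>. cmod (u p) \<le> B))"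
proof -
  let ?z0 = "\<phi> a"
  interpret f: cr_jet M U0 \<phi> n k W0 E V lam f \<eta> by (rule f)
  obtain r0 where r0: "r0 > 0" "cball ?z0 r0 \<subseteq> \<phi> ` W0"
    using open_imgW a(1) open_contains_cball by (metis imageI)
  \<comment> \<open>The bump turned upside down and extended by its largest value off the
    chart.\<close>
  define \<rho> where "\<rho> p = (if p \<in> U0 then bump r0 ?z0 ?z0 - bump r0 ?z0 (\<phi> p) else bump r0 ?z0 ?z0)" for p
  have "cball ?z0 r0 \<subseteq> \<phi> ` U0" using r0(2) W0(2) by blast
  then have \<rho>V: "smooth_fun A V \<rho>" unfolding \<rho>_def[abs_def] by (rule localizer_smooth[OF r0(1)])
  \<comment> \<open>The weight gets the zero form as its transversal part, in the gauge of the given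
    jet.\<close>
  have \<rho>: "cr_jet M U0 \<phi> n k W0 E V lam \<rho> (\<lambda>p v. 0)"
  proof (intro cr_jet.intro cr_jet_axioms.intro)
    show "one_form A V (\<lambda>p v. 0)" by (simp add: one_form_def ccovectors_def smooth_fun_const)
  qed (auto simp: H0_def ccovectors_def \<rho>V f.V f.lam cr_frame_axioms)
  interpret \<rho>: cr_jet M U0 \<phi> n k W0 E V lam \<rho> "\<lambda>p v. 0" by (rule \<rho>)
  let ?H = "\<lambda>i j. hmat (jet_form A V lam \<rho> (\<lambda>p v. 0)) \<rho> i j"
  obtain m where m: "m > 0" and evm: "eventually (\<lambda>z. \<forall>c. m * (\<Sum>i<2*n. (c i)\<^sup>2) \<le>
      (\<Sum>i<2*n. \<Sum>j<2*n. c i * c j * gmat h i j z)) (nhds ?z0)"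
    using gmat_lower_bound[OF h a(1)] by blast
  \<comment> \<open>The \<open>+ 1\<close> makes the bound positive and strict at a, so that it
    persists nearby.\<close>
  define C where "C = (\<Sum>i<2*n. \<Sum>j<2*n. \<bar>?H i j ?z0\<bar>) + 1"
  have C: "C > 0" unfolding C_def by (intro add_nonneg_pos sum_nonneg) auto
  have "\<forall>\<^sub>F z in nhds ?z0. \<bar>?H i j z\<bar> < C" if "i < 2 * n" "j < 2 * n" for i j
  proof -
    have "\<bar>?H i j ?z0\<bar> \<le> (\<Sum>j<2*n. \<bar>?H i j ?z0\<bar>)" using that by (intro member_le_sum) auto
    also have "\<dots> \<le> (\<Sum>i<2*n. \<Sum>j<2*n. \<bar>?H i j ?z0\<bar>)"
      using that by (intro member_le_sum[of i "{..<2*n}" "\<lambda>i. \<Sum>j<2*n. \<bar>?H i j ?z0\<bar>"]) (auto intro: sum_nonneg)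
    finally have "\<bar>?H i j ?z0\<bar> < C" by (simp add: C_def)
    moreover have "((\<lambda>z. \<bar>?H i j z\<bar>) \<longlongrightarrow> \<bar>?H i j ?z0\<bar>) (nhds ?z0)"
      using \<rho>.hmat_continuous[of a i j] a WV that by (intro tendsto_rabs) (auto simp: continuous_at tendsto_nhds_iff)
    ultimately show ?thesis by (rule order_tendstoD(2)[rotated])
  qed
  then have "\<forall>\<^sub>F z in nhds ?z0. \<forall>i\<in>{..<2*n}. \<forall>j\<in>{..<2*n}. \<bar>?H i j z\<bar> < C"
    by (intro eventually_ball_finite ballI) auto
  from eventually_conj[OF evm this] obtain d where d: "d > 0" "\<And>z. dist z ?z0 < d \<Longrightarrow>
      (\<forall>c. m * (\<Sum>i<2*n. (c i)\<^sup>2) \<le> (\<Sum>i<2*n. \<Sum>j<2*n. c i * c j * gmat h i j z)) \<and>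
      (\<forall>i\<in>{..<2*n}. \<forall>j\<in>{..<2*n}. \<bar>?H i j z\<bar> < C)"
    unfolding eventually_nhds_metric by blast
  define r where "r = min d r0 / 2"
  have r: "r > 0" "r < d" "r < r0" using d(1) r0(1) by (auto simp: r_def)
  have cb: "cball ?z0 r \<subseteq> \<phi> ` W0" using r0(2) r(3) by (meson less_imp_le order_trans subset_cball)
  \<comment> \<open>Half of the critical value c0 m / (2 n C).\<close>
  define \<epsilon> where "\<epsilon> = c0 * m / (2 * (C * real (2 * n)))"
  have \<epsilon>: "\<epsilon> > 0" "\<epsilon> * (C * real (2 * n)) < c0 * m"
  proof -
    show "\<epsilon> > 0" unfolding \<epsilon>_def using c0 m C n by simp
    have "\<epsilon> * (C * real (2 * n)) = c0 * m / 2" using C n by (simp add: \<epsilon>_def)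
    also have "\<dots> < c0 * m" using mult_pos_pos[OF c0 m] by simp
    finally show "\<epsilon> * (C * real (2 * n)) < c0 * m" .
  qed
  \<comment> \<open>The value of \<rho> at coordinate distance r, and a lower bound for it from
    there on.\<close>
  define \<rho>1 where "\<rho>1 = flat 0 (r0\<^sup>2) - flat 0 (r0\<^sup>2 - r\<^sup>2)"
  have \<rho>1: "\<rho>1 > 0" using flat_less[of "r0\<^sup>2 - r\<^sup>2" "r0\<^sup>2"] r r0 by (simp add: \<rho>1_def)
  have \<rho>_ge: "\<rho> p \<ge> \<rho>1" if "p \<in> U0" "r \<le> dist (\<phi> p) ?z0" for p
  proof -
    have "r\<^sup>2 \<le> (dist (\<phi> p) ?z0)\<^sup>2" using that(2) r(1) by (intro power_mono) auto
    then show ?thesis using that(1) flat_mono[of "r0\<^sup>2 - (dist (\<phi> p) ?z0)\<^sup>2" "r0\<^sup>2 - r\<^sup>2"]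
      by (simp add: \<rho>_def \<rho>1_def bump_def)
  qed
  \<comment> \<open>Where f \<ge> 0 and the distance is at least r, \<psi> is at least \<delta>, so
    the weight \<delta> - \<psi> is not positive there.\<close>
  define \<delta> where "\<delta> = \<epsilon> * \<rho>1"
  have \<delta>: "\<delta> > 0" using \<epsilon>(1) \<rho>1 by (simp add: \<delta>_def)
  define \<psi> where "\<psi> = (\<lambda>y. (f \<circ> \<Phi>) y + \<epsilon> * (\<rho> \<circ> \<Phi>) y)"
  have "Cinf_on (\<phi> ` W0) (f \<circ> \<Phi>)" "Cinf_on (\<phi> ` W0) (\<rho> \<circ> \<Phi>)"
    using smooth_iff[OF W0] smooth_fun_subset[OF f.f WV] smooth_fun_subset[OF \<rho>V WV] by auto
  then have "Cinf_on (\<phi> ` W0) \<psi>" unfolding \<psi>_def by (intro Cinf_on_add Cinf_on_cmult open_imgW)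
  then have \<psi>c: "continuous_on (\<phi> ` W0) \<psi>" by (rule Cinf_on_continuous_on)
  define O' where "O' = ball ?z0 r \<inter> (\<phi> ` W0 \<inter> \<psi> -` {..<\<delta>})"
  define \<omega> where "\<omega> = U0 \<inter> \<phi> -` O'"
  have "open O'" unfolding O'_def using continuous_open_preimage[OF \<psi>c open_imgW, of "{..<\<delta>}"] by auto
  then have \<omega>: "open \<omega>" unfolding \<omega>_def by (rule open_vimage_\<phi>)
  have \<omega>W: "\<omega> \<subseteq> W0"
  proof
    fix p assume "p \<in> \<omega>"
    then have "p \<in> U0" "\<phi> p \<in> \<phi> ` W0" by (auto simp: \<omega>_def O'_def)
    then show "p \<in> W0" using \<phi>_\<Phi>[OF _ W0(2), of "\<phi> p"] by auto
  qed
  have aU: "a \<in> U0" using a(1) W0 by auto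
  \<comment> \<open>Here f a \<le> 0, and \<rho> vanishes at a.\<close>
  have "a \<in> \<omega>" using a aU r(1) \<delta> by (simp add: \<omega>_def O'_def \<psi>_def \<rho>_def)
  moreover have "cmod (u p0) \<le> B"
    if u: "CR_fun M U u" and B: "0 \<le> B" and uB: "\<And>p. p \<in> W0 \<Longrightarrow> f p < 0 \<Longrightarrow> cmod (u p) \<le> B" and p0: "p0 \<in> \<omega>"
    for u B p0
  proof -
    \<comment> \<open>The closed counterpart of \<omega> in coordinates, on which maxima are
      attained.\<close>
    define K where "K = cball ?z0 r \<inter> (cball ?z0 r \<inter> \<psi> -` {..\<delta>})"
    have \<psi>cb: "continuous_on (cball ?z0 r) \<psi>" by (rule continuous_on_subset[OF \<psi>c cb])
    have K: "compact K" unfolding K_def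
      by (intro compact_Int_closed compact_cball continuous_closed_preimage[OF \<psi>cb]) auto
    have \<omega>K: "\<phi> p \<in> K" if "p \<in> \<omega>" for p using that by (auto simp: \<omega>_def O'_def K_def)
    have KW: "K \<subseteq> \<phi> ` W0" using cb by (auto simp: K_def)
    have uC: "Cinf_on (\<phi> ` W0) (u \<circ> \<Phi>)"
      using u smooth_fun_subset[OF _ U(2)] smooth_iff[OF W0] by (auto simp: CR_fun_def)
    obtain y0 where y0: "y0 \<in> K" "\<And>y. y \<in> K \<Longrightarrow> \<psi> y0 \<le> \<psi> y"
      using continuous_attains_inf[OF K _ continuous_on_subset[OF \<psi>c KW]] \<omega>K[OF p0] by blast
    \<comment> \<open>The largest value of the weight on K, independent of N.\<close>
    define D where "D = \<delta> - \<psi> y0"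
    have D: "D \<ge> 0" using y0(1) by (simp add: D_def K_def)
    have bound: "(cmod ((u \<circ> \<Phi>) y) ^ N)\<^sup>2 * (\<delta> - \<psi> y) \<le> (B ^ N)\<^sup>2 * D" if y: "y \<in> K" for y N
    proof -
      define v where "v y = (u \<circ> \<Phi>) y ^ N" for y
      have vC: "Cinf_on (\<phi> ` W0) v" unfolding v_def[abs_def] by (rule Cinf_on_power[OF uC open_imgW])
      define F where "F y = (cmod (v y))\<^sup>2 * (\<delta> - \<psi> y)" for y
      have "continuous_on K F" unfolding F_def
        by (intro continuous_intros continuous_on_subset[OF \<psi>c KW] continuous_on_subset[OF Cinf_on_continuous_on[OF vC] KW])
      then obtain z where z: "z \<in> K" "\<And>y. y \<in> K \<Longrightarrow> F y \<le> F z"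
        using continuous_attains_sup[OF K _ \<open>continuous_on K F\<close>] y by blast
      have "F z \<le> (B ^ N)\<^sup>2 * D"
      proof (rule ccontr)
        assume n': "\<not> F z \<le> (B ^ N)\<^sup>2 * D"
        have "0 \<le> (B ^ N)\<^sup>2 * D" using D by simp
        then have Fz: "F z > 0" using n' by linarith
        have "\<psi> z \<le> \<delta>" using z(1) by (simp add: K_def)
        then have v0: "v z \<noteq> 0" and \<psi>0: "\<psi> z < \<delta>" using Fz by (auto simp: F_def zero_less_mult_iff)
        obtain q where q: "q \<in> W0" "z = \<phi> q" using KW z(1) by blast
        have qU: "q \<in> U0" using q W0 by auto
        \<comment> \<open>A maximum where f < 0 is bounded by B directly; any other one would be
          interior, which \<open>no_local_max\<close> excludes.\<close>
        show False
        proof (cases "f q < 0")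
          case True
          have "cmod (v z) \<le> B ^ N"
            using uB[OF q(1) True] q qU by (simp add: v_def norm_power power_mono)
          then have "(cmod (v z))\<^sup>2 \<le> (B ^ N)\<^sup>2" by (intro power_mono) auto
          moreover have "\<delta> - \<psi> z \<le> D" using y0(2)[OF z(1)] by (simp add: D_def)
          ultimately have "F z \<le> (B ^ N)\<^sup>2 * D" unfolding F_def using \<psi>0 by (intro mult_mono) auto
          then show False using n' by simp
        next
          case False
          have "dist z ?z0 < r"
          proof (rule ccontr)
            assume "\<not> ?thesis"
            then have "\<epsilon> * \<rho> q \<ge> \<delta>" unfolding \<delta>_def using \<rho>_ge[OF qU] q \<epsilon>(1) by (intro mult_left_mono) auto
            then show False using False \<psi>0 q qU by (simp add: \<psi>_def)
          qed
          then have q\<omega>: "q \<in> \<omega>" using q qU \<psi>0 by (simp add: \<omega>_def O'_def dist_commute)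
          have dz: "dist z ?z0 < d" using \<open>dist z ?z0 < r\<close> r by simp
          have CR: "fd v y (jvec c y) = \<i> * fd v y (vec c y)" if y: "y \<in> \<phi> ` \<omega>" for y c
          proof -
            obtain p where p: "p \<in> \<omega>" "y = \<phi> p" using y by blast
            have pW: "p \<in> W0" "p \<in> U" using p \<omega>W U by auto
            have "(u \<circ> \<Phi>) differentiable at y"
              using Cinf_on_differentiable[OF uC] pW p by auto
            \<comment> \<open>The derivative of a power is a multiple of that of u, so v inherits
              the CR equation.\<close>
            then have "fd v y w = of_nat N * fd (u \<circ> \<Phi>) y w * (u \<circ> \<Phi>) y ^ (N - 1)" for w
              unfolding v_def[abs_def] by (rule fd_power)
            then show ?thesis using CR_fun_vec[OF u U(1) pW] p(2) by simp
          qed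
          show False
          proof (rule no_local_max[OF f \<rho> h n conc[OF q(1)] m _ _ \<epsilon> c0 \<omega> \<omega>W _ q\<omega> _ CR \<psi>_def])
            show "m * (\<Sum>i<2*n. (c i)\<^sup>2) \<le> (\<Sum>i<2*n. \<Sum>j<2*n. c i * c j * gmat h i j (\<phi> q))" for c
              using d(2)[OF dz] q(2) by blast
            show "\<bar>?H i j (\<phi> q)\<bar> \<le> C" if "i < 2 * n" "j < 2 * n" for i j
              using d(2)[OF dz] q(2) that by (simp add: less_imp_le)
            show "\<omega> \<subseteq> V" using \<omega>W WV by auto
            show "Cinf_on (\<phi> ` \<omega>) v" by (rule Cinf_on_subset[OF vC image_mono[OF \<omega>W]])
            show "(cmod (v y))\<^sup>2 * (\<delta> - \<psi> y) \<le> (cmod (v (\<phi> q)))\<^sup>2 * (\<delta> - \<psi> (\<phi> q))" if "y \<in> \<phi> ` \<omega>" for y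
              using z(2)[of y] \<omega>K that q(2) by (auto simp: F_def)
            show "v (\<phi> q) \<noteq> 0" "\<psi> (\<phi> q) < \<delta>" using v0 \<psi>0 q(2) by auto
          qed
        qed
      qed
      then show ?thesis using z(2)[OF y] by (simp add: F_def v_def norm_power)
    qed
    have "cmod ((u \<circ> \<Phi>) (\<phi> p0)) \<le> B"
    proof (rule le_of_power_bounds[OF norm_ge_zero B _ bound[OF \<omega>K[OF p0]]])
      show "0 < \<delta> - \<psi> (\<phi> p0)" using p0 by (simp add: \<omega>_def O'_def)
    qed
    then show ?thesis using p0 by (simp add: \<omega>_def)
  qed
  ultimately show ?thesis using \<omega> \<omega>W by (intro exI[of _ \<omega>]) blast
qed

end

theorem lemma3p2:
  fixes M :: "('a::t2_space, 'e::euclidean_space) cr_struct"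
    and n k :: nat
    and h :: "'a \<Rightarrow> 'a tvec \<Rightarrow> 'a tvec \<Rightarrow> complex"
    and Y U :: "'a set"
    and a :: 'a
  assumes "CR_manifold n k M"
    and "property_E TYPE('b::t2_space) TYPE('m::finite) n k M"
    and "hermitian_metric M h"
    and "open Y"
    and "smooth_boundary (atl M) Y"
    and "a \<in> frontier Y"
    and "strongly_pseudoconcave_at n M h Y a"
    and "open U"
    and "a \<in> U"
  shows "\<exists>\<omega>. open \<omega> \<and> a \<in> \<omega> \<and> \<omega> \<subseteq> U \<and>
    (\<forall>u. CR_fun M U u \<longrightarrow>
       (SUP p\<in>\<omega>. ereal (cmod (u p))) \<le> (SUP p\<in>Y \<inter> U. ereal (cmod (u p))))"
proof -
  have atlas: "smooth_atlas (atl M)" and sub: "smooth_subbundle (atl M) (2 * n) (hor M)"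
    using assms(1) by (auto simp: CR_manifold_def smooth_manifold_def)
  obtain U0 \<phi> where ch: "chart (atl M) U0 \<phi>" "a \<in> U0" using smooth_atlas_chart_at[OF atlas] by blast
  interpret chart "atl M" U0 \<phi> by (rule ch)
  obtain VE E where VE: "open VE \<and> a \<in> VE \<and>
      (\<forall>i<2*n. smooth_section (atl M) VE (tangent_space (atl M)) (E i)) \<and>
      (\<forall>q\<in>VE. hor M q = {lincomb (2 * n) (\<lambda>i. complex_of_real (c i)) (\<lambda>i. E i q) | c. True} \<and>
        (\<forall>c. lincomb (2 * n) (\<lambda>i. complex_of_real (c i)) (\<lambda>i. E i q) = (\<lambda>f. 0) \<longrightarrow> (\<forall>i<2*n. c i = 0)))"
    using sub[unfolded smooth_subbundle_def, THEN spec, of a] by (elim exE) (rule that)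
  then have E: "open VE" "a \<in> VE"
    "\<And>i. i < 2 * n \<Longrightarrow> smooth_section (atl M) VE (tangent_space (atl M)) (E i)"
    "\<And>q. q \<in> VE \<Longrightarrow> hor M q = {lincomb (2 * n) (\<lambda>i. complex_of_real (c i)) (\<lambda>i. E i q) | c. True}"
    "\<And>q c i. q \<in> VE \<Longrightarrow> lincomb (2 * n) (\<lambda>i. complex_of_real (c i)) (\<lambda>i. E i q) = (\<lambda>f. 0) \<Longrightarrow> i < 2 * n \<Longrightarrow> c i = 0"
    by simp_all
  have n: "2 \<le> n" using assms(7) by (simp add: strongly_pseudoconcave_at_def)
  obtain V jet lam c0 W where V: "open V" "a \<in> V" "transversal_jet M V jet" "CR_gauge M V lam"
    and YV: "Y \<inter> V = {p\<in>V. fst (jet lam) p < 0}" and c0: "c0 > 0" and W: "open W" "a \<in> W" "W \<subseteq> V"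
    and conc: "\<And>p \<xi>. p \<in> W \<Longrightarrow> \<xi> \<in> H0 M p \<Longrightarrow> jet_eigenvalues n M h V lam (jet lam) p \<xi> ! 1 \<le> - c0"
    using assms(7) unfolding strongly_pseudoconcave_at_def by blast
  define f where "f = fst (jet lam)"
  define \<eta> where "\<eta> = snd (jet lam)"
  define W0 where "W0 = U0 \<inter> VE \<inter> W \<inter> U"
  have W0: "open W0" "W0 \<subseteq> U0" "W0 \<subseteq> VE" "W0 \<subseteq> W" "W0 \<subseteq> U" "a \<in> W0" "W0 \<subseteq> V"
    using open_U0 E W assms(8,9) ch by (auto simp: W0_def)
  have fr: "cr_frame M U0 \<phi> n k W0 E"
  proof (intro cr_frame.intro ch cr_frame_axioms.intro assms(1) W0(1,2))
    show "smooth_section (atl M) W0 (tangent_space (atl M)) (E i)" if "i < 2 * n" for i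
      by (rule smooth_section_subset[OF E(3)[OF that] W0(3)])
    show "hor M q = {lincomb (2 * n) (\<lambda>i. complex_of_real (c i)) (\<lambda>i. E i q) | c. True}" if "q \<in> W0" for q
      using E(4) that W0(3) by blast
    show "c i = 0" if "q \<in> W0" "lincomb (2 * n) (\<lambda>i. complex_of_real (c i)) (\<lambda>i. E i q) = (\<lambda>f. 0)" "i < 2 * n" for q c i
      using E(5) that W0(3) by blast
  qed
  have jt: "smooth_fun (atl M) V f" "one_form (atl M) V \<eta>" "\<And>q. q \<in> V \<Longrightarrow> \<eta> q \<in> H0 M q"
    using V(3,4) unfolding transversal_jet_def f_def \<eta>_def by blast+
  have jet: "cr_jet M U0 \<phi> n k W0 E V lam f \<eta>"
    by (intro cr_jet.intro fr cr_jet_axioms.intro V(1,4) jt)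
  \<comment> \<open>Otherwise f would be positive near a, while a is a limit of points of Y, where f
    < 0.\<close>
  have "f a \<le> 0"
  proof (rule ccontr)
    assume "\<not> f a \<le> 0"
    then have pos: "f a > 0" by simp
    have "Cinf_on (\<phi> ` W0) (f \<circ> \<Phi>)"
      using smooth_iff[OF W0(1,2)] smooth_fun_subset[OF jt(1) W0(7)] by blast
    then have "continuous_on W0 ((f \<circ> \<Phi>) \<circ> \<phi>)"
      by (intro continuous_on_compose continuous_on_subset[OF continuous_\<phi> W0(2)] Cinf_on_continuous_on)
    then have "open (W0 \<inter> ((f \<circ> \<Phi>) \<circ> \<phi>) -` {0<..})" by (rule continuous_open_preimage[OF _ W0(1)]) auto
    moreover have "a \<in> W0 \<inter> ((f \<circ> \<Phi>) \<circ> \<phi>) -` {0<..}" using pos W0(6) ch(2) by simp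
    moreover have "a \<in> closure Y" using assms(6) by (simp add: frontier_def)
    ultimately have "(W0 \<inter> ((f \<circ> \<Phi>) \<circ> \<phi>) -` {0<..}) \<inter> Y \<noteq> {}"
      using open_Int_closure_eq_empty by blast
    then obtain p where p: "p \<in> Y" "p \<in> W0" "f (\<Phi> (\<phi> p)) > 0" by auto
    then have "f p > 0" using W0(2) by auto
    moreover have "p \<in> Y \<inter> V" using p W0(7) by auto
    then have "f p < 0" unfolding YV f_def by simp
    ultimately show False by simp
  qed
  have conc': "jet_eigenvalues n M h V lam (f, \<eta>) q \<xi> ! 1 \<le> - c0" if "q \<in> W0" "\<xi> \<in> H0 M q" for q \<xi>
    using conc[of q \<xi>] that W0(4) by (auto simp: f_def \<eta>_def)
  obtain \<omega> where "open \<omega> \<and> a \<in> \<omega> \<and> \<omega> \<subseteq> W0 \<and> (\<forall>u B. CR_fun M U u \<longrightarrow> 0 \<le> B \<longrightarrow>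
      (\<forall>p\<in>W0. f p < 0 \<longrightarrow> cmod (u p) \<le> B) \<longrightarrow> (\<forall>p\<in>\<omega>. cmod (u p) \<le> B))"
    using cr_frame.local_maximum_principle[OF fr jet assms(3) n _ c0 W0(6) \<open>f a \<le> 0\<close> W0(7) assms(8) W0(5)] conc'
    by (metis (no_types, lifting))
  then have \<omega>: "open \<omega>" "a \<in> \<omega>" "\<omega> \<subseteq> W0" and max: "\<And>u B p. CR_fun M U u \<Longrightarrow> 0 \<le> B \<Longrightarrow>
      (\<forall>p\<in>W0. f p < 0 \<longrightarrow> cmod (u p) \<le> B) \<Longrightarrow> p \<in> \<omega> \<Longrightarrow> cmod (u p) \<le> B"
    by simp_all
  have "(SUP p\<in>\<omega>. ereal (cmod (u p))) \<le> (SUP p\<in>Y \<inter> U. ereal (cmod (u p)))" if u: "CR_fun M U u" for u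
  \<comment> \<open>The local statement takes a real bound; an infinite right side leaves nothing to
    prove.\<close>
  proof (cases "(SUP p\<in>Y \<inter> U. ereal (cmod (u p))) = \<infinity>")
    case False
    let ?s = "SUP p\<in>Y \<inter> U. ereal (cmod (u p))"
    have "a \<in> closure Y" using assms(6) by (simp add: frontier_def)
    \<comment> \<open>A point of Y in U makes the supremum nonnegative, hence a real number B \<ge>
      0 when it is not infinite.\<close>
    then have "U \<inter> Y \<noteq> {}" using assms(8,9) open_Int_closure_eq_empty by blast
    then obtain y where y: "y \<in> Y \<inter> U" by blast
    have up: "ereal (cmod (u p)) \<le> ?s" if "p \<in> Y \<inter> U" for p using that by (rule SUP_upper)
    have "0 \<le> ?s" using order_trans[OF _ up[OF y], of 0] by simp
    then obtain B where B: "?s = ereal B" "0 \<le> B" using False by (cases ?s) auto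
    have "cmod (u p) \<le> B" if "p \<in> W0" "f p < 0" for p
    proof -
      have "p \<in> Y \<inter> V" unfolding YV using that W0(7) by (auto simp: f_def)
      then show ?thesis using up[of p] that W0(5) B(1) by auto
    qed
    then have "cmod (u p) \<le> B" if "p \<in> \<omega>" for p using max[OF u B(2) _ that] by blast
    then show ?thesis unfolding B(1) by (intro SUP_least) simp
  qed simp
  then show ?thesis using \<omega> W0(5) by (intro exI[of _ \<omega>]) auto
qed

end
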